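(* Let $n\ge 1$ and let $\alpha\in(0,n+2)$, $\lambda>0$, $T>0$ and $\sigma$ be constants with $$0\le\sigma<g_\alpha(\lambda),$$ and let $\Omega$ be an open subset of $\mathbb{R}^n$. Suppose $u$ is a nonnegative function with $$u\in C^{2,1}(\mathbb{R}^n\times(0,T))\cap L^\lambda(\mathbb{R}^n\times(0,T))$$ satisfying $$0\le u_t-\Delta u\le \Big(\iint_{\mathbb{R}^n\times(0,T)}\Phi(x-y,t-s)^{\alpha/n}u(y,s)^\lambda\,dy\,ds\Big)\,u(x,t)^\sigma\quad\text{for }(x,t)\in\Omega\times(0,T).$$ Then for each compact subset $K$ of $\Omega$, as $t\to0^+$, $$\max_{x\in K}u(x,t)=O(t^{-n/2})\ \text{ if } 0<\lambda<\tfrac{n+2}{n},\qquad \max_{x\in K}u(x,t)=o\big(t^{-(n+2)/(2\lambda)}\big)\ \text{ if } \lambda\ge\tfrac{n+2}{n}.$$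
   Context: $\Phi$ is the heat kernel: $\Phi(x,t)=(4\pi t)^{-n/2}e^{-|x|^2/(4t)}$ for $(x,t)\in\mathbb{R}^n\times(0,\infty)$ and $\Phi(x,t)=0$ for $t\le 0$. For $\alpha\in(0,n+2)$, $g_\alpha:(0,\infty)\to[0,\infty)$ is defined by $g_\alpha(\lambda)=\frac{n+2}{n}$ if $0<\lambda<\frac{n+2-\alpha}{n}$; $g_\alpha(\lambda)=\frac{2(n+2)-\alpha}{n}-\lambda$ if $\frac{n+2-\alpha}{n}\le\lambda<\frac{n+2}{n}$; $g_\alpha(\lambda)=\max\{0,1-\frac{\alpha-2}{n+2}\lambda\}$ if $\lambda\ge\frac{n+2}{n}$. *)

theory Defs
  imports "HOL-Analysis.Analysis" "HOL-Library.Landau_Symbols"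
begin

definition heat_kernel :: "'a::euclidean_space \<Rightarrow> real \<Rightarrow> real" where
  "heat_kernel x t =
     (if t > 0 then (4 * pi * t) powr (- real DIM('a) / 2) * exp (- (norm x)\<^sup>2 / (4 * t)) else 0)"

definition g_alpha :: "nat \<Rightarrow> real \<Rightarrow> real \<Rightarrow> real" where
  "g_alpha n \<alpha> lam =
     (if lam < (real n + 2 - \<alpha>) / real n then (real n + 2) / real n
      else if lam < (real n + 2) / real n then (2 * (real n + 2) - \<alpha>) / real n - lam
      else max 0 (1 - (\<alpha> - 2) / (real n + 2) * lam))"

definition C21_on :: "('a::euclidean_space \<Rightarrow> real \<Rightarrow> real) \<Rightarrow> real \<Rightarrow>
    ('a \<Rightarrow> real \<Rightarrow> real) \<Rightarrow> ('a \<Rightarrow> real \<Rightarrow> 'a) \<Rightarrow> ('a \<Rightarrow> real \<Rightarrow> 'a \<Rightarrow> 'a) \<Rightarrow> bool" where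
  "C21_on u T ut ux uxx \<longleftrightarrow>
     (\<forall>x. \<forall>t\<in>{0<..<T}.
        ((\<lambda>s. u x s) has_real_derivative ut x t) (at t) \<and>
        ((\<lambda>y. u y t) has_derivative (\<lambda>h. ux x t \<bullet> h)) (at x) \<and>
        ((\<lambda>y. ux y t) has_derivative uxx x t) (at x)) \<and>
     continuous_on (UNIV \<times> {0<..<T}) (\<lambda>(x, t). u x t) \<and>
     continuous_on (UNIV \<times> {0<..<T}) (\<lambda>(x, t). ut x t) \<and>
     continuous_on (UNIV \<times> {0<..<T}) (\<lambda>(x, t). ux x t) \<and>
     (\<forall>i\<in>Basis. continuous_on (UNIV \<times> {0<..<T}) (\<lambda>(x, t). uxx x t i))"

definition laplacian_of :: "('a::euclidean_space \<Rightarrow> real \<Rightarrow> 'a \<Rightarrow> 'a) \<Rightarrow> 'a \<Rightarrow> real \<Rightarrow> real" where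
  "laplacian_of uxx x t = (\<Sum>i\<in>Basis. uxx x t i \<bullet> i)"

end

theory Submission
  imports Defs
begin

text \<open>
  Write \<open>n\<close> for the dimension, \<open>f = u_t - \<Delta>u\<close> and \<open>Q_\<rho>(x,t)\<close> for the backward parabolic cylinder. Testing the
  equation with a truncated backward heat kernel gives
  \<open>u(x,t) \<le> C (\<rho>^(-n-2) \<integral>\<integral>_Q_\<rho> u + \<integral>\<integral>_Q_\<rho> \<Phi> f)\<close>. At a maximum point of \<open>d^p u\<close>, where \<open>d\<close> is the
  parabolic distance to the boundary of a cylinder of size \<open>\<surd>t\<close>, the function \<open>u\<close> is at most \<open>2^p\<close> times
  its maximum value \<open>A\<close> on a smaller cylinder. There the nonlocal term splits into a near part of size
  \<open>A^\<lambda> \<rho>^(n+2-\<alpha>)\<close> and a far part \<open>O(\<rho>^-\<beta>)\<close>. Choosing \<open>\<rho>\<close> so that the mean value term equals \<open>A/4\<close>, the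
  condition on \<open>\<sigma>\<close> says exactly that the potential of \<open>f\<close> is eventually smaller than \<open>A/2\<close>, a
  contradiction. The weight is \<open>p = n\<close> if \<open>\<lambda> < (n+2)/n\<close>, where the local mass of \<open>u\<close> stays bounded, and
  \<open>p = (n+2)/\<lambda>\<close> otherwise, where smallness comes from \<open>u \<in> L^\<lambda>\<close>. In the first case the far part is controlled
  because \<open>u\<close> is bounded by the heat potential of a finite measure.
\<close>

section \<open>Integration by parts against radial weights\<close>

text \<open>With A = b rho^(-p), the scaling forced by equating the mean value term with A/4, the
  near part contributes rho^2 A^(lam+sigma) rho^(n+2-alpha) to the potential of f and the far part
  rho^(2-beta) A^sigma. Relative to A these are powers of rho with exponents 2 + (n+2-alpha) +
  (1-sigma-lam)p and 2 - beta + (1-sigma)p, which must be positive. For p = (n+2)/lam and beta =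
  alpha the two exponents coincide, and positivity is the last branch of \<open>g_alpha\<close>. For
  p = n the first gives sigma + lam < (2(n+2)-alpha)/n, but beta = alpha would cost too much in the
  second. So Phi^(alpha/n) is split into the powers beta/n and gamma/n with alpha = beta + gamma,
  and the gamma power is spent on a potential of u^lam that is bounded while gamma + n lam < n+2; a
  suitable gamma exists when moreover sigma < (n+2)/n. The obstacle behind the localisation is that
  the differential inequality holds only over Omega and nothing is known at t = 0: masses are
  bounded backward from a later time, and away from Omega u enters only through its L^lam
  integral.\<close>

lemma set_nn_integral_cbox_continuous:
  fixes g :: "'b::euclidean_space \<Rightarrow> real"
  assumes "continuous_on (cbox a b) g" and "\<And>x. x \<in> cbox a b \<Longrightarrow> 0 \<le> g x"
  shows "(\<integral>\<^sup>+x\<in>cbox a b. ennreal (g x) \<partial>lborel) = ennreal (integral (cbox a b) g)"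
proof -
  have si: "set_integrable lborel (cbox a b) g"
    unfolding set_integrable_def by (intro borel_integrable_compact assms compact_cbox)
  have "(\<integral>\<^sup>+x\<in>cbox a b. ennreal (g x) \<partial>lborel) = (\<integral>\<^sup>+x. ennreal (indicator (cbox a b) x *\<^sub>R g x) \<partial>lborel)"
    by (intro nn_integral_cong) (auto simp: indicator_def)
  also have "\<dots> = ennreal (LINT x:cbox a b|lborel. g x)"
    unfolding set_lebesgue_integral_def
    using si assms(2) by (intro nn_integral_eq_integral) (auto simp: set_integrable_def indicator_def)
  finally show ?thesis using set_borel_integral_eq_integral(2)[OF si] by simp
qed

text \<open>The Leibniz rule and the fundamental theorem are applied to gauge integrals over boxes,
  whereas all estimates use nonnegative integrals. Since \<open>ennreal\<close> sends negative
  numbers to 0, the right side integrates the positive part of \<open>g\<close>, so this direction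
  needs no sign condition; it is applied to integrands of unknown sign.\<close>

lemma integral_le_set_nn_integral:
  fixes g :: "'b::euclidean_space \<Rightarrow> real"
  assumes "continuous_on (cbox a b) g"
  shows "ennreal (integral (cbox a b) g) \<le> (\<integral>\<^sup>+x\<in>cbox a b. ennreal (g x) \<partial>lborel)"
proof -
  have c: "continuous_on (cbox a b) (\<lambda>x. max 0 (g x))"
    using assms by (intro continuous_intros)
  have "integral (cbox a b) g \<le> integral (cbox a b) (\<lambda>x. max 0 (g x))"
    using assms c by (intro integral_le integrable_continuous) auto
  then have "ennreal (integral (cbox a b) g) \<le> ennreal (integral (cbox a b) (\<lambda>x. max 0 (g x)))"
    by (rule ennreal_leI)
  also have "\<dots> = (\<integral>\<^sup>+x\<in>cbox a b. ennreal (max 0 (g x)) \<partial>lborel)"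
    using set_nn_integral_cbox_continuous[OF c] by simp
  also have "\<dots> = (\<integral>\<^sup>+x\<in>cbox a b. ennreal (g x) \<partial>lborel)"
    by (intro nn_integral_cong) (auto simp: max_def ennreal_neg)
  finally show ?thesis .
qed

lemma lborel_integral_translate:
  fixes F :: "'a::euclidean_space \<Rightarrow> real"
  assumes "F \<in> borel_measurable borel"
  shows "(LINT y|lborel. F (y + c)) = (LINT y|lborel. F y)"
proof -
  have "(LINT y|lborel. F y) = (LINT y|distr lborel borel ((+) c). F y)"
    by (simp add: lborel_distr_plus)
  also have "\<dots> = (LINT y|lborel. F (c + y))"
    using assms by (subst integral_distr) auto
  finally show ?thesis by (simp add: add.commute)
qed

text \<open>Translation invariance of Lebesgue measure replaces the divergence theorem: while |h| <=
  1 the translate of \<open>F\<close> is still supported in the box, so its integral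
  \<open>G h\<close> does not depend on h; differentiating under the integral sign at h = 0 gives 0.
  The margin 1 in \<open>cball x (r + 1)\<close> is the room for these shifts.\<close>

lemma integral_cbox_directional_derivative_eq_0:
  fixes F F' :: "'a::euclidean_space \<Rightarrow> real"
  assumes der: "\<And>y h. ((\<lambda>h. F (y + h *\<^sub>R i)) has_real_derivative F' (y + h *\<^sub>R i)) (at h)"
    and F: "continuous_on UNIV F" and F': "continuous_on UNIV F'"
    and supp: "\<And>y. y \<notin> cball x r \<Longrightarrow> F y = 0" and i: "norm i = 1"
    and box: "cball x (r + 1) \<subseteq> cbox a b"
  shows "integral (cbox a b) F' = 0"
proof -
  define G where "G h = integral (cbox a b) (\<lambda>y. F (y + h *\<^sub>R i))" for h :: real
  have Fm: "F \<in> borel_measurable borel" using F by (rule borel_measurable_continuous_onI)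
  have G: "G h = (LINT y|lborel. F y)" if h: "h \<in> {-1..1}" for h
  proof -
    have c: "continuous_on UNIV (\<lambda>y. F (y + h *\<^sub>R i))"
      by (rule continuous_on_compose2[OF F]) (auto intro!: continuous_intros)
    have si: "set_integrable lborel (cbox a b) (\<lambda>y. F (y + h *\<^sub>R i))"
      unfolding set_integrable_def
      by (intro borel_integrable_compact compact_cbox continuous_on_subset[OF c]) auto
    have z: "F (y + h *\<^sub>R i) = 0" if "y \<notin> cbox a b" for y
    proof (rule supp)
      have "r + 1 < dist x y" using that box by (meson linorder_not_le mem_cball subsetD)
      moreover have "dist x y \<le> dist x (y + h *\<^sub>R i) + norm (h *\<^sub>R i)"
        by (metis add_diff_cancel_left' dist_norm dist_triangle norm_minus_commute dist_commute)
      moreover have "norm (h *\<^sub>R i) \<le> 1" using h i by auto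
      ultimately show "y + h *\<^sub>R i \<notin> cball x r" by auto
    qed
    have "G h = (LINT y:cbox a b|lborel. F (y + h *\<^sub>R i))"
      using set_borel_integral_eq_integral(2)[OF si] by (simp add: G_def)
    also have "\<dots> = (LINT y|lborel. F (y + h *\<^sub>R i))"
      unfolding set_lebesgue_integral_def
      by (intro Bochner_Integration.integral_cong) (auto simp: indicator_def z)
    finally show ?thesis using lborel_integral_translate[OF Fm] by simp
  qed
  have "(G has_field_derivative integral (cbox a b) (\<lambda>y. F' (y + 0 *\<^sub>R i))) (at 0 within {-1..1})"
    unfolding G_def
  proof (rule leibniz_rule_field_derivative[where fx = "\<lambda>h y. F' (y + h *\<^sub>R i)"])
    show "((\<lambda>h. F (y + h *\<^sub>R i)) has_real_derivative F' (y + h *\<^sub>R i)) (at h within {-1..1})" for h y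
      using der by (rule has_field_derivative_at_within)
    show "(\<lambda>y. F (y + h *\<^sub>R i)) integrable_on cbox a b" for h
      by (intro integrable_continuous continuous_on_compose2[OF F]) (auto intro!: continuous_intros)
    show "continuous_on ({-1..1} \<times> cbox a b) (\<lambda>(h, y). F' (y + h *\<^sub>R i))"
      unfolding case_prod_unfold
      by (rule continuous_on_compose2[OF F']) (auto intro!: continuous_intros)
  qed auto
  then have "(G has_field_derivative integral (cbox a b) F') (at 0)"
    by (subst (asm) at_within_Icc_at) auto
  moreover have "(G has_field_derivative 0) (at 0)"
  proof (rule has_field_derivative_transform_within_open)
    show "((\<lambda>h. LINT y|lborel. F y) has_field_derivative 0) (at 0)" by simp
    show "open {-1<..<1::real}" by simp
  qed (auto simp: G)
  ultimately show ?thesis by (rule DERIV_unique)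
qed

text \<open>The factor of \<open>v\<close> on the right is the Laplacian of the radial weight \<open>y \<mapsto> Z (|y - x|\<^sup>2)\<close>.\<close>

lemma green_identity_radial:
  fixes v :: "'a::euclidean_space \<Rightarrow> real" and g :: "'a \<Rightarrow> 'a" and h :: "'a \<Rightarrow> 'a \<Rightarrow> 'a"
  assumes v: "\<And>y. (v has_derivative (\<lambda>k. g y \<bullet> k)) (at y)"
    and g: "\<And>y. (g has_derivative h y) (at y)"
    and h: "\<And>i. i \<in> Basis \<Longrightarrow> continuous_on UNIV (\<lambda>y. h y i)"
    and Z: "\<And>q. (Z has_real_derivative Z1 q) (at q)" "\<And>q. (Z1 has_real_derivative Z2 q) (at q)"
      "continuous_on UNIV Z2"
    and supp: "\<And>q. r\<^sup>2 \<le> q \<Longrightarrow> Z q = 0 \<and> Z1 q = 0" and r: "0 \<le> r"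
    and box: "cball x (r + 1) \<subseteq> cbox a b"
  shows "integral (cbox a b) (\<lambda>y. Z ((norm (y - x))\<^sup>2) * (\<Sum>i\<in>Basis. h y i \<bullet> i)) =
    integral (cbox a b) (\<lambda>y. (2 * real DIM('a) * Z1 ((norm (y - x))\<^sup>2)
      + 4 * (norm (y - x))\<^sup>2 * Z2 ((norm (y - x))\<^sup>2)) * v y)"
proof -
  define q where "q y = (norm (y - x))\<^sup>2" for y
  \<comment> \<open>\<open>F i\<close> is component i of v grad W - W grad v for the weight W(y) =
    Z(|y - x|^2), whose gradient is 2 (y - x) Z1. In its i-th partial derivative \<open>F' i\<close>
    the products of first derivatives cancel.\<close>
  define F where "F i y = v y * (2 * ((y - x) \<bullet> i) * Z1 (q y)) - Z (q y) * (g y \<bullet> i)" for i y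
  define F' where "F' i y = v y * (2 * Z1 (q y) + 4 * ((y - x) \<bullet> i)\<^sup>2 * Z2 (q y)) - Z (q y) * (h y i \<bullet> i)" for i y
  have cv: "continuous_on UNIV v" by (rule has_derivative_continuous_on) (rule v)
  have cg: "continuous_on UNIV g" by (rule has_derivative_continuous_on) (rule g)
  have cq: "continuous_on UNIV q" unfolding q_def by (intro continuous_intros)
  have cZ: "continuous_on UNIV Z" "continuous_on UNIV Z1"
    using DERIV_continuous_on[of UNIV, OF Z(1)] DERIV_continuous_on[of UNIV, OF Z(2)] by simp_all
  have cZq: "continuous_on UNIV (\<lambda>y. Z (q y))" "continuous_on UNIV (\<lambda>y. Z1 (q y))"
      "continuous_on UNIV (\<lambda>y. Z2 (q y))"
    using cZ Z(3) cq by (auto intro: continuous_on_compose2)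
  have cF: "continuous_on UNIV (F i)" for i
    unfolding F_def by (intro continuous_intros cv cg cZq)
  have cF': "continuous_on UNIV (F' i)" if "i \<in> Basis" for i
    unfolding F'_def by (intro continuous_intros cv cg cZq h that)
  have int0: "integral (cbox a b) (F' i) = 0" if i: "i \<in> Basis" for i
  proof (rule integral_cbox_directional_derivative_eq_0[where F = "F i" and i = i and x = x and r = r])
    fix y s
    have line: "((\<lambda>s. y + s *\<^sub>R i) has_derivative (\<lambda>k. k *\<^sub>R i)) (at s)"
      by (auto intro!: derivative_eq_intros)
    have dv: "((\<lambda>s. v (y + s *\<^sub>R i)) has_real_derivative g (y + s *\<^sub>R i) \<bullet> i) (at s)"
      using has_derivative_compose[OF line v[of "y + s *\<^sub>R i"]]
      by (simp add: has_field_derivative_def mult.commute[of _ "_ \<bullet> _"])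
    have "((\<lambda>s. g (y + s *\<^sub>R i)) has_derivative (\<lambda>k. h (y + s *\<^sub>R i) (k *\<^sub>R i))) (at s)"
      using has_derivative_compose[OF line g[of "y + s *\<^sub>R i"]] by simp
    then have "((\<lambda>s. g (y + s *\<^sub>R i) \<bullet> i) has_derivative (\<lambda>k. h (y + s *\<^sub>R i) (k *\<^sub>R i) \<bullet> i)) (at s)"
      by (intro has_derivative_inner_left)
    moreover have "h (y + s *\<^sub>R i) (k *\<^sub>R i) = k *\<^sub>R h (y + s *\<^sub>R i) i" for k
      using linear_cmul[OF bounded_linear.linear[OF has_derivative_bounded_linear[OF g]]] by simp
    ultimately have dg: "((\<lambda>s. g (y + s *\<^sub>R i) \<bullet> i) has_real_derivative h (y + s *\<^sub>R i) i \<bullet> i) (at s)"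
      by (simp add: has_field_derivative_def mult.commute[of _ "_ \<bullet> _"])
    have qe: "q (y + s *\<^sub>R i) = (norm (y - x))\<^sup>2 + 2 * s * ((y - x) \<bullet> i) + s\<^sup>2" for s
      using i unfolding q_def power2_norm_eq_inner
      by (simp add: inner_simps inner_commute algebra_simps power2_eq_square)
    have le: "(y + s *\<^sub>R i - x) \<bullet> i = (y - x) \<bullet> i + s" for s
      using i by (simp add: inner_simps algebra_simps)
    have dq: "((\<lambda>s. q (y + s *\<^sub>R i)) has_real_derivative 2 * ((y + s *\<^sub>R i - x) \<bullet> i)) (at s)"
      unfolding qe le by (auto intro!: derivative_eq_intros)
    have dl: "((\<lambda>s. (y + s *\<^sub>R i - x) \<bullet> i) has_real_derivative 1) (at s)"
      unfolding le by (auto intro!: derivative_eq_intros)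
    note dZ = DERIV_chain2[OF Z(1) dq] DERIV_chain2[OF Z(2) dq]
    show "((\<lambda>s. F i (y + s *\<^sub>R i)) has_real_derivative F' i (y + s *\<^sub>R i)) (at s)"
      unfolding F_def F'_def
      by (rule derivative_eq_intros dv dg dZ dl refl)+ (simp add: algebra_simps power2_eq_square)
  next
    fix y assume "y \<notin> cball x r"
    then have "r \<le> norm (y - x)" by (simp add: dist_norm norm_minus_commute)
    then have "r\<^sup>2 \<le> q y" unfolding q_def using r by (intro power_mono)
    then show "F i y = 0" using supp by (simp add: F_def)
  qed (use i cF cF' box in auto)
  have sumF: "(\<Sum>i\<in>Basis. F' i y) =
      (2 * real DIM('a) * Z1 (q y) + 4 * q y * Z2 (q y)) * v y - Z (q y) * (\<Sum>i\<in>Basis. h y i \<bullet> i)" for y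
  proof -
    have "(\<Sum>i\<in>Basis. ((y - x) \<bullet> i)\<^sup>2) = q y"
      unfolding q_def power2_norm_eq_inner by (subst euclidean_inner) (simp add: power2_eq_square)
    then show ?thesis
      unfolding F'_def
      by (simp add: sum_subtractf sum.distrib algebra_simps flip: sum_distrib_left sum_distrib_right)
  qed
  have "0 = integral (cbox a b) (\<lambda>y. \<Sum>i\<in>Basis. F' i y)"
    using int0 by (subst integral_sum)
      (auto intro!: integrable_continuous continuous_on_subset[OF cF' subset_UNIV])
  also have "\<dots> = integral (cbox a b) (\<lambda>y. (2 * real DIM('a) * Z1 (q y) + 4 * q y * Z2 (q y)) * v y)
      - integral (cbox a b) (\<lambda>y. Z (q y) * (\<Sum>i\<in>Basis. h y i \<bullet> i))"
    unfolding sumF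
  proof (intro Henstock_Kurzweil_Integration.integral_diff integrable_continuous)
    have "continuous_on UNIV (\<lambda>y. (2 * real DIM('a) * Z1 (q y) + 4 * q y * Z2 (q y)) * v y)"
      by (intro continuous_intros cZq cq cv)
    then show "continuous_on (cbox a b) (\<lambda>y. (2 * real DIM('a) * Z1 (q y) + 4 * q y * Z2 (q y)) * v y)"
      by (rule continuous_on_subset) simp
    have "continuous_on UNIV (\<lambda>y. Z (q y) * (\<Sum>i\<in>Basis. h y i \<bullet> i))"
      by (intro continuous_intros cZq h)
    then show "continuous_on (cbox a b) (\<lambda>y. Z (q y) * (\<Sum>i\<in>Basis. h y i \<bullet> i))"
      by (rule continuous_on_subset) simp
  qed
  finally show ?thesis by (simp add: q_def)
qed

section \<open>The heat kernel\<close>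

declare borel_open[OF open_ball, measurable] borel_closed[OF closed_cball, measurable]

section \<open>Twice differentiable cutoffs\<close>

text \<open>At the kink the difference quotient is (max 0 h)^k, which tends to 0 because k >= 1.
  Applied twice, this makes the cube of a positive part twice continuously differentiable, so
  piecewise polynomial cutoffs suffice wherever only two derivatives are taken.\<close>

lemma has_real_derivative_max_0_power:
  assumes "0 < k"
  shows "((\<lambda>x. (max 0 x) ^ Suc k) has_real_derivative real (Suc k) * (max 0 x) ^ k) (at x)"
proof -
  consider "x < 0" | "x = 0" | "0 < x" by linarith
  then show ?thesis
  proof cases
    case 1
    show ?thesis
      by (rule has_field_derivative_transform_within_open[where f = "\<lambda>x. 0" and S = "{..<0}"])
        (use 1 assms in \<open>auto simp: max_def power_0_left\<close>)
  next
    case 3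
    have "((\<lambda>x. x ^ Suc k) has_real_derivative real (Suc k) * (max 0 x) ^ k) (at x)"
      using 3 DERIV_pow[of "Suc k" x] by (simp add: max_def)
    then show ?thesis
      by (rule has_field_derivative_transform_within_open[where S = "{0<..}"])
        (use 3 in \<open>auto simp: max_def\<close>)
  next
    case 2
    have "(max 0 0 :: real) ^ k = 0" using assms by simp
    moreover have "((\<lambda>h::real. (max 0 h) ^ k) \<longlongrightarrow> (max 0 0) ^ k) (at 0)"
      by (intro tendsto_intros)
    ultimately have "((\<lambda>h::real. (max 0 h) ^ k) \<longlongrightarrow> 0) (at 0)" by metis
    then have "((\<lambda>h::real. (max 0 h) ^ Suc k / h) \<longlongrightarrow> 0) (at 0)"
      by (rule Lim_transform_eventually)
        (use assms in \<open>auto simp: eventually_at_filter max_def intro!: always_eventually\<close>)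
    then show ?thesis using 2 assms by (simp add: DERIV_def power_0_left)
  qed
qed

text \<open>The argument q stands for |y - x|^2 / r^2, so 1/4 corresponds to half the radius. The
  witness is (1 - m^3)_+^3, where m vanishes up to q = 1/4 and reaches 1 at q = 1; the inner cube
  smooths the join at 1/4, the outer cube the one at 1.\<close>

lemma C2_cutoff:
  obtains \<psi> \<psi>1 \<psi>2 :: "real \<Rightarrow> real" and C :: real
  where "\<And>q. (\<psi> has_real_derivative \<psi>1 q) (at q)" "\<And>q. (\<psi>1 has_real_derivative \<psi>2 q) (at q)"
    "continuous_on UNIV \<psi>2" "\<And>q. 0 \<le> \<psi> q" "\<And>q. \<psi> q \<le> 1" "\<And>q. q \<le> 1/4 \<Longrightarrow> \<psi> q = 1"
    "\<And>q. 1 \<le> q \<Longrightarrow> \<psi> q = 0" "\<And>q. q \<le> 1/4 \<or> 1 \<le> q \<Longrightarrow> \<psi>1 q = 0 \<and> \<psi>2 q = 0"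
    "0 < C" "\<And>q. \<bar>\<psi>1 q\<bar> \<le> C" "\<And>q. \<bar>\<psi>2 q\<bar> \<le> C"
proof -
  define m where "m q = max 0 ((4 * q - 1) / 3 :: real)" for q
  define M where "M q = max 0 (1 - m q ^ 3)" for q
  have line: "((\<lambda>q. (4 * q - 1) / 3 :: real) has_real_derivative 4/3) (at q)" for q
    by (auto intro!: derivative_eq_intros)
  have m3: "((\<lambda>q. m q ^ 3) has_real_derivative 4 * m q ^ 2) (at q)" for q
    using DERIV_chain2[OF has_real_derivative_max_0_power[of 2] line[of q]]
    by (simp add: m_def eval_nat_numeral)
  have m2: "((\<lambda>q. m q ^ 2) has_real_derivative 8/3 * m q) (at q)" for q
    using DERIV_chain2[OF has_real_derivative_max_0_power[of 1] line[of q]]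
    by (simp add: m_def eval_nat_numeral)
  have in3: "((\<lambda>q. 1 - m q ^ 3) has_real_derivative - (4 * m q ^ 2)) (at q)" for q
    using DERIV_diff[OF DERIV_const m3[of q]] by simp
  have M3: "((\<lambda>q. M q ^ 3) has_real_derivative 3 * M q ^ 2 * (- (4 * m q ^ 2))) (at q)" for q
    using DERIV_chain2[OF has_real_derivative_max_0_power[of 2] in3[of q]]
    by (simp add: M_def eval_nat_numeral)
  have M2: "((\<lambda>q. M q ^ 2) has_real_derivative 2 * M q * (- (4 * m q ^ 2))) (at q)" for q
    using DERIV_chain2[OF has_real_derivative_max_0_power[of 1] in3[of q]]
    by (simp add: M_def eval_nat_numeral)
  have m0: "0 \<le> m q" and M01: "0 \<le> M q" "M q \<le> 1" for q
    by (auto simp: m_def M_def)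
  have Mm: "M q = 0 \<or> m q \<le> 1" for q
  proof (cases "m q \<le> 1")
    case False
    then have "1 \<le> m q ^ 3" by (intro one_le_power) auto
    then show ?thesis by (simp add: M_def)
  qed simp
  define \<psi>1 where "\<psi>1 q = 3 * M q ^ 2 * (- (4 * m q ^ 2))" for q
  define \<psi>2 where "\<psi>2 q = 96 * M q * m q ^ 4 - 32 * M q ^ 2 * m q" for q
  show ?thesis
  \<comment> \<open>128 = 96 + 32 adds the two coefficients of \<open>\<psi>2\<close>; wherever
    \<open>M\<close> is nonzero, both \<open>M\<close> and \<open>m\<close> lie between 0 and
    1.\<close>
  proof (rule that[of "\<lambda>q. M q ^ 3" \<psi>1 \<psi>2 128])
    show "((\<lambda>q. M q ^ 3) has_real_derivative \<psi>1 q) (at q)" for q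
      unfolding \<psi>1_def by (rule M3)
    show "(\<psi>1 has_real_derivative \<psi>2 q) (at q)" for q
      unfolding \<psi>1_def \<psi>2_def
      by (rule derivative_eq_intros M2 m2 refl)+ (simp add: algebra_simps power4_eq_xxxx power2_eq_square)
    show "continuous_on UNIV \<psi>2" unfolding \<psi>2_def m_def M_def by (intro continuous_intros) auto
    show "0 \<le> M q ^ 3" for q using M01 by simp
    show "M q ^ 3 \<le> 1" for q using M01 by (simp add: power_le_one)
    show "M q ^ 3 = 1" if "q \<le> 1/4" for q 
    proof -
      have "m q = 0" using that by (simp add: m_def)
      then show ?thesis by (simp add: M_def)
    qed
    have M_0: "M q = 0" if "1 \<le> q" for q
    proof -
      have "1 \<le> m q" using that by (simp add: m_def)
      then have "1 \<le> m q ^ 3" by (rule one_le_power)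
      then show ?thesis by (simp add: M_def)
    qed
    show "M q ^ 3 = 0" if "1 \<le> q" for q using M_0[OF that] by simp
    show "\<psi>1 q = 0 \<and> \<psi>2 q = 0" if "q \<le> 1/4 \<or> 1 \<le> q" for q
    proof -
      have "m q = 0 \<or> M q = 0" using that M_0[of q] by (auto simp: m_def)
      then show ?thesis by (auto simp: \<psi>1_def \<psi>2_def)
    qed
    show "\<bar>\<psi>1 q\<bar> \<le> 128" for q
    proof (cases "M q = 0")
      case False
      with Mm[of q] m0[of q] M01[of q] have "M q ^ 2 * m q ^ 2 \<le> 1"
        by (intro mult_le_one power_le_one) auto
      then show ?thesis by (simp add: \<psi>1_def abs_mult)
    qed (simp add: \<psi>1_def)
    show "\<bar>\<psi>2 q\<bar> \<le> 128" for q
    proof (cases "M q = 0")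
      case False
      with Mm[of q] m0[of q] M01[of q]
      have "M q * m q ^ 4 \<le> 1" "M q ^ 2 * m q \<le> 1" "0 \<le> M q * m q ^ 4" "0 \<le> M q ^ 2 * m q"
        by (auto intro!: mult_le_one power_le_one)
      then show ?thesis by (simp add: \<psi>2_def abs_le_iff)
    qed (simp add: \<psi>2_def)
  qed simp
qed

section \<open>Pointwise bounds for the heat kernel\<close>

lemma power2_powr:
  fixes y a :: real
  assumes "0 < y"
  shows "(y\<^sup>2) powr a = y powr (2 * a)"
  using assms by (simp add: powr_powr flip: powr_numeral)

text \<open>This is z <= exp z at z = w/a, raised to the power a.\<close>

lemma powr_le_exp:
  fixes w a :: real
  assumes "0 \<le> w" "0 < a"
  shows "w powr a \<le> a powr a * exp w"
proof -
  have "w / a \<le> exp (w / a)" using exp_ge_add_one_self[of "w / a"] by linarith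
  then have "(w / a) powr a \<le> exp (w / a) powr a" using assms by (intro powr_mono2) auto
  then have "w powr a / a powr a \<le> exp w" using assms by (simp add: powr_divide exp_powr_real)
  then show ?thesis using assms by (simp add: field_simps)
qed

lemma heat_kernel_nonneg [simp]: "0 \<le> heat_kernel x t"
  by (simp add: heat_kernel_def)

lemma heat_kernel_le_powr:
  fixes x :: "'a::euclidean_space"
  assumes "0 < t"
  shows "heat_kernel x t \<le> t powr (- real DIM('a) / 2)"
proof -
  have "(4 * pi * t) powr (- real DIM('a) / 2) \<le> t powr (- real DIM('a) / 2)"
    using assms pi_gt3 by (intro powr_mono2') (auto simp: field_simps)
  moreover have "exp (- (norm x)\<^sup>2 / (4 * t)) \<le> 1" using assms by simp
  ultimately have "(4 * pi * t) powr (- real DIM('a) / 2) * exp (- (norm x)\<^sup>2 / (4 * t))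
      \<le> t powr (- real DIM('a) / 2) * 1"
    by (intro mult_mono) auto
  then show ?thesis using assms by (simp add: heat_kernel_def)
qed

text \<open>With w = |x|^2/(4t) one has t^(-n/2) = 2^n |x|^(-n) w^(n/2), so time survives only in
  w^(n/2+k) exp(-w), which \<open>powr_le_exp\<close> bounds. The cases k = 0 and k = 1 are the ones
  used.\<close>

lemma heat_kernel_moment_bound:
  fixes x :: "'a::euclidean_space"
  assumes t: "0 < t" and x: "x \<noteq> 0" and k: "0 \<le> k"
  shows "heat_kernel x t * ((norm x)\<^sup>2 / (4 * t)) powr k \<le>
    2 powr real DIM('a) * (real DIM('a) / 2 + k) powr (real DIM('a) / 2 + k) * norm x powr (- real DIM('a))"
proof -
  define N where "N = real DIM('a)"
  have N: "0 < N" by (simp add: N_def)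
  define w where "w = (norm x)\<^sup>2 / (4 * t)"
  have w: "0 < w" using t x by (simp add: w_def)
  have tw: "t = (norm x / 2)\<^sup>2 / w" using t x by (simp add: w_def field_simps)
  have "t powr (- N / 2) = ((norm x / 2)\<^sup>2) powr (- N / 2) / w powr (- N / 2)"
    using w x by (simp add: tw powr_divide)
  also have "((norm x / 2)\<^sup>2) powr (- N / 2) = (norm x / 2) powr (- N)"
    using power2_powr[of "norm x / 2" "- N / 2"] x by simp
  also have "(norm x / 2) powr (- N) / w powr (- N / 2) = (norm x / 2) powr (- N) * w powr (N / 2)"
    by (simp add: powr_minus divide_simps)
  also have "(norm x / 2) powr (- N) = 2 powr N * norm x powr (- N)"
    using x by (simp add: powr_divide powr_minus field_simps)
  finally have tN: "t powr (- N / 2) = 2 powr N * norm x powr (- N) * w powr (N / 2)" .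
  have "heat_kernel x t \<le> t powr (- N / 2) * exp (- w)"
  proof -
    have "(4 * pi * t) powr (- N / 2) \<le> t powr (- N / 2)"
      using t N pi_gt3 by (intro powr_mono2') (auto simp: field_simps)
    then show ?thesis using t by (simp add: heat_kernel_def w_def N_def)
  qed
  then have "heat_kernel x t * w powr k \<le> t powr (- N / 2) * exp (- w) * w powr k"
    by (intro mult_right_mono) auto
  also have "\<dots> = 2 powr N * norm x powr (- N) * (w powr (N / 2 + k) * exp (- w))"
    unfolding tN by (simp add: powr_add)
  also have "\<dots> \<le> 2 powr N * norm x powr (- N) * (N / 2 + k) powr (N / 2 + k)"
    using powr_le_exp[of w "N / 2 + k"] w N k
    by (intro mult_left_mono) (auto simp: exp_minus field_simps)
  finally show ?thesis by (simp add: w_def N_def mult_ac)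
qed

text \<open>Outside a cylinder of size rho the kernel is O(rho^(-n)): at large distance by the
  moment bound, at large time by t^(-n/2). The weighted version absorbs the factor |x|^2/t that
  arises when one derivative falls on the kernel and another on a cutoff.\<close>

lemma heat_kernel_off_diagonal:
  obtains C :: real where "0 < C"
    "\<And>(x::'a::euclidean_space) t \<rho>. 0 < \<rho> \<Longrightarrow> \<rho> \<le> norm x \<or> \<rho>\<^sup>2 \<le> t \<Longrightarrow>
       heat_kernel x t \<le> C * \<rho> powr (- real DIM('a))"
    "\<And>(x::'a) t \<rho>. 0 < \<rho> \<Longrightarrow> \<rho> \<le> norm x \<Longrightarrow> 0 < t \<Longrightarrow>
       heat_kernel x t * ((norm x)\<^sup>2 / t) \<le> C * \<rho> powr (- real DIM('a))"
proof -
  define N where "N = real DIM('a)"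
  have N: "0 < N" by (simp add: N_def)
  define C0 where "C0 k = 2 powr N * (N / 2 + k) powr (N / 2 + k)" for k
  have C0: "0 \<le> C0 k" for k by (simp add: C0_def)
  define C where "C = 1 + C0 0 + 4 * C0 1"
  have b: "heat_kernel x t * ((norm x)\<^sup>2 / (4 * t)) powr k \<le> C0 k * \<rho> powr (- N)"
    if "0 < \<rho>" "\<rho> \<le> norm x" "0 < t" "0 \<le> k" for x :: 'a and t \<rho> k
  proof -
    have "heat_kernel x t * ((norm x)\<^sup>2 / (4 * t)) powr k \<le> C0 k * norm x powr (- N)"
      unfolding C0_def N_def using that by (intro heat_kernel_moment_bound) auto
    also have "\<dots> \<le> C0 k * \<rho> powr (- N)"
      using that N C0 by (intro mult_left_mono powr_mono2') auto
    finally show ?thesis .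
  qed
  show ?thesis
  proof (rule that[of C])
    show "0 < C" using C0[of 0] C0[of 1] by (simp add: C_def)
  next
    fix x :: 'a and t \<rho> :: real assume *: "0 < \<rho>" "\<rho> \<le> norm x \<or> \<rho>\<^sup>2 \<le> t"
    have C: "C0 0 \<le> C" "1 \<le> C" using C0[of 0] C0[of 1] by (auto simp: C_def)
    consider "t \<le> 0" | "0 < t" "\<rho> \<le> norm x" | "0 < t" "\<rho>\<^sup>2 \<le> t" using * by fastforce
    then show "heat_kernel x t \<le> C * \<rho> powr (- real DIM('a))"
    proof cases
      case 1 then show ?thesis using C by (simp add: heat_kernel_def)
    next
      case 2
      then have "heat_kernel x t \<le> C0 0 * \<rho> powr (- N)" using b[of \<rho> x t 0] *(1) by (cases "x = 0") auto
      also have "\<dots> \<le> C * \<rho> powr (- N)" using C by (intro mult_right_mono) auto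
      finally show ?thesis by (simp add: N_def)
    next
      case 3
      have "heat_kernel x t \<le> t powr (- N / 2)" unfolding N_def using 3 by (intro heat_kernel_le_powr)
      also have "\<dots> \<le> (\<rho>\<^sup>2) powr (- N / 2)" using 3 N * by (intro powr_mono2') auto
      also have "\<dots> = 1 * \<rho> powr (- N)" using * by (simp add: powr_powr flip: powr_numeral)
      also have "\<dots> \<le> C * \<rho> powr (- N)" using C by (intro mult_right_mono) auto
      finally show ?thesis by (simp add: N_def)
    qed
  next
    fix x :: 'a and t \<rho> :: real assume *: "0 < \<rho>" "\<rho> \<le> norm x" "0 < t"
    then have "heat_kernel x t * ((norm x)\<^sup>2 / t) \<le> 4 * C0 1 * \<rho> powr (- N)"
      using b[of \<rho> x t 1] by (simp add: field_simps)
    also have "\<dots> \<le> C * \<rho> powr (- N)" using C0[of 0] by (intro mult_right_mono) (auto simp: C_def)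
    finally show "heat_kernel x t * ((norm x)\<^sup>2 / t) \<le> C * \<rho> powr (- real DIM('a))" by (simp add: N_def)
  qed
qed

lemma heat_kernel_measurable [measurable (raw)]:
  fixes X :: "'b \<Rightarrow> 'a::euclidean_space"
  assumes [measurable]: "X \<in> borel_measurable M" "Y \<in> borel_measurable M"
  shows "(\<lambda>z. heat_kernel (X z) (Y z)) \<in> borel_measurable M"
  unfolding heat_kernel_def by measurable

section \<open>Integrals of powers of the heat kernel\<close>

lemma nn_integral_lborel_scale:
  fixes g :: "'a::euclidean_space \<Rightarrow> ennreal"
  assumes [measurable]: "g \<in> borel_measurable borel" and c: "0 < c"
  shows "(\<integral>\<^sup>+y. g y \<partial>lborel) = ennreal (c ^ DIM('a)) * (\<integral>\<^sup>+z. g (x + c *\<^sub>R z) \<partial>lborel)"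
  using c by (subst lborel_affine[of c x])
    (simp_all add: nn_integral_density nn_integral_distr nn_integral_cmult)

text \<open>Summation over shells: where k+1 <= |z| <= k+2 the Gaussian is at most K (k+1)^(-(n+2)),
  and the ball of radius k+2 has volume at most V 2^n (k+1)^n, which leaves the convergent sum of
  (k+1)^(-2).\<close>

lemma nn_integral_gaussian_finite:
  fixes c :: real
  assumes c: "0 < c"
  shows "(\<integral>\<^sup>+z. ennreal (exp (- c * (norm (z::'a::euclidean_space))\<^sup>2)) \<partial>lborel) < \<infinity>"
proof -
  define n where "n = DIM('a)"
  \<comment> \<open>Chosen so that (r^2)^a = r^(n+2).\<close>
  define a where "a = real n / 2 + 1"
  have a: "0 < a" by (simp add: a_def)
  define K where "K = a powr a * c powr (- a)"
  have K: "0 \<le> K" by (simp add: K_def)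
  have dec: "exp (- c * r\<^sup>2) \<le> K / real (Suc k) ^ (n + 2)" if "real (Suc k) \<le> r" for r k
  proof -
    have r: "0 < r" using that by linarith
    have "(c * r\<^sup>2) powr a \<le> a powr a * exp (c * r\<^sup>2)" using c a by (intro powr_le_exp) auto
    moreover have "(c * r\<^sup>2) powr a = c powr a * r ^ (n + 2)"
    proof -
      have "(r\<^sup>2) powr a = r powr (2 * a)"
        using r by (rule power2_powr)
      also have "2 * a = real (n + 2)" by (simp add: a_def)
      also have "r powr real (n + 2) = r ^ (n + 2)" using r by (rule powr_realpow)
      finally show ?thesis using r c by (simp add: powr_mult)
    qed
    ultimately have "exp (- c * r\<^sup>2) \<le> K / r ^ (n + 2)"
      using r c by (simp add: K_def exp_minus powr_minus field_simps)
    also have "\<dots> \<le> K / real (Suc k) ^ (n + 2)"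
      using that K by (intro divide_left_mono power_mono mult_pos_pos zero_less_power) auto
    finally show ?thesis .
  qed
  define V where "V = unit_ball_vol (real n)"
  have V: "0 \<le> V" by (simp add: V_def)
  have pw: "ennreal (exp (- c * (norm z)\<^sup>2)) \<le>
      indicator (cball 0 1) z + (\<Sum>k. ennreal (K / real (Suc k) ^ (n + 2)) * indicator (cball 0 (real k + 2)) z)"
    for z :: 'a
  proof (cases "norm z \<le> 1")
    case True
    then have "ennreal (exp (- c * (norm z)\<^sup>2)) \<le> indicator (cball 0 1) z"
      using c by (simp add: indicator_def)
    then show ?thesis using add_increasing2 zero_le by blast
  next
    case False
    define k where "k = nat (\<lfloor>norm z\<rfloor> - 1)"
    have k: "real (Suc k) \<le> norm z" "norm z \<le> real k + 2"
      using False unfolding k_def by linarith+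
    have "ennreal (exp (- c * (norm z)\<^sup>2)) \<le> ennreal (K / real (Suc k) ^ (n + 2)) * indicator (cball 0 (real k + 2)) z"
      using dec[OF k(1)] k(2) by (simp add: indicator_def ennreal_leI)
    also have "\<dots> \<le> (\<Sum>k. ennreal (K / real (Suc k) ^ (n + 2)) * indicator (cball 0 (real k + 2)) z)"
    proof -
      define w where "w k = ennreal (K / real (Suc k) ^ (n + 2)) * indicator (cball 0 (real k + 2)) z" for k
      have "w k \<le> suminf w" using sum_le_suminf[of w "{k}"] by simp
      then show ?thesis unfolding w_def .
    qed
    finally show ?thesis by (simp add: add_increasing)
  qed
  have "(\<integral>\<^sup>+z. ennreal (exp (- c * (norm (z::'a))\<^sup>2)) \<partial>lborel) \<le>
    (\<integral>\<^sup>+z. indicator (cball 0 1) z + (\<Sum>k. ennreal (K / real (Suc k) ^ (n + 2)) * indicator (cball (0::'a) (real k + 2)) z) \<partial>lborel)"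
    by (intro nn_integral_mono pw)
  also have "\<dots> = emeasure lborel (cball (0::'a) 1) +
      (\<Sum>k. ennreal (K / real (Suc k) ^ (n + 2)) * emeasure lborel (cball (0::'a) (real k + 2)))"
  proof -
    define w where "w k = ennreal (K / real (Suc k) ^ (n + 2))" for k
    have m: "(\<lambda>z. w k * indicator (cball (0::'a) (real k + 2)) z) \<in> borel_measurable lborel" for k
      by measurable
    have "(\<integral>\<^sup>+z. indicator (cball 0 1) z + (\<Sum>k. w k * indicator (cball (0::'a) (real k + 2)) z) \<partial>lborel)
      = (\<integral>\<^sup>+z. indicator (cball 0 1) (z::'a) \<partial>lborel) + (\<integral>\<^sup>+z. (\<Sum>k. w k * indicator (cball (0::'a) (real k + 2)) z) \<partial>lborel)"
      by (rule nn_integral_add) (auto intro: borel_measurable_suminf_order m)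
    also have "\<dots> = emeasure lborel (cball (0::'a) 1) + (\<Sum>k. w k * emeasure lborel (cball (0::'a) (real k + 2)))"
      using m by (subst nn_integral_suminf) (auto simp: nn_integral_cmult_indicator)
    finally show ?thesis unfolding w_def .
  qed
  also have "\<dots> \<le> ennreal V + (\<Sum>k. ennreal (K * V * 2 ^ n * (1 / real (Suc k) ^ 2)))"
  proof (intro add_mono suminf_le)
    show "emeasure lborel (cball (0::'a) 1) \<le> ennreal V"
      by (simp add: emeasure_cball V_def n_def)
    fix k
    have "real k + 2 \<le> 2 * real (Suc k)" by simp
    then have "(real k + 2) ^ n \<le> (2 * real (Suc k)) ^ n" by (intro power_mono) auto
    then have "K / real (Suc k) ^ (n + 2) * (V * (real k + 2) ^ n)
        \<le> K / real (Suc k) ^ (n + 2) * (V * (2 * real (Suc k)) ^ n)"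
      using K V by (intro mult_left_mono) auto
    also have "\<dots> = K * V * 2 ^ n * (1 / real (Suc k) ^ 2)"
    proof -
      have "K / m ^ (n + 2) * (V * (2 * m) ^ n) = K * V * 2 ^ n * (1 / m ^ 2)" if "0 < m" for m :: real
        using that by (simp add: power_mult_distrib power_add field_simps power2_eq_square)
      from this[of "real (Suc k)"] show ?thesis by (simp only: of_nat_0_less_iff zero_less_Suc simp_thms)
    qed
    finally have "K / real (Suc k) ^ (n + 2) * (V * (real k + 2) ^ n) \<le> K * V * 2 ^ n * (1 / real (Suc k) ^ 2)" .
    then show "ennreal (K / real (Suc k) ^ (n + 2)) * emeasure lborel (cball (0::'a) (real k + 2))
        \<le> ennreal (K * V * 2 ^ n * (1 / real (Suc k) ^ 2))"
      using K V by (simp add: emeasure_cball V_def n_def ennreal_leI flip: ennreal_mult)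
  qed auto
  also have "\<dots> < \<infinity>"
  proof -
    have "summable (\<lambda>k. 1 / real k ^ 2)"
      using inverse_power_summable[of 2, where ?'a = real] by (simp add: inverse_eq_divide)
    then have "summable (\<lambda>k. 1 / real (Suc k) ^ 2)" by (subst summable_Suc_iff)
    then have "summable (\<lambda>k. K * V * 2 ^ n * (1 / real (Suc k) ^ 2))" by (rule summable_mult)
    then show ?thesis using K V by (subst suminf_ennreal2) auto
  qed
  finally show ?thesis .
qed

text \<open>The substitution y = x + sqrt(tau) z leaves a Gaussian integral; tau^(n/2) from the
  volume and tau^(-na/2) from the kernel give the exponent. The second form, with the two points
  exchanged, is the one that appears after integrals have been interchanged.\<close>

lemma nn_integral_heat_kernel_powr:
  assumes a: "0 < a"
  obtains C :: real where "0 < C"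
    "\<And>(x::'a::euclidean_space) \<tau>. 0 < \<tau> \<Longrightarrow>
       (\<integral>\<^sup>+y. ennreal (heat_kernel (x - y) \<tau> powr a) \<partial>lborel) \<le> ennreal (C * \<tau> powr (real DIM('a) * (1 - a) / 2))"
    "\<And>(x::'a::euclidean_space) \<tau>. 0 < \<tau> \<Longrightarrow>
       (\<integral>\<^sup>+y. ennreal (heat_kernel (y - x) \<tau> powr a) \<partial>lborel) \<le> ennreal (C * \<tau> powr (real DIM('a) * (1 - a) / 2))"
proof -
  define G where "G = (\<integral>\<^sup>+z. ennreal (exp (- (a / 4) * (norm (z::'a))\<^sup>2)) \<partial>lborel)"
  have G: "G < \<infinity>" unfolding G_def using a by (intro nn_integral_gaussian_finite) auto
  define N where "N = real DIM('a)"
  have *: "(\<integral>\<^sup>+y. ennreal (heat_kernel (x - y) \<tau> powr a) \<partial>lborel) \<le> ennreal ((1 + enn2real G) * \<tau> powr (N * (1 - a) / 2))"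
    if \<tau>: "0 < \<tau>" for x :: 'a and \<tau>
  proof -
    have sq: "0 < sqrt \<tau>" using \<tau> by simp
    have "(\<integral>\<^sup>+y. ennreal (heat_kernel (x - y) \<tau> powr a) \<partial>lborel)
        = ennreal (sqrt \<tau> ^ DIM('a)) * (\<integral>\<^sup>+z. ennreal (heat_kernel (x - (x + sqrt \<tau> *\<^sub>R z)) \<tau> powr a) \<partial>lborel)"
      by (rule nn_integral_lborel_scale[OF _ sq]) measurable
    also have "\<dots> \<le> ennreal (sqrt \<tau> ^ DIM('a)) * (\<integral>\<^sup>+z. ennreal (\<tau> powr (- N * a / 2)) * ennreal (exp (- (a / 4) * (norm (z::'a))\<^sup>2)) \<partial>lborel)"
    proof (intro mult_left_mono nn_integral_mono)
      fix z :: 'a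
      have "heat_kernel (x - (x + sqrt \<tau> *\<^sub>R z)) \<tau> \<le> \<tau> powr (- N / 2) * exp (- (norm z)\<^sup>2 / 4)"
      proof -
        have "(4 * pi * \<tau>) powr (- N / 2) \<le> \<tau> powr (- N / 2)"
          using \<tau> pi_gt3 by (intro powr_mono2') (auto simp: field_simps N_def)
        moreover have "(norm (x - (x + sqrt \<tau> *\<^sub>R z)))\<^sup>2 / (4 * \<tau>) = (norm z)\<^sup>2 / 4"
          using \<tau> by (simp add: power_mult_distrib)
        ultimately show ?thesis
          using \<tau> by (simp add: heat_kernel_def N_def power_mult_distrib)
      qed
      then have "heat_kernel (x - (x + sqrt \<tau> *\<^sub>R z)) \<tau> powr a \<le> (\<tau> powr (- N / 2) * exp (- (norm z)\<^sup>2 / 4)) powr a"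
        using a by (intro powr_mono2) auto
      also have "\<dots> = \<tau> powr (- N * a / 2) * exp (- (a / 4) * (norm z)\<^sup>2)"
        by (simp add: powr_mult powr_powr exp_powr_real mult_ac)
      finally show "ennreal (heat_kernel (x - (x + sqrt \<tau> *\<^sub>R z)) \<tau> powr a)
          \<le> ennreal (\<tau> powr (- N * a / 2)) * ennreal (exp (- (a / 4) * (norm z)\<^sup>2))"
        by (simp add: ennreal_leI flip: ennreal_mult)
    qed auto
    also have "\<dots> = ennreal (sqrt \<tau> ^ DIM('a)) * (ennreal (\<tau> powr (- N * a / 2)) * G)"
      unfolding G_def by (subst nn_integral_cmult) auto
    also have "G = ennreal (enn2real G)" using G by simp
    also have "ennreal (sqrt \<tau> ^ DIM('a)) * (ennreal (\<tau> powr (- N * a / 2)) * ennreal (enn2real G))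
        = ennreal (enn2real G * \<tau> powr (N * (1 - a) / 2))"
    proof -
      have "sqrt \<tau> ^ DIM('a) = \<tau> powr (N / 2)"
        using \<tau> by (simp add: N_def powr_half_sqrt[symmetric] powr_realpow[symmetric] powr_powr)
      then have "sqrt \<tau> ^ DIM('a) * \<tau> powr (- N * a / 2) = \<tau> powr (N * (1 - a) / 2)"
        using \<tau> by (simp add: powr_add[symmetric] algebra_simps diff_divide_distrib)
      then show ?thesis using \<tau> by (simp add: ennreal_mult[symmetric] mult_ac)
    qed
    also have "\<dots> \<le> ennreal ((1 + enn2real G) * \<tau> powr (N * (1 - a) / 2))"
      by (intro ennreal_leI mult_right_mono) auto
    finally show ?thesis .
  qed
  have sym: "heat_kernel (y - x) \<tau> = heat_kernel (x - y) \<tau>" for x y :: 'a and \<tau>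
    by (simp add: heat_kernel_def norm_minus_commute)
  show ?thesis
    by (rule that[of "1 + enn2real G"]) (use * in \<open>auto simp: N_def add_pos_nonneg sym\<close>)
qed

section \<open>Singular time integrals\<close>

lemma nn_integral_powr_Ioo:
  assumes b: "b < 1" and h: "0 \<le> h"
  shows "(\<integral>\<^sup>+s\<in>{0<..<h}. ennreal (s powr (- b)) \<partial>lborel) \<le> ennreal (h powr (1 - b) / (1 - b))"
proof -
  have "((\<lambda>s. s powr (- b)) has_integral h powr (- b + 1) / (- b + 1)) {0..h}"
    using b h by (intro has_integral_powr_from_0) auto
  then have *: "((\<lambda>s. if s \<in> {0..h} then s powr (- b) else 0) has_integral h powr (1 - b) / (1 - b)) UNIV"
    by (subst has_integral_restrict_UNIV) (simp add: add.commute)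
  have "(\<integral>\<^sup>+s\<in>{0<..<h}. ennreal (s powr (- b)) \<partial>lborel)
      \<le> (\<integral>\<^sup>+s. ennreal (if s \<in> {0..h} then s powr (- b) else 0) \<partial>lborel)"
    by (intro nn_integral_mono) (auto simp: indicator_def)
  also have "\<dots> = ennreal (h powr (1 - b) / (1 - b))"
    by (rule nn_integral_has_integral_lborel[OF _ _ *]) auto
  finally show ?thesis .
qed

lemma nn_integral_powr_right:
  assumes b: "b < 1" and h: "0 \<le> h"
  shows "(\<integral>\<^sup>+s\<in>{t - h<..<t}. ennreal ((t - s) powr (- b)) \<partial>lborel) \<le> ennreal (h powr (1 - b) / (1 - b))"
proof -
  have "(\<integral>\<^sup>+s\<in>{t - h<..<t}. ennreal ((t - s) powr (- b)) \<partial>lborel)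
      = (\<integral>\<^sup>+s. ennreal ((t - (t + (-1) * s)) powr (- b)) * indicator {t - h<..<t} (t + (-1) * s) \<partial>lborel)"
    by (subst nn_integral_real_affine[where c = "-1" and t = t]) auto
  also have "\<dots> = (\<integral>\<^sup>+s\<in>{0<..<h}. ennreal (s powr (- b)) \<partial>lborel)"
    by (intro nn_integral_cong) (auto simp: indicator_def)
  finally show ?thesis using nn_integral_powr_Ioo[OF b h] by simp
qed

lemma nn_integral_powr_left:
  assumes b: "b < 1" and h: "0 \<le> h"
  shows "(\<integral>\<^sup>+s\<in>{t<..<t + h}. ennreal ((s - t) powr (- b)) \<partial>lborel) \<le> ennreal (h powr (1 - b) / (1 - b))"
proof -
  have "(\<integral>\<^sup>+s\<in>{t<..<t + h}. ennreal ((s - t) powr (- b)) \<partial>lborel)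
      = (\<integral>\<^sup>+s. ennreal ((t + 1 * s - t) powr (- b)) * indicator {t<..<t + h} (t + 1 * s) \<partial>lborel)"
    by (subst nn_integral_real_affine[where c = "1" and t = t]) auto
  also have "\<dots> = (\<integral>\<^sup>+s\<in>{0<..<h}. ennreal (s powr (- b)) \<partial>lborel)"
    by (intro nn_integral_cong) (auto simp: indicator_def)
  finally show ?thesis using nn_integral_powr_Ioo[OF b h] by simp
qed

text \<open>A substitute for the Beta integral: the smaller of t - s and s - v can take over both
  exponents, so the product is at most (t - s)^(-(a+b)) + (s - v)^(-(a+b)), and each summand is
  integrable because a + b < 1. The bound depends on v and t only through \<open>h\<close>, which
  Fubini arguments later rely on.\<close>

lemma nn_integral_powr_convolution:
  assumes a: "0 \<le> a" and b: "0 \<le> b" and ab: "a + b < 1" and vt: "v \<le> t" "t - v \<le> h"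
  shows "(\<integral>\<^sup>+s\<in>{v<..<t}. ennreal ((t - s) powr (- a) * (s - v) powr (- b)) \<partial>lborel)
    \<le> ennreal (2 * h powr (1 - (a + b)) / (1 - (a + b)))"
proof -
  let ?c = "a + b"
  have le: "x powr (- a) * y powr (- b) \<le> x powr (- ?c) + y powr (- ?c)" if "0 < x" "0 < y" for x y :: real
  proof (cases "x \<le> y")
    case True
    then have "y powr (- b) \<le> x powr (- b)" using that b by (intro powr_mono2') auto
    then have "x powr (- a) * y powr (- b) \<le> x powr (- a) * x powr (- b)" by (intro mult_left_mono) auto
    then show ?thesis by (simp add: powr_add[symmetric] add_increasing2)
  next
    case False
    then have "x powr (- a) \<le> y powr (- a)" using that a by (intro powr_mono2') auto
    then have "x powr (- a) * y powr (- b) \<le> y powr (- a) * y powr (- b)" by (intro mult_right_mono) auto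
    then show ?thesis by (simp add: powr_add[symmetric] add_increasing)
  qed
  have "(\<integral>\<^sup>+s\<in>{v<..<t}. ennreal ((t - s) powr (- a) * (s - v) powr (- b)) \<partial>lborel)
    \<le> (\<integral>\<^sup>+s. ennreal ((t - s) powr (- ?c)) * indicator {v<..<t} s + ennreal ((s - v) powr (- ?c)) * indicator {v<..<t} s \<partial>lborel)"
  proof (intro nn_integral_mono)
    fix s
    show "ennreal ((t - s) powr (- a) * (s - v) powr (- b)) * indicator {v<..<t} s \<le>
       ennreal ((t - s) powr (- ?c)) * indicator {v<..<t} s + ennreal ((s - v) powr (- ?c)) * indicator {v<..<t} s"
      using le[of "t - s" "s - v"] by (auto simp: indicator_def ennreal_leI simp flip: ennreal_plus)
  qed
  also have "\<dots> = (\<integral>\<^sup>+s\<in>{t - (t - v)<..<t}. ennreal ((t - s) powr (- ?c)) \<partial>lborel)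
      + (\<integral>\<^sup>+s\<in>{v<..<v + (t - v)}. ennreal ((s - v) powr (- ?c)) \<partial>lborel)"
    by (subst nn_integral_add) auto
  also have "\<dots> \<le> ennreal ((t - v) powr (1 - ?c) / (1 - ?c)) + ennreal ((t - v) powr (1 - ?c) / (1 - ?c))"
    using ab vt by (intro add_mono nn_integral_powr_right nn_integral_powr_left) auto
  also have "\<dots> = ennreal (2 * (t - v) powr (1 - ?c) / (1 - ?c))"
    using ab by (simp flip: ennreal_plus)
  also have "\<dots> \<le> ennreal (2 * h powr (1 - ?c) / (1 - ?c))"
    using ab vt by (intro ennreal_leI divide_right_mono mult_left_mono powr_mono2) auto
  finally show ?thesis .
qed

text \<open>The spatial integral contributes (t - s)^(-n(a-1)/2), integrable up to s = t because
  n(a-1) < 2. For a = alpha/n this condition reads alpha < n + 2, and with h = rho^2 the bound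
  becomes a multiple of rho^(n+2-alpha).\<close>

lemma nn_integral_heat_kernel_cylinder:
  assumes a: "0 < a" "real DIM('a) * (a - 1) < 2"
  obtains C :: real where "0 < C"
    "\<And>(x::'a::euclidean_space) t h. 0 \<le> h \<Longrightarrow>
       (\<integral>\<^sup>+s\<in>{t - h<..<t}. (\<integral>\<^sup>+y. ennreal (heat_kernel (x - y) (t - s) powr a) \<partial>lborel) \<partial>lborel)
         \<le> ennreal (C * h powr (1 - real DIM('a) * (a - 1) / 2))"
proof -
  obtain C where C: "0 < C" "\<And>(x::'a) \<tau>. 0 < \<tau> \<Longrightarrow>
       (\<integral>\<^sup>+y. ennreal (heat_kernel (x - y) \<tau> powr a) \<partial>lborel) \<le> ennreal (C * \<tau> powr (real DIM('a) * (1 - a) / 2))"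
    using nn_integral_heat_kernel_powr[OF a(1), where ?'a = 'a] by metis
  define b where "b = real DIM('a) * (a - 1) / 2"
  have b: "b < 1" using a by (simp add: b_def)
  show ?thesis
  proof (rule that[of "C / (1 - b)"])
    show "0 < C / (1 - b)" using C b by simp
    fix x :: 'a and t h :: real assume h: "0 \<le> h"
    have "(\<integral>\<^sup>+s\<in>{t - h<..<t}. (\<integral>\<^sup>+y. ennreal (heat_kernel (x - y) (t - s) powr a) \<partial>lborel) \<partial>lborel)
      \<le> (\<integral>\<^sup>+s. ennreal C * (ennreal ((t - s) powr (- b)) * indicator {t - h<..<t} s) \<partial>lborel)"
    proof (intro nn_integral_mono)
      fix s
      have "real DIM('a) * (1 - a) / 2 = - b" by (simp add: b_def algebra_simps diff_divide_distrib)
      then show "(\<integral>\<^sup>+y. ennreal (heat_kernel (x - y) (t - s) powr a) \<partial>lborel) * indicator {t - h<..<t} s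
          \<le> ennreal C * (ennreal ((t - s) powr (- b)) * indicator {t - h<..<t} s)"
        using C(2)[of "t - s" x] C(1) by (auto simp: indicator_def ennreal_mult)
    qed
    also have "\<dots> = ennreal C * (\<integral>\<^sup>+s\<in>{t - h<..<t}. ennreal ((t - s) powr (- b)) \<partial>lborel)"
      by (rule nn_integral_cmult) auto
    also have "\<dots> \<le> ennreal C * ennreal (h powr (1 - b) / (1 - b))"
      using b h by (intro mult_left_mono nn_integral_powr_right) auto
    also have "\<dots> = ennreal (C / (1 - b) * h powr (1 - b))"
      using C b by (simp flip: ennreal_mult)
    finally show "(\<integral>\<^sup>+s\<in>{t - h<..<t}. (\<integral>\<^sup>+y. ennreal (heat_kernel (x - y) (t - s) powr a) \<partial>lborel) \<partial>lborel)
         \<le> ennreal (C / (1 - b) * h powr (1 - real DIM('a) * (a - 1) / 2))" by (simp add: b_def)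
  qed
qed

section \<open>The weak form of the heat operator\<close>

text \<open>Iterated with time outermost, so that estimates on single time slices can be inserted
  before integrating in time.\<close>

abbreviation cyl_integral :: "real set \<Rightarrow> 'a::euclidean_space set \<Rightarrow> ('a \<Rightarrow> real \<Rightarrow> real) \<Rightarrow> ennreal" where
  "cyl_integral I B g \<equiv> \<integral>\<^sup>+s\<in>I. (\<integral>\<^sup>+y\<in>B. ennreal (g y s) \<partial>lborel) \<partial>lborel"

lemma continuous_on_compose_pair:
  assumes "continuous_on (UNIV \<times> S) (\<lambda>z. w (fst z) (snd z))"
    and "continuous_on A g" "continuous_on A k" "\<And>x. x \<in> A \<Longrightarrow> k x \<in> S"
  shows "continuous_on A (\<lambda>x. w (g x) (k x))"
proof -
  have "continuous_on A (\<lambda>x. (g x, k x))" using assms by (intro continuous_intros)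
  from continuous_on_compose2[OF assms(1) this] show ?thesis using assms(4) by auto
qed

locale C21_strip =
  fixes u :: "'a::euclidean_space \<Rightarrow> real \<Rightarrow> real" and T :: real
    and ut :: "'a \<Rightarrow> real \<Rightarrow> real" and ux :: "'a \<Rightarrow> real \<Rightarrow> 'a"
    and uxx :: "'a \<Rightarrow> real \<Rightarrow> 'a \<Rightarrow> 'a"
  assumes C21: "C21_on u T ut ux uxx"
begin

definition source :: "'a \<Rightarrow> real \<Rightarrow> real" where
  "source x t = ut x t - laplacian_of uxx x t"

lemma
  assumes "t \<in> {0<..<T}"
  shows u_t: "((\<lambda>s. u x s) has_real_derivative ut x t) (at t)"
    and u_x: "((\<lambda>y. u y t) has_derivative (\<lambda>h. ux x t \<bullet> h)) (at x)"
    and u_xx: "((\<lambda>y. ux y t) has_derivative uxx x t) (at x)"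
  using C21 assms unfolding C21_on_def by blast+

lemma
  shows cont_u: "continuous_on (UNIV \<times> {0<..<T}) (\<lambda>z. u (fst z) (snd z))"
    and cont_ut: "continuous_on (UNIV \<times> {0<..<T}) (\<lambda>z. ut (fst z) (snd z))"
    and cont_uxx: "i \<in> Basis \<Longrightarrow> continuous_on (UNIV \<times> {0<..<T}) (\<lambda>z. uxx (fst z) (snd z) i)"
  using C21 unfolding C21_on_def case_prod_unfold by blast+

lemma cont_source: "continuous_on (UNIV \<times> {0<..<T}) (\<lambda>z. source (fst z) (snd z))"
  unfolding source_def laplacian_of_def
  by (intro continuous_intros cont_ut cont_uxx) auto

lemma cont_slice:
  assumes "continuous_on (UNIV \<times> {0<..<T}) (\<lambda>z. w (fst z) (snd z))" "t \<in> {0<..<T}"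
  shows "continuous_on A (\<lambda>y. w y t)"
  using assms(2) by (intro continuous_on_compose_pair[OF assms(1)] continuous_intros)

text \<open>By u_t = f + Laplacian u and Green's identity, the derivative of the integral of Z u is
  the integral of Z f + (Z_s + Laplacian Z) u: the second factor is the backward heat operator
  applied to the weight. Weights are functions of q = |y - x|^2, so only ordinary derivatives in q
  occur. The horizon \<open>t\<close> may be smaller than \<open>T\<close> because the backward
  kernel is singular at its pole.\<close>

lemma weak_identity_radial:
  assumes tT: "t \<le> T"
    and Zs: "\<And>q s. s \<in> {0<..<t} \<Longrightarrow> ((\<lambda>s. Z q s) has_real_derivative Zs q s) (at s)"
    and Z1: "\<And>q s. s \<in> {0<..<t} \<Longrightarrow> ((\<lambda>q. Z q s) has_real_derivative Z1 q s) (at q)"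
    and Z2: "\<And>q s. s \<in> {0<..<t} \<Longrightarrow> ((\<lambda>q. Z1 q s) has_real_derivative Z2 q s) (at q)"
    and cZ: "continuous_on (UNIV \<times> {0<..<t}) (\<lambda>z. Z (fst z) (snd z))"
      "continuous_on (UNIV \<times> {0<..<t}) (\<lambda>z. Zs (fst z) (snd z))"
      "continuous_on (UNIV \<times> {0<..<t}) (\<lambda>z. Z1 (fst z) (snd z))"
      "continuous_on (UNIV \<times> {0<..<t}) (\<lambda>z. Z2 (fst z) (snd z))"
    and supp: "\<And>q s. s \<in> {0<..<t} \<Longrightarrow> r\<^sup>2 \<le> q \<Longrightarrow> Z q s = 0 \<and> Z1 q s = 0" and r: "0 \<le> r"
    and box: "cball x (r + 1) \<subseteq> cbox a b"
  defines "q \<equiv> \<lambda>y. (norm (y - x))\<^sup>2"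
  defines "I \<equiv> \<lambda>y s. Z (q y) s * source y s +
    (Zs (q y) s + (2 * real DIM('a) * Z1 (q y) s + 4 * q y * Z2 (q y) s)) * u y s"
  shows "\<And>s. s \<in> {0<..<t} \<Longrightarrow>
      ((\<lambda>s. integral (cbox a b) (\<lambda>y. Z (q y) s * u y s)) has_real_derivative
        integral (cbox a b) (\<lambda>y. I y s)) (at s)"
    and "continuous_on (UNIV \<times> {0<..<t}) (\<lambda>z. I (fst z) (snd z))"
    and "continuous_on {0<..<t} (\<lambda>s. integral (cbox a b) (\<lambda>y. I y s))"
proof -
  have cq: "continuous_on A (\<lambda>y. q (g y))" if "continuous_on A g" for A :: "'c::topological_space set" and g
    unfolding q_def by (intro continuous_intros that)
  note cZq = cZ[THEN continuous_on_compose_pair, where A = "UNIV \<times> {0<..<t}" and g = "\<lambda>z. q (fst z)" and k = snd,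
      OF cq[OF continuous_on_fst[OF continuous_on_id]] continuous_on_snd[OF continuous_on_id] mem_Times_iff[THEN iffD1, THEN conjunct2]]
  have sub: "UNIV \<times> {0<..<t} \<subseteq> UNIV \<times> {0<..<T}" using tT by auto
  note cu = continuous_on_subset[OF cont_u sub] continuous_on_subset[OF cont_ut sub]
    continuous_on_subset[OF cont_source sub]
  show cI: "continuous_on (UNIV \<times> {0<..<t}) (\<lambda>z. I (fst z) (snd z))"
    unfolding I_def by (intro continuous_intros cZq cu cq)
  show "continuous_on {0<..<t} (\<lambda>s. integral (cbox a b) (\<lambda>y. I y s))"
  proof (rule integral_continuous_on_param)
    show "continuous_on ({0<..<t} \<times> cbox a b) (\<lambda>(s, y). I y s)"
      unfolding case_prod_unfold
      by (rule continuous_on_compose_pair[OF cI]) (auto intro!: continuous_intros)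
  qed
  fix s assume s: "s \<in> {0<..<t}"
  have sT: "s \<in> {0<..<T}" using s tT by auto
  define J where "J y s = Zs (q y) s * u y s + ut y s * Z (q y) s" for y s
  have sl: "continuous_on A (\<lambda>y. w (q y) s)"
    if "continuous_on (UNIV \<times> {0<..<t}) (\<lambda>z. w (fst z) (snd z))" for w and A :: "'a set"
    using s by (intro continuous_on_compose_pair[OF that] continuous_intros cq)
  have sl0: "continuous_on A (\<lambda>q. w q s)"
    if "continuous_on (UNIV \<times> {0<..<t}) (\<lambda>z. w (fst z) (snd z))" for w and A :: "real set"
    using s by (intro continuous_on_compose_pair[OF that] continuous_intros)
  have clap: "continuous_on A (\<lambda>y. laplacian_of uxx y s)" for A
    unfolding laplacian_of_def
    by (intro continuous_intros cont_slice[OF cont_uxx sT]) auto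
  have cux: "continuous_on UNIV (\<lambda>y. uxx y s i)" if "i \<in> Basis" for i
    using cont_slice[OF cont_uxx[OF that] sT] by simp
  have green: "integral (cbox a b) (\<lambda>y. Z (q y) s * laplacian_of uxx y s) =
      integral (cbox a b) (\<lambda>y. (2 * real DIM('a) * Z1 (q y) s + 4 * q y * Z2 (q y) s) * u y s)"
    unfolding laplacian_of_def q_def
    using s by (intro green_identity_radial[where r = r, OF u_x[OF sT] u_xx[OF sT] cux Z1 Z2 sl0[OF cZ(4)]]
        supp r box)
  have "((\<lambda>s. integral (cbox a b) (\<lambda>y. Z (q y) s * u y s)) has_real_derivative
        integral (cbox a b) (\<lambda>y. J y s)) (at s within {0<..<t})"
  proof (rule leibniz_rule_field_derivative[where fx = "\<lambda>s y. J y s"])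
    fix s y assume s': "s \<in> {0<..<t}"
    then have "s \<in> {0<..<T}" using tT by auto
    from DERIV_mult[OF Zs[OF s'] u_t[OF this]]
    show "((\<lambda>s. Z (q y) s * u y s) has_real_derivative J y s) (at s within {0<..<t})"
      unfolding J_def by (rule has_field_derivative_at_within)
  next
    fix s assume s': "s \<in> {0<..<t}"
    have "continuous_on (cbox a b) (\<lambda>y. Z (q y) s * u y s)"
      using s' tT by (intro continuous_on_mult continuous_on_compose_pair[OF cZ(1)]
          cont_slice[OF cont_u] continuous_intros cq) auto
    then show "(\<lambda>y. Z (q y) s * u y s) integrable_on cbox a b" by (rule integrable_continuous)
  next
    have cJ: "continuous_on (UNIV \<times> {0<..<t}) (\<lambda>z. J (fst z) (snd z))"
      unfolding J_def by (intro continuous_intros cZq cu)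
    show "continuous_on ({0<..<t} \<times> cbox a b) (\<lambda>(s, y). J y s)"
      unfolding case_prod_unfold
      by (rule continuous_on_compose_pair[OF cJ]) (auto intro!: continuous_intros)
  qed (use s in auto)
  moreover have "integral (cbox a b) (\<lambda>y. J y s) = integral (cbox a b) (\<lambda>y. I y s)"
  proof -
    have "integral (cbox a b) (\<lambda>y. J y s) =
      integral (cbox a b) (\<lambda>y. (Zs (q y) s * u y s + Z (q y) s * source y s) + Z (q y) s * laplacian_of uxx y s)"
      by (rule integral_cong) (simp add: J_def source_def algebra_simps)
    also have "\<dots> = integral (cbox a b) (\<lambda>y. Zs (q y) s * u y s + Z (q y) s * source y s)
        + integral (cbox a b) (\<lambda>y. Z (q y) s * laplacian_of uxx y s)"
      by (intro Henstock_Kurzweil_Integration.integral_add integrable_continuous continuous_intros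
          sl cZ cont_slice[OF cont_u sT] cont_slice[OF cont_source sT] clap)
    also have "\<dots> = integral (cbox a b) (\<lambda>y. I y s)"
      unfolding green
      by (subst Henstock_Kurzweil_Integration.integral_add [symmetric])
        (auto simp: I_def algebra_simps intro!: integrable_continuous continuous_intros
          sl cZ cq cont_slice[OF cont_u sT] cont_slice[OF cont_source sT])
    finally show ?thesis .
  qed
  ultimately show "((\<lambda>s. integral (cbox a b) (\<lambda>y. Z (q y) s * u y s)) has_real_derivative
        integral (cbox a b) (\<lambda>y. I y s)) (at s)"
    using s by (simp add: at_within_open[of s "{0<..<t}"])
qed

end

section \<open>The representation inequality\<close>

locale supersolution = C21_strip u T ut ux uxx
  for u :: "'a::euclidean_space \<Rightarrow> real \<Rightarrow> real" and T ut ux uxx +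
  fixes \<Omega> :: "'a set"
  assumes u_nonneg: "\<And>x t. t \<in> {0<..<T} \<Longrightarrow> 0 \<le> u x t"
    and source_nonneg: "\<And>x t. x \<in> \<Omega> \<Longrightarrow> t \<in> {0<..<T} \<Longrightarrow> 0 \<le> source x t"
begin

text \<open>Extension by zero in time. Off the strip \<open>u\<close> is unconstrained, possibly not
  even measurable; with \<open>uT\<close> and \<open>sourceT\<close> all integrals can run over the
  whole of space-time.\<close>

definition uT :: "'a \<Rightarrow> real \<Rightarrow> real" where "uT y s = (if s \<in> {0<..<T} then u y s else 0)"
definition sourceT :: "'a \<Rightarrow> real \<Rightarrow> real" where "sourceT y s = (if s \<in> {0<..<T} then source y s else 0)"

lemma uT_nonneg [simp]: "0 \<le> uT y s"
  using u_nonneg by (simp add: uT_def)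

lemma strip_restrict_measurable:
  fixes w :: "'a \<Rightarrow> real \<Rightarrow> real"
  assumes "continuous_on (UNIV \<times> {0<..<T}) (\<lambda>z. w (fst z) (snd z))"
    and [measurable]: "X \<in> borel_measurable M" "Y \<in> borel_measurable M"
  shows "(\<lambda>z. if Y z \<in> {0<..<T} then w (X z) (Y z) else 0) \<in> borel_measurable M"
proof -
  have "(\<lambda>z. indicator (UNIV \<times> {0<..<T}) z *\<^sub>R w (fst z) (snd z)) \<in> borel_measurable (borel :: ('a \<times> real) measure)"
    by (intro borel_measurable_continuous_on_indicator assms borel_open open_Times) auto
  then have "(\<lambda>z. if snd z \<in> {0<..<T} then w (fst z) (snd z) else 0) \<in> borel_measurable (borel :: ('a \<times> real) measure)"
    by (rule measurable_cong[THEN iffD1, rotated]) (auto simp: indicator_def mem_Times_iff)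
  then have [measurable]: "(\<lambda>z. if snd z \<in> {0<..<T} then w (fst z) (snd z) else 0) \<in> borel_measurable (borel \<Otimes>\<^sub>M borel)"
    by (simp add: borel_prod)
  have "(\<lambda>z. (\<lambda>z. if snd z \<in> {0<..<T} then w (fst z) (snd z) else 0) (X z, Y z)) \<in> borel_measurable M"
    by measurable
  then show ?thesis by (simp only: fst_conv snd_conv)
qed

lemma uT_measurable [measurable (raw)]:
  "X \<in> borel_measurable M \<Longrightarrow> Y \<in> borel_measurable M \<Longrightarrow> (\<lambda>z. uT (X z) (Y z)) \<in> borel_measurable M"
  unfolding uT_def by (rule strip_restrict_measurable[OF cont_u])

lemma sourceT_measurable [measurable (raw)]:
  "X \<in> borel_measurable M \<Longrightarrow> Y \<in> borel_measurable M \<Longrightarrow> (\<lambda>z. sourceT (X z) (Y z)) \<in> borel_measurable M"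
  unfolding sourceT_def by (rule strip_restrict_measurable[OF cont_source])

end

text \<open>The heat kernel with pole at time t as a function of q = |y - x|^2 and s, the form of
  weight that \<open>weak_identity_radial\<close> expects. It has no case distinction in time, so
  derivative rules apply directly; it is used only for s < t.\<close>

definition gauss :: "real \<Rightarrow> real \<Rightarrow> real \<Rightarrow> real \<Rightarrow> real" where
  "gauss N t q s = (4 * pi * (t - s)) powr (- N / 2) * exp (- q / (4 * (t - s)))"

lemma gauss_deriv_s:
  assumes "s < t"
  shows "((\<lambda>s. gauss N t q s) has_real_derivative
     gauss N t q s * (N / (2 * (t - s)) - q / (4 * (t - s)\<^sup>2))) (at s)"
proof -
  have p: "0 < 4 * pi * (t - s)" using assms by simp
  have "((\<lambda>s. (4 * pi * (t - s)) powr (- N / 2)) has_real_derivative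
      (4 * pi * (t - s)) powr (- N / 2) * (N / (2 * (t - s)))) (at s)"
  proof -
    have "((\<lambda>s. 4 * pi * (t - s)) has_real_derivative - (4 * pi)) (at s)"
      by (auto intro!: derivative_eq_intros)
    from DERIV_chain2[OF has_real_derivative_powr[OF p, of "- N / 2"] this]
    show ?thesis
    proof (rule DERIV_cong)
      have "(4 * pi * (t - s)) powr (- N / 2 - 1) = (4 * pi * (t - s)) powr (- N / 2) / (4 * pi * (t - s))"
        using p by (simp add: powr_diff)
      moreover have "- N / 2 * (P / (4 * pi * (t - s))) * - (4 * pi) = P * (N / (2 * (t - s)))" for P
        using assms by (simp add: field_simps)
      ultimately show "- N / 2 * (4 * pi * (t - s)) powr (- N / 2 - 1) * - (4 * pi) =
          (4 * pi * (t - s)) powr (- N / 2) * (N / (2 * (t - s)))"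
        by (simp only:)
    qed
  qed
  moreover have "((\<lambda>s. exp (- q / (4 * (t - s)))) has_real_derivative
      exp (- q / (4 * (t - s))) * (- q / (4 * (t - s)\<^sup>2))) (at s)"
  proof -
    have x: "((\<lambda>x. exp (- q / (4 * x))) has_real_derivative exp (- q / (4 * x)) * (q / (4 * x\<^sup>2))) (at x)"
      if "x \<noteq> 0" for x :: real
      using that by (auto intro!: derivative_eq_intros simp: power2_eq_square)
    have "((\<lambda>s. t - s) has_real_derivative - 1) (at s)"
      by (auto intro!: derivative_eq_intros)
    from DERIV_chain2[OF x this] show ?thesis using assms by simp
  qed
  ultimately show ?thesis unfolding gauss_def
    by (rule DERIV_mult[THEN DERIV_cong]) (simp add: algebra_simps)
qed

lemma gauss_deriv_q:
  assumes "s < t"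
  shows "((\<lambda>q. gauss N t q s) has_real_derivative - gauss N t q s / (4 * (t - s))) (at q)"
  using assms unfolding gauss_def by (auto intro!: derivative_eq_intros)

lemma gauss_continuous:
  "continuous_on (UNIV \<times> {0<..<t}) (\<lambda>z. gauss N t (fst z) (snd z))"
  unfolding gauss_def by (intro continuous_intros) auto

lemma gauss_heat_kernel:
  fixes x :: "'a::euclidean_space"
  assumes "s < t"
  shows "gauss (real DIM('a)) t ((norm (y - x))\<^sup>2) s = heat_kernel (x - y) (t - s)"
  using assms by (simp add: gauss_def heat_kernel_def norm_minus_commute)

context supersolution
begin

text \<open>The weight is the backward kernel times a cutoff at scale r. The kernel is annihilated
  by the backward heat operator, so only terms with derivatives of the cutoff remain; they live on
  r/2 <= |y - x| <= r and are O(r^(-n-2)). No limit to a delta function is taken as s tends to t: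
  shortly before t the weight has mass at least c on a small ball around x where u > u(x,t)/2, which
  is enough for an inequality up to a constant.\<close>

lemma representation:
  obtains C :: real where "0 < C"
    "\<And>x t \<tau> r. 0 < \<tau> \<Longrightarrow> \<tau> < t \<Longrightarrow> t < T \<Longrightarrow> 0 < r \<Longrightarrow> cball x r \<subseteq> \<Omega> \<Longrightarrow>
      ennreal (u x t) \<le> ennreal C *
       ((\<integral>\<^sup>+y\<in>ball x r. ennreal (heat_kernel (x - y) (t - \<tau>) * uT y \<tau>) \<partial>lborel) +
        cyl_integral {\<tau><..<t} (ball x r) (\<lambda>y s. heat_kernel (x - y) (t - s) * sourceT y s) +
        ennreal (r powr (- real DIM('a) - 2)) *
          cyl_integral {\<tau><..<t} (ball x r) (\<lambda>y s. uT y s))"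
proof -
  obtain \<psi> \<psi>1 \<psi>2 C\<psi> where \<psi>:
    "\<And>q. (\<psi> has_real_derivative \<psi>1 q) (at q)" "\<And>q. (\<psi>1 has_real_derivative \<psi>2 q) (at q)"
    "continuous_on UNIV \<psi>2" "\<And>q. 0 \<le> \<psi> q" "\<And>q. \<psi> q \<le> 1" "\<And>q. q \<le> 1/4 \<Longrightarrow> \<psi> q = 1"
    "\<And>q. 1 \<le> q \<Longrightarrow> \<psi> q = 0" "\<And>q. q \<le> 1/4 \<or> 1 \<le> q \<Longrightarrow> \<psi>1 q = 0 \<and> \<psi>2 q = 0"
    "0 < C\<psi>" "\<And>q. \<bar>\<psi>1 q\<bar> \<le> C\<psi>" "\<And>q. \<bar>\<psi>2 q\<bar> \<le> C\<psi>"
    using C2_cutoff by metis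
  obtain Ck where Ck: "0 < Ck"
    "\<And>(x::'a) t \<rho>. 0 < \<rho> \<Longrightarrow> \<rho> \<le> norm x \<or> \<rho>\<^sup>2 \<le> t \<Longrightarrow>
       heat_kernel x t \<le> Ck * \<rho> powr (- real DIM('a))"
    "\<And>(x::'a) t \<rho>. 0 < \<rho> \<Longrightarrow> \<rho> \<le> norm x \<Longrightarrow> 0 < t \<Longrightarrow>
       heat_kernel x t * ((norm x)\<^sup>2 / t) \<le> Ck * \<rho> powr (- real DIM('a))"
    using heat_kernel_off_diagonal[where ?'a = 'a] by metis
  define N where "N = real DIM('a)"
  have N: "0 < N" by (simp add: N_def)
  \<comment> \<open>\<open>Ck * 2 powr N\<close> is the kernel bound at radius r/2; 2N + 2 + 4
    collects the three terms of \<open>err\<close>.\<close>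
  define C2 where "C2 = Ck * 2 powr N * C\<psi> * (2 * N + 6)"
  have C2: "0 < C2" using Ck \<psi>(9) N by (simp add: C2_def)
  \<comment> \<open>For every eta > 0, a lower bound for the heat kernel mass at time eta in the
    ball of radius sqrt(eta), where the exponential is at least exp(-1/4).\<close>
  define c where "c = (4 * pi) powr (- N / 2) * exp (-1/4) * unit_ball_vol N"
  have c: "0 < c" using N by (simp add: c_def)
  show ?thesis
  proof (rule that[of "2 / c * (1 + C2)"])
    show "0 < 2 / c * (1 + C2)" using c C2 by simp
  next
    fix x :: 'a and t \<tau> r :: real
    assume \<tau>: "0 < \<tau>" "\<tau> < t" and tT: "t < T" and r: "0 < r" and ball: "cball x r \<subseteq> \<Omega>"
    define E where "E = gauss N t"
    define Z where "Z q s = E q s * \<psi> (q / r\<^sup>2)" for q s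
    define Z1 where "Z1 q s = - E q s / (4 * (t - s)) * \<psi> (q / r\<^sup>2) + E q s * (\<psi>1 (q / r\<^sup>2) / r\<^sup>2)" for q s
    define Z2 where "Z2 q s = E q s / (16 * (t - s)\<^sup>2) * \<psi> (q / r\<^sup>2)
       - E q s / (2 * (t - s)) * (\<psi>1 (q / r\<^sup>2) / r\<^sup>2) + E q s * (\<psi>2 (q / r\<^sup>2) / r\<^sup>2 / r\<^sup>2)" for q s
    define Zs where "Zs q s = E q s * (N / (2 * (t - s)) - q / (4 * (t - s)\<^sup>2)) * \<psi> (q / r\<^sup>2)" for q s
    have line: "((\<lambda>q. q / r\<^sup>2) has_real_derivative 1 / r\<^sup>2) (at q)" for q
      by (intro DERIV_cdivide DERIV_ident)
    have d\<psi>: "((\<lambda>q. \<psi> (q / r\<^sup>2)) has_real_derivative \<psi>1 (q / r\<^sup>2) / r\<^sup>2) (at q)"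
      "((\<lambda>q. \<psi>1 (q / r\<^sup>2)) has_real_derivative \<psi>2 (q / r\<^sup>2) / r\<^sup>2) (at q)" for q
      using DERIV_chain2[OF \<psi>(1) line] DERIV_chain2[OF \<psi>(2) line] by (simp_all)
    have d1: "((\<lambda>q. Z q s) has_real_derivative Z1 q s) (at q)" if "s \<in> {0<..<t}" for q s
      unfolding Z_def Z1_def E_def using that
      by (auto intro!: derivative_eq_intros gauss_deriv_q d\<psi>)
    have d2: "((\<lambda>q. Z1 q s) has_real_derivative Z2 q s) (at q)" if "s \<in> {0<..<t}" for q s
    proof -
      have s: "s < t" "t - s \<noteq> 0" using that by auto
      have dE: "((\<lambda>q. E q s) has_real_derivative - E q s / (4 * (t - s))) (at q)"
        unfolding E_def using s(1) by (rule gauss_deriv_q)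
      from DERIV_add[OF DERIV_mult[OF DERIV_cdivide[OF DERIV_minus[OF dE]] d\<psi>(1)]
          DERIV_mult[OF dE DERIV_cdivide[OF d\<psi>(2)]], of "4 * (t - s)" "r\<^sup>2"]
      show ?thesis unfolding Z1_def
      proof (rule DERIV_cong)
        have "- (- e / (4 * k)) / (4 * k) * p + p1 / m * (- e / (4 * k)) + (- e / (4 * k) * (p1 / m) + p2 / m / m * e)
          = e / (16 * k\<^sup>2) * p - e / (2 * k) * (p1 / m) + e * (p2 / m / m)"
          if "k \<noteq> 0" "m \<noteq> 0" for e k p p1 p2 m :: real
          using that by (simp add: field_simps power2_eq_square)
        from this[OF s(2), of "r\<^sup>2"] r
        show "- (- E q s / (4 * (t - s))) / (4 * (t - s)) * \<psi> (q / r\<^sup>2) + \<psi>1 (q / r\<^sup>2) / r\<^sup>2 * (- E q s / (4 * (t - s)))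
          + (- E q s / (4 * (t - s)) * (\<psi>1 (q / r\<^sup>2) / r\<^sup>2) + \<psi>2 (q / r\<^sup>2) / r\<^sup>2 / r\<^sup>2 * E q s) = Z2 q s"
          unfolding Z2_def by simp
      qed
    qed
    have ds: "((\<lambda>s. Z q s) has_real_derivative Zs q s) (at s)" if "s \<in> {0<..<t}" for q s
      unfolding Z_def Zs_def E_def using that
      by (auto intro!: derivative_eq_intros gauss_deriv_s)
    have cE: "continuous_on (UNIV \<times> {0<..<t}) (\<lambda>z. E (fst z) (snd z))"
      unfolding E_def by (rule gauss_continuous)
    have c\<psi>: "continuous_on UNIV \<psi>" "continuous_on UNIV \<psi>1"
      using DERIV_continuous_on[of UNIV, OF \<psi>(1)] DERIV_continuous_on[of UNIV, OF \<psi>(2)] by simp_all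
    have c\<psi>q: "continuous_on (UNIV \<times> {0<..<t}) (\<lambda>z. g (fst z / r\<^sup>2))" if "continuous_on UNIV g" for g :: "real \<Rightarrow> real"
      by (rule continuous_on_compose2[OF that]) (use r in \<open>auto intro!: continuous_intros\<close>)
    have cZ: "continuous_on (UNIV \<times> {0<..<t}) (\<lambda>z. Z (fst z) (snd z))"
      "continuous_on (UNIV \<times> {0<..<t}) (\<lambda>z. Zs (fst z) (snd z))"
      "continuous_on (UNIV \<times> {0<..<t}) (\<lambda>z. Z1 (fst z) (snd z))"
      "continuous_on (UNIV \<times> {0<..<t}) (\<lambda>z. Z2 (fst z) (snd z))"
      unfolding Z_def Z1_def Z2_def Zs_def
      using r by (auto intro!: continuous_intros cE c\<psi>q c\<psi> \<psi>(3))
    have supp: "Z q s = 0 \<and> Z1 q s = 0" if "r\<^sup>2 \<le> q" for q s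
      using that r \<psi>(7)[of "q / r\<^sup>2"] \<psi>(8)[of "q / r\<^sup>2"] by (simp add: Z_def Z1_def)
    obtain a b where box: "cball x (r + 1) \<subseteq> cbox a b"
      using bounded_cball bounded_subset_cbox_symmetric by metis
    define Q where "Q y = (norm (y - x))\<^sup>2" for y
    define I where "I y s = Z (Q y) s * source y s +
      (Zs (Q y) s + (2 * N * Z1 (Q y) s + 4 * Q y * Z2 (Q y) s)) * u y s" for y s
    define H where "H s = integral (cbox a b) (\<lambda>y. Z (Q y) s * u y s)" for s
    note weak = weak_identity_radial[of t Z Zs Z1 Z2 r x a b, OF _ ds d1 d2 cZ supp _ box,
        folded Q_def N_def, folded I_def H_def]
    have H': "(H has_real_derivative integral (cbox a b) (\<lambda>y. I y s)) (at s)" if "s \<in> {0<..<t}" for s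
      using weak(1)[of s] that tT r by simp
    have cI: "continuous_on (UNIV \<times> {0<..<t}) (\<lambda>z. I (fst z) (snd z))"
      using weak(2) tT r by simp
    have cH': "continuous_on {0<..<t} (\<lambda>s. integral (cbox a b) (\<lambda>y. I y s))"
      using weak(3) tT r by simp
    have EQ: "E (Q y) s = heat_kernel (x - y) (t - s)" if "s < t" for y s
      unfolding E_def Q_def N_def using that by (rule gauss_heat_kernel)
    \<comment> \<open>All terms carrying \<open>\<psi>\<close> undifferentiated cancel, because
      \<open>E\<close> solves the backward heat equation.\<close>
    have err: "Zs q s + (2 * N * Z1 q s + 4 * q * Z2 q s) =
        E q s * ((2 * N / r\<^sup>2) * \<psi>1 (q / r\<^sup>2) - 2 * (q / (t - s)) / r\<^sup>2 * \<psi>1 (q / r\<^sup>2) + 4 * (q / r\<^sup>2) / r\<^sup>2 * \<psi>2 (q / r\<^sup>2))"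
      if "s < t" for q s
    proof -
      have "e * (N / (2 * k) - q / (4 * k\<^sup>2)) * p + (2 * N * (- e / (4 * k) * p + e * (p1 / m))
          + 4 * q * (e / (16 * k\<^sup>2) * p - e / (2 * k) * (p1 / m) + e * (p2 / m / m)))
        = e * ((2 * N / m) * p1 - 2 * (q / k) / m * p1 + 4 * (q / m) / m * p2)"
        if "k \<noteq> 0" "m \<noteq> 0" for e k p p1 p2 m :: real
        using that by (simp add: field_simps power2_eq_square)
      from this[of "t - s" "r\<^sup>2"] show ?thesis
        unfolding Zs_def Z1_def Z2_def using that r by simp
    qed
    have errb: "Zs (Q y) s + (2 * N * Z1 (Q y) s + 4 * Q y * Z2 (Q y) s) \<le> C2 * r powr (- N - 2)"
      if s: "s < t" and y: "y \<in> ball x r" for y s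
    proof (cases "Q y / r\<^sup>2 \<le> 1/4")
      case True
      then show ?thesis unfolding err[OF s] using \<psi>(8)[of "Q y / r\<^sup>2"] C2 by simp
    next
      case False
      define k where "k = heat_kernel (x - y) (t - s)"
      have q: "r / 2 \<le> norm (x - y)" "Q y / r\<^sup>2 \<le> 1" "0 \<le> Q y"
      proof -
        have "(r / 2)\<^sup>2 < (norm (y - x))\<^sup>2" using False r by (simp add: Q_def power2_eq_square field_simps)
        then have "r / 2 < norm (y - x)" by (rule power2_less_imp_less) simp
        then show "r / 2 \<le> norm (x - y)" by (simp add: norm_minus_commute)
        have "norm (y - x) \<le> r" using y by (simp add: dist_norm norm_minus_commute)
        then have "Q y \<le> r\<^sup>2" unfolding Q_def by (intro power_mono) auto
        then show "Q y / r\<^sup>2 \<le> 1" using r by simp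
      qed (simp add: Q_def)
      define B where "B = Ck * (r / 2) powr (- N)"
      have B: "k \<le> B" "k * (Q y / (t - s)) \<le> B"
        using Ck(2)[of "r / 2" "x - y" "t - s"] Ck(3)[of "r / 2" "x - y" "t - s"] q(1) r s
        by (simp_all add: k_def B_def N_def Q_def norm_minus_commute)
      have k0: "0 \<le> k" "0 \<le> k * (Q y / (t - s))" using s q by (auto simp: k_def)
      have ab: "\<psi>1 p \<le> C\<psi>" "- \<psi>1 p \<le> C\<psi>" "\<psi>2 p \<le> C\<psi>" for p using \<psi>(10)[of p] \<psi>(11)[of p] by auto
      have B0: "0 \<le> B" using Ck(1) by (simp add: B_def)
      have "Zs (Q y) s + (2 * N * Z1 (Q y) s + 4 * Q y * Z2 (Q y) s) =
         k * (2 * N / r\<^sup>2) * \<psi>1 (Q y / r\<^sup>2) + (k * (Q y / (t - s))) * (2 / r\<^sup>2) * (- \<psi>1 (Q y / r\<^sup>2))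
         + k * (4 * (Q y / r\<^sup>2) / r\<^sup>2) * \<psi>2 (Q y / r\<^sup>2)"
        unfolding err[OF s] EQ[OF s] k_def by (simp add: algebra_simps)
      also have "\<dots> \<le> B * (2 * N / r\<^sup>2) * C\<psi> + B * (2 / r\<^sup>2) * C\<psi> + B * (4 * 1 / r\<^sup>2) * C\<psi>"
      proof (intro add_mono)
        show "k * (2 * N / r\<^sup>2) * \<psi>1 (Q y / r\<^sup>2) \<le> B * (2 * N / r\<^sup>2) * C\<psi>"
          using B k0 N \<psi>(9) ab by (intro mult_mono' order_trans[OF mult_left_mono[OF ab(1)]] mult_right_mono) auto
        show "(k * (Q y / (t - s))) * (2 / r\<^sup>2) * (- \<psi>1 (Q y / r\<^sup>2)) \<le> B * (2 / r\<^sup>2) * C\<psi>"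
          using B k0 N \<psi>(9) ab q(3) s by (intro order_trans[OF mult_left_mono[OF ab(2)]] mult_right_mono mult_nonneg_nonneg) auto
        show "k * (4 * (Q y / r\<^sup>2) / r\<^sup>2) * \<psi>2 (Q y / r\<^sup>2) \<le> B * (4 * 1 / r\<^sup>2) * C\<psi>"
          using B k0 N B0 \<psi>(9) ab q by (intro order_trans[OF mult_left_mono[OF ab(3)]] mult_right_mono mult_mono divide_right_mono mult_left_mono mult_nonneg_nonneg) auto
      qed
      also have "\<dots> = C2 * r powr (- N - 2)"
      proof -
        have e1: "r powr (- N - 2) = r powr (- N) / r\<^sup>2"
          using r by (simp add: powr_diff flip: powr_numeral)
        have e2: "(r / 2) powr (- N) = 2 powr N * r powr (- N)"
          using r by (simp add: powr_divide powr_minus field_simps)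
        show ?thesis unfolding B_def C2_def e1 e2 using r by (simp add: field_simps)
      qed
      finally show ?thesis .
    qed
    have Z_le: "Z (Q y) s \<le> heat_kernel (x - y) (t - s)" and Z_ge: "0 \<le> Z (Q y) s" if "s < t" for y s
      using \<psi>(4,5)[of "Q y / r\<^sup>2"] EQ[OF that, of y] by (simp_all add: Z_def mult_left_le)
    have outside: "Z (Q y) s = 0" "I y s = 0" if "y \<notin> ball x r" "s < t" for y s
    proof -
      have "r \<le> norm (y - x)" using that by (simp add: dist_norm norm_minus_commute)
      then have q: "r\<^sup>2 \<le> Q y" unfolding Q_def using r by (intro power_mono) auto
      then show z: "Z (Q y) s = 0" using supp by simp
      have "Zs (Q y) s + (2 * N * Z1 (Q y) s + 4 * Q y * Z2 (Q y) s) = 0"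
        unfolding err[OF that(2)] using \<psi>(8)[of "Q y / r\<^sup>2"] q r by simp
      then show "I y s = 0" by (simp add: I_def z)
    qed
    define R where "R = r powr (- N - 2)"
    define A1 where "A1 = (\<integral>\<^sup>+y\<in>ball x r. ennreal (heat_kernel (x - y) (t - \<tau>) * uT y \<tau>) \<partial>lborel)"
    define a2 where "a2 s = (\<integral>\<^sup>+y\<in>ball x r. ennreal (heat_kernel (x - y) (t - s) * sourceT y s) \<partial>lborel)" for s
    define a3 where "a3 s = (\<integral>\<^sup>+y\<in>ball x r. ennreal (uT y s) \<partial>lborel)" for s
    have meas[measurable]: "a2 \<in> borel_measurable lborel" "a3 \<in> borel_measurable lborel"
      unfolding a2_def a3_def by measurable
    define A2 where "A2 = (\<integral>\<^sup>+s\<in>{\<tau><..<t}. a2 s \<partial>lborel)"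
    define A3 where "A3 = (\<integral>\<^sup>+s\<in>{\<tau><..<t}. a3 s \<partial>lborel)"
    have H'_le: "ennreal (integral (cbox a b) (\<lambda>y. I y s)) \<le> a2 s + ennreal (C2 * R) * a3 s"
      if s: "s \<in> {0<..<t}" for s
    proof -
      have sT: "s \<in> {0<..<T}" using s tT by auto
      have "ennreal (integral (cbox a b) (\<lambda>y. I y s)) \<le> (\<integral>\<^sup>+y\<in>cbox a b. ennreal (I y s) \<partial>lborel)"
        by (intro integral_le_set_nn_integral continuous_on_compose_pair[OF cI] continuous_intros) (use s in auto)
      also have "\<dots> \<le> (\<integral>\<^sup>+y. ennreal (heat_kernel (x - y) (t - s) * sourceT y s) * indicator (ball x r) y +
          ennreal (C2 * R) * (ennreal (uT y s) * indicator (ball x r) y) \<partial>lborel)"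
      proof (intro nn_integral_mono)
        fix y
        show "ennreal (I y s) * indicator (cbox a b) y \<le> ennreal (heat_kernel (x - y) (t - s) * sourceT y s) * indicator (ball x r) y +
          ennreal (C2 * R) * (ennreal (uT y s) * indicator (ball x r) y)"
        proof (cases "y \<in> ball x r")
          case True
          then have f0: "0 \<le> source y s" by (intro source_nonneg[OF _ sT] subsetD[OF ball]) auto
          have u0: "0 \<le> u y s" using sT by (rule u_nonneg)
          have "I y s \<le> heat_kernel (x - y) (t - s) * source y s + C2 * R * u y s"
            unfolding I_def R_def using s True f0 u0 by (intro add_mono mult_right_mono Z_le errb) auto
          then have "ennreal (I y s) \<le> ennreal (heat_kernel (x - y) (t - s) * sourceT y s + C2 * R * uT y s)"
            using sT by (intro ennreal_leI) (simp add: sourceT_def uT_def)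
          also have "\<dots> = ennreal (heat_kernel (x - y) (t - s) * sourceT y s) + ennreal (C2 * R) * ennreal (uT y s)"
            using f0 sT C2 by (simp add: sourceT_def R_def ennreal_mult)
          finally show ?thesis using True by (auto simp: indicator_def)
        next
          case False then show ?thesis using s by (simp add: outside)
        qed
      qed
      also have "\<dots> = a2 s + ennreal (C2 * R) * a3 s"
        unfolding a2_def a3_def
        by (simp add: nn_integral_add nn_integral_cmult)
      finally show ?thesis .
    qed
    have H_le: "ennreal (H s) \<le> A1 + (A2 + ennreal (C2 * R) * A3)" if s: "\<tau> \<le> s" "s < t" for s
    proof -
      have "((\<lambda>s. integral (cbox a b) (\<lambda>y. I y s)) has_integral H s - H \<tau>) {\<tau>..s}"
      proof (rule fundamental_theorem_of_calculus[OF s(1)])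
        fix v assume "v \<in> {\<tau>..s}"
        then have "v \<in> {0<..<t}" using \<tau> s by auto
        from H'[OF this] show "(H has_vector_derivative integral (cbox a b) (\<lambda>y. I y v)) (at v within {\<tau>..s})"
          using has_field_derivative_at_within has_real_derivative_iff_has_vector_derivative by blast
      qed
      then have eq: "H s = H \<tau> + integral {\<tau>..s} (\<lambda>s. integral (cbox a b) (\<lambda>y. I y s))"
        by (simp add: integral_unique)
      have "ennreal (integral {\<tau>..s} (\<lambda>s. integral (cbox a b) (\<lambda>y. I y s)))
          \<le> (\<integral>\<^sup>+v\<in>{\<tau>..s}. ennreal (integral (cbox a b) (\<lambda>y. I y v)) \<partial>lborel)"
        using integral_le_set_nn_integral[of \<tau> s "\<lambda>s. integral (cbox a b) (\<lambda>y. I y s)"]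
          continuous_on_subset[OF cH', of "{\<tau>..s}"] \<tau> s by (auto simp: subset_eq)
      also have "\<dots> \<le> (\<integral>\<^sup>+v. a2 v * indicator {\<tau>..s} v + ennreal (C2 * R) * (a3 v * indicator {\<tau>..s} v) \<partial>lborel)"
        using \<tau> s H'_le by (intro nn_integral_mono) (auto simp: indicator_def)
      also have "\<dots> = (\<integral>\<^sup>+v\<in>{\<tau>..s}. a2 v \<partial>lborel) + ennreal (C2 * R) * (\<integral>\<^sup>+v\<in>{\<tau>..s}. a3 v \<partial>lborel)"
        by (simp add: nn_integral_add nn_integral_cmult)
      also have "\<dots> \<le> A2 + ennreal (C2 * R) * A3"
      proof -
        \<comment> \<open>The closed interval exceeds the open one only by the null set
          {\<open>\<tau>\<close>}.\<close>
        have "(\<integral>\<^sup>+v\<in>{\<tau>..s}. g v \<partial>lborel) \<le> (\<integral>\<^sup>+v\<in>{\<tau><..<t}. g v \<partial>lborel)" for g :: "real \<Rightarrow> ennreal"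
        proof (rule nn_integral_mono_AE)
          show "AE v in lborel. g v * indicator {\<tau>..s} v \<le> g v * indicator {\<tau><..<t} v"
            using AE_lborel_singleton[of \<tau>] by eventually_elim (use s in \<open>auto simp: indicator_def\<close>)
        qed
        then show ?thesis unfolding A2_def A3_def by (intro add_mono mult_left_mono) auto
      qed
      finally have 1: "ennreal (integral {\<tau>..s} (\<lambda>s. integral (cbox a b) (\<lambda>y. I y s))) \<le> A2 + ennreal (C2 * R) * A3" .
      have \<tau>T: "\<tau> \<in> {0<..<T}" using \<tau> tT by auto
      have "ennreal (H \<tau>) \<le> (\<integral>\<^sup>+y\<in>cbox a b. ennreal (Z (Q y) \<tau> * u y \<tau>) \<partial>lborel)"
        unfolding H_def Q_def using \<tau> tT
        by (intro integral_le_set_nn_integral continuous_on_mult continuous_on_compose_pair[OF cZ(1)]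
            cont_slice[OF cont_u] continuous_intros) auto
      also have "\<dots> \<le> A1"
        unfolding A1_def
      proof (intro nn_integral_mono)
        fix y
        show "ennreal (Z (Q y) \<tau> * u y \<tau>) * indicator (cbox a b) y \<le>
          ennreal (heat_kernel (x - y) (t - \<tau>) * uT y \<tau>) * indicator (ball x r) y"
        proof (cases "y \<in> ball x r")
          case True
          then show ?thesis using Z_le[of \<tau> y] u_nonneg[OF \<tau>T, of y] \<tau> \<tau>T
            by (auto simp: indicator_def uT_def intro!: ennreal_leI mult_right_mono)
        next
          case False then show ?thesis using \<tau> by (simp add: outside)
        qed
      qed
      finally have 2: "ennreal (H \<tau>) \<le> A1" .
      have "ennreal (H s) \<le> ennreal (H \<tau>) + ennreal (integral {\<tau>..s} (\<lambda>s. integral (cbox a b) (\<lambda>y. I y s)))"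
        unfolding eq by (cases "0 \<le> H \<tau>"; cases "0 \<le> integral {\<tau>..s} (\<lambda>s. integral (cbox a b) (\<lambda>y. I y s))")
          (auto simp: ennreal_neg intro!: ennreal_leI)
      also have "\<dots> \<le> A1 + (A2 + ennreal (C2 * R) * A3)" by (intro add_mono 1 2)
      finally show ?thesis .
    qed
    have low: "ennreal (c / 2 * u x t) \<le> A1 + (A2 + ennreal (C2 * R) * A3)"
    proof (cases "u x t > 0")
      case False
      then show ?thesis using c by (simp add: ennreal_neg mult_nonneg_nonpos)
    next
      case True
      have "isCont (\<lambda>z. u (fst z) (snd z)) (x, t)"
        using cont_u \<tau> tT by (auto simp: continuous_on_eq_continuous_at open_Times)
      then obtain \<delta> where \<delta>: "0 < \<delta>" "\<And>z. dist z (x, t) < \<delta> \<Longrightarrow> dist (u (fst z) (snd z)) (u x t) < u x t / 2"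
        using True unfolding continuous_at_eps_delta by (metis fst_conv snd_conv half_gt_zero)
      \<comment> \<open>Three demands: points (y, t - eta) with |y - x| <= sqrt(eta) lie within
        delta of (x,t), so that u > u(x,t)/2 there; sqrt(eta) <= r/2, so that the cutoff equals 1;
        and t - eta stays above \<open>\<tau>\<close>.\<close>
      define \<eta> where "\<eta> = min (min (\<delta> / 4) ((min (\<delta> / 4) (r / 2))\<^sup>2)) ((t - \<tau>) / 2)"
      have \<eta>: "0 < \<eta>" "\<eta> \<le> \<delta> / 4" "\<eta> \<le> (min (\<delta> / 4) (r / 2))\<^sup>2" "\<eta> \<le> (t - \<tau>) / 2"
        unfolding \<eta>_def
        using \<delta>(1) r \<tau> order_trans[OF min.cobounded1 min.cobounded1] order_trans[OF min.cobounded1 min.cobounded2]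
        by (simp, blast, blast, intro min.cobounded2)
      have "sqrt \<eta> \<le> min (\<delta> / 4) (r / 2)"
        using real_sqrt_le_mono[OF \<eta>(3)] \<delta>(1) r by simp
      then have sq: "sqrt \<eta> \<le> \<delta> / 4" "sqrt \<eta> \<le> r / 2" by simp_all
      define s where "s = t - \<eta>"
      have s: "\<tau> \<le> s" "s < t" "s \<in> {0<..<T}" using \<eta> \<tau> tT by (auto simp: s_def)
      define e where "e = (4 * pi * \<eta>) powr (- N / 2) * exp (-1/4) * (u x t / 2)"
      have pt: "e \<le> Z (Q y) s * u y s" if y: "y \<in> cball x (sqrt \<eta>)" for y
      proof -
        have ny: "norm (y - x) \<le> sqrt \<eta>" using y by (simp add: dist_norm norm_minus_commute)
        then have "Q y \<le> (sqrt \<eta>)\<^sup>2" unfolding Q_def by (intro power_mono) auto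
        then have q: "Q y \<le> \<eta>" using \<eta> by simp
        have "Q y \<le> (r / 2)\<^sup>2" unfolding Q_def using ny sq by (intro power_mono) auto
        then have "\<psi> (Q y / r\<^sup>2) = 1" using r by (intro \<psi>(6)) (simp add: field_simps power2_eq_square)
        then have "Z (Q y) s = (4 * pi * \<eta>) powr (- N / 2) * exp (- Q y / (4 * \<eta>))"
          by (simp add: Z_def E_def gauss_def s_def)
        moreover have "exp (-1/4) \<le> exp (- Q y / (4 * \<eta>))" using q \<eta> by (simp add: field_simps)
        ultimately have 1: "(4 * pi * \<eta>) powr (- N / 2) * exp (-1/4) \<le> Z (Q y) s"
          by (simp add: mult_left_mono)
        have "dist (y, s) (x, t) \<le> dist y x + dist s t"
          unfolding dist_prod_def by (simp add: sqrt_sum_squares_le_sum)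
        also have "\<dots> < \<delta>" using ny sq \<eta> \<delta>(1) by (simp add: dist_norm s_def)
        finally have "\<bar>u y s - u x t\<bar> < u x t / 2" using \<delta>(2)[of "(y, s)"] by (simp add: dist_real_def)
        then have "u x t / 2 \<le> u y s" by linarith
        then show ?thesis unfolding e_def using 1 True Z_ge[OF s(2)] by (intro mult_mono) auto
      qed
      have sub: "cball x (sqrt \<eta>) \<subseteq> cbox a b" 
      proof -
        have "cball x (sqrt \<eta>) \<subseteq> cball x (r + 1)" using sq r by (intro subset_cball) auto
        then show ?thesis using box by blast
      qed
      have "ennreal (c / 2 * u x t) = ennreal e * emeasure lborel (cball x (sqrt \<eta>))"
      proof -
        have "sqrt \<eta> ^ DIM('a) = \<eta> powr (N / 2)"
          using \<eta> by (simp add: N_def powr_half_sqrt[symmetric] powr_realpow[symmetric] powr_powr)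
        moreover have "(4 * pi * \<eta>) powr (- N / 2) = (4 * pi) powr (- N / 2) * \<eta> powr (- N / 2)"
          using \<eta> by (simp add: powr_mult)
        moreover have "\<eta> powr (- N / 2) * \<eta> powr (N / 2) = 1" using \<eta> by (simp add: powr_add[symmetric])
        ultimately have "e * (unit_ball_vol N * sqrt \<eta> ^ DIM('a)) = c / 2 * u x t"
          by (simp add: e_def c_def mult_ac)
        then have "ennreal (c / 2 * u x t) = ennreal (e * (unit_ball_vol N * sqrt \<eta> ^ DIM('a)))" by (simp only:)
        also have "\<dots> = ennreal e * ennreal (unit_ball_vol N * sqrt \<eta> ^ DIM('a))"
          using True N \<eta>(1) by (intro ennreal_mult) (auto simp: e_def)
        finally show ?thesis using \<eta>(1) by (simp add: emeasure_cball N_def)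
      qed
      also have "\<dots> = (\<integral>\<^sup>+y. ennreal e * indicator (cball x (sqrt \<eta>)) y \<partial>lborel)"
        by (subst nn_integral_cmult_indicator) auto
      also have "\<dots> \<le> (\<integral>\<^sup>+y\<in>cbox a b. ennreal (Z (Q y) s * u y s) \<partial>lborel)"
        using pt sub by (intro nn_integral_mono) (auto simp: indicator_def intro!: ennreal_leI)
      also have "\<dots> = ennreal (H s)"
        unfolding H_def Q_def using s \<tau> Z_ge[OF s(2)] u_nonneg[OF s(3)]
        by (intro set_nn_integral_cbox_continuous continuous_on_mult continuous_on_compose_pair[OF cZ(1)]
            cont_slice[OF cont_u] continuous_intros) (auto simp: Q_def)
      also have "\<dots> \<le> A1 + (A2 + ennreal (C2 * R) * A3)" using s by (intro H_le)
      finally show ?thesis .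
    qed
    have "ennreal (u x t) = ennreal (2 / c) * ennreal (c / 2 * u x t)"
      using c u_nonneg[of t x] \<tau> tT by (simp add: ennreal_mult[symmetric])
    also have "\<dots> \<le> ennreal (2 / c) * (A1 + (A2 + ennreal (C2 * R) * A3))"
      using low by (intro mult_left_mono) auto
    also have "\<dots> \<le> ennreal (2 / c) * (ennreal (1 + C2) * (A1 + A2 + ennreal R * A3))"
    proof (intro mult_left_mono)
      have "A1 + (A2 + ennreal (C2 * R) * A3) \<le> ennreal (1 + C2) * A1 + (ennreal (1 + C2) * A2 + ennreal (1 + C2) * (ennreal R * A3))"
      proof (intro add_mono)
        have g: "X \<le> ennreal (1 + C2) * X" for X
          using mult_right_mono[of 1 "ennreal (1 + C2)" X] C2 by simp
        show "A1 \<le> ennreal (1 + C2) * A1" "A2 \<le> ennreal (1 + C2) * A2" by (rule g)+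
        have "ennreal (C2 * R) * A3 = ennreal C2 * (ennreal R * A3)"
          using C2 by (simp add: ennreal_mult R_def mult_ac)
        also have "\<dots> \<le> ennreal (1 + C2) * (ennreal R * A3)" by (intro mult_right_mono ennreal_leI) auto
        finally show "ennreal (C2 * R) * A3 \<le> ennreal (1 + C2) * (ennreal R * A3)" .
      qed
      then show "A1 + (A2 + ennreal (C2 * R) * A3) \<le> ennreal (1 + C2) * (A1 + A2 + ennreal R * A3)"
        by (simp add: distrib_left add.assoc)
    qed auto
    also have "\<dots> = ennreal (2 / c * (1 + C2)) * (A1 + A2 + ennreal R * A3)"
    proof -
      have "ennreal (2 / c * (1 + C2)) = ennreal (2 / c) * ennreal (1 + C2)"
        using c C2 by (intro ennreal_mult) auto
      then show ?thesis by (simp only: mult.assoc)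
    qed
    finally show "ennreal (u x t) \<le> ennreal (2 / c * (1 + C2)) *
       ((\<integral>\<^sup>+y\<in>ball x r. ennreal (heat_kernel (x - y) (t - \<tau>) * uT y \<tau>) \<partial>lborel) +
        cyl_integral {\<tau><..<t} (ball x r) (\<lambda>y s. heat_kernel (x - y) (t - s) * sourceT y s) +
        ennreal (r powr (- real DIM('a) - 2)) *
          cyl_integral {\<tau><..<t} (ball x r) (\<lambda>y s. uT y s))"
      by (simp add: A1_def A2_def A3_def a2_def a3_def R_def N_def)
  qed
qed

end

section \<open>Averaging in time and local mass bounds\<close>

text \<open>Monotone convergence. It carries estimates that start at a positive time down to time 0,
  where nothing is assumed about u.\<close>

lemma set_nn_integral_Ioo_limit:
  fixes g :: "real \<Rightarrow> ennreal"
  assumes [measurable]: "g \<in> borel_measurable lborel"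
    and le: "\<And>\<tau>. 0 < \<tau> \<Longrightarrow> \<tau> < b \<Longrightarrow> (\<integral>\<^sup>+s\<in>{\<tau><..<b}. g s \<partial>lborel) \<le> M"
  shows "(\<integral>\<^sup>+s\<in>{0<..<b}. g s \<partial>lborel) \<le> M"
proof (cases "0 < b")
  case True
  define h where "h k s = g s * indicator {b / (real k + 2)<..<b} s" for k s
  have mono: "incseq h"
  proof (intro incseq_SucI le_funI)
    fix k s
    have "b / (real (Suc k) + 2) \<le> b / (real k + 2)" using True by (intro divide_left_mono) auto
    then show "h k s \<le> h (Suc k) s" by (auto simp: h_def indicator_def)
  qed
  have "g s * indicator {0<..<b} s \<le> (SUP k. h k s)" for s
  proof (cases "s \<in> {0<..<b}")
    case s: True
    obtain k where "b / s < real k" using reals_Archimedean2 by blast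
    then have "b < s * real k" using s by (simp add: field_simps)
    also have "\<dots> \<le> s * (real k + 2)" using s by simp
    finally have "b / (real k + 2) < s" by (simp add: field_simps)
    then have "g s * indicator {0<..<b} s = h k s" using s by (simp add: h_def)
    also have "\<dots> \<le> (SUP k. h k s)" by (rule SUP_upper) simp
    finally show ?thesis .
  qed simp
  then have "(\<integral>\<^sup>+s\<in>{0<..<b}. g s \<partial>lborel) \<le> (\<integral>\<^sup>+s. (SUP k. h k s) \<partial>lborel)"
    by (intro nn_integral_mono)
  also have "\<dots> = (SUP k. \<integral>\<^sup>+s. h k s \<partial>lborel)"
  proof (rule nn_integral_monotone_convergence_SUP[OF mono])
    show "h k \<in> borel_measurable lborel" for k unfolding h_def by measurable
  qed
  also have "\<dots> \<le> M"
    unfolding h_def using True by (intro SUP_least le) (auto simp: field_simps add_pos_nonneg)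
  finally show ?thesis .
qed simp

context supersolution
begin

text \<open>Averages \<open>representation\<close> over starting times between t - rho^2 and t -
  rho^2/2. There the kernel is at most (rho^2/2)^(-n/2), so the slice integral becomes rho^(-n-2)
  times a space-time integral and no individual time slice of u remains.\<close>

lemma cylinder_representation:
  obtains C :: real where "0 < C"
    "\<And>x t \<rho>. 0 < \<rho> \<Longrightarrow> \<rho>\<^sup>2 < t \<Longrightarrow> t < T \<Longrightarrow> cball x \<rho> \<subseteq> \<Omega> \<Longrightarrow>
      ennreal (u x t) \<le> ennreal C *
       (ennreal (\<rho> powr (- real DIM('a) - 2)) *
          cyl_integral {t - \<rho>\<^sup>2<..<t} (ball x \<rho>) (\<lambda>y s. uT y s) +
        cyl_integral {t - \<rho>\<^sup>2<..<t} (ball x \<rho>) (\<lambda>y s. heat_kernel (x - y) (t - s) * sourceT y s))"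
proof -
  define N where "N = real DIM('a)"
  obtain C where C: "0 < C"
    "\<And>x t \<tau> r. 0 < \<tau> \<Longrightarrow> \<tau> < t \<Longrightarrow> t < T \<Longrightarrow> 0 < r \<Longrightarrow> cball x r \<subseteq> \<Omega> \<Longrightarrow>
      ennreal (u x t) \<le> ennreal C *
       ((\<integral>\<^sup>+y\<in>ball x r. ennreal (heat_kernel (x - y) (t - \<tau>) * uT y \<tau>) \<partial>lborel) +
        cyl_integral {\<tau><..<t} (ball x r) (\<lambda>y s. heat_kernel (x - y) (t - s) * sourceT y s) +
        ennreal (r powr (- N - 2)) *
          cyl_integral {\<tau><..<t} (ball x r) (\<lambda>y s. uT y s))"
    by (rule representation[folded N_def]) (rule that)
  \<comment> \<open>2^(n/2) comes from (rho^2/2)^(-n/2), the further factor 2 from dividing by the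
    length rho^2/2 of \<open>J\<close>.\<close>
  define D where "D = 2 powr (N / 2 + 1)"
  have D: "0 < D" by (simp add: D_def)
  show ?thesis
  proof (rule that[of "C * (1 + D)"])
    show "0 < C * (1 + D)" using C D by simp
  next
    fix x t \<rho> assume \<rho>: "0 < \<rho>" "\<rho>\<^sup>2 < t" and tT: "t < T" and ball: "cball x \<rho> \<subseteq> \<Omega>"
    define a2 where "a2 s = (\<integral>\<^sup>+y\<in>ball x \<rho>. ennreal (heat_kernel (x - y) (t - s) * sourceT y s) \<partial>lborel)" for s
    define a3 where "a3 s = (\<integral>\<^sup>+y\<in>ball x \<rho>. ennreal (uT y s) \<partial>lborel)" for s
    have meas[measurable]: "a2 \<in> borel_measurable lborel" "a3 \<in> borel_measurable lborel"
      unfolding a2_def a3_def by measurable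
    define A2 where "A2 = (\<integral>\<^sup>+s\<in>{t - \<rho>\<^sup>2<..<t}. a2 s \<partial>lborel)"
    define A3 where "A3 = (\<integral>\<^sup>+s\<in>{t - \<rho>\<^sup>2<..<t}. a3 s \<partial>lborel)"
    define R where "R = \<rho> powr (- N - 2)"
    define B where "B = (\<rho>\<^sup>2 / 2) powr (- N / 2)"
    define J where "J = {t - \<rho>\<^sup>2<..<t - \<rho>\<^sup>2 / 2}"
    have J: "emeasure lborel J = ennreal (\<rho>\<^sup>2 / 2)"
      using \<rho> by (simp add: J_def)
    have slice: "ennreal (u x t) \<le> ennreal C * (ennreal B * a3 \<tau> + A2 + ennreal R * A3)" if \<tau>: "\<tau> \<in> J" for \<tau>
    proof -
      have \<tau>': "0 < \<tau>" "\<tau> < t" "\<rho>\<^sup>2 / 2 \<le> t - \<tau>" using \<tau> \<rho> by (auto simp: J_def)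
      have "ennreal (u x t) \<le> ennreal C *
       ((\<integral>\<^sup>+y\<in>ball x \<rho>. ennreal (heat_kernel (x - y) (t - \<tau>) * uT y \<tau>) \<partial>lborel) +
        (\<integral>\<^sup>+s\<in>{\<tau><..<t}. a2 s \<partial>lborel) + ennreal R * (\<integral>\<^sup>+s\<in>{\<tau><..<t}. a3 s \<partial>lborel))"
        using C(2)[OF \<tau>'(1,2) tT \<rho>(1) ball] by (simp add: a2_def a3_def R_def)
      also have "\<dots> \<le> ennreal C * (ennreal B * a3 \<tau> + A2 + ennreal R * A3)"
      proof (intro mult_left_mono add_mono)
        have "heat_kernel (x - y) (t - \<tau>) \<le> B" for y
        proof -
          have "heat_kernel (x - y) (t - \<tau>) \<le> (t - \<tau>) powr (- N / 2)"
            unfolding N_def using \<tau>' by (intro heat_kernel_le_powr) auto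
          also have "\<dots> \<le> B" unfolding B_def using \<tau>' \<rho> by (intro powr_mono2') (auto simp: N_def)
          finally show ?thesis .
        qed
        then have "(\<integral>\<^sup>+y\<in>ball x \<rho>. ennreal (heat_kernel (x - y) (t - \<tau>) * uT y \<tau>) \<partial>lborel)
          \<le> (\<integral>\<^sup>+y. ennreal B * (ennreal (uT y \<tau>) * indicator (ball x \<rho>) y) \<partial>lborel)"
          by (intro nn_integral_mono)
            (auto simp: indicator_def B_def ennreal_mult[symmetric] intro!: ennreal_leI mult_right_mono)
        also have "\<dots> = ennreal B * a3 \<tau>"
          unfolding a3_def by (rule nn_integral_cmult) measurable
        finally show "(\<integral>\<^sup>+y\<in>ball x \<rho>. ennreal (heat_kernel (x - y) (t - \<tau>) * uT y \<tau>) \<partial>lborel) \<le> ennreal B * a3 \<tau>" .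
        show "(\<integral>\<^sup>+s\<in>{\<tau><..<t}. a2 s \<partial>lborel) \<le> A2" "(\<integral>\<^sup>+s\<in>{\<tau><..<t}. a3 s \<partial>lborel) \<le> A3"
          unfolding A2_def A3_def using \<tau> by (auto intro!: nn_set_integral_set_mono simp: J_def)
      qed auto
      finally show ?thesis .
    qed
    have "ennreal (u x t) * ennreal (\<rho>\<^sup>2 / 2) = (\<integral>\<^sup>+\<tau>. ennreal (u x t) * indicator J \<tau> \<partial>lborel)"
      by (subst nn_integral_cmult_indicator) (auto simp: J, simp add: J_def)
    also have "\<dots> \<le> (\<integral>\<^sup>+\<tau>. ennreal C * (ennreal B * (a3 \<tau> * indicator J \<tau>) + (A2 + ennreal R * A3) * indicator J \<tau>) \<partial>lborel)"
      using slice by (intro nn_integral_mono) (auto simp: indicator_def add.assoc)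
    also have "\<dots> = ennreal C * (ennreal B * (\<integral>\<^sup>+\<tau>\<in>J. a3 \<tau> \<partial>lborel) + (A2 + ennreal R * A3) * emeasure lborel J)"
      by (simp add: nn_integral_add nn_integral_cmult nn_integral_cmult_indicator J_def)
    also have "\<dots> \<le> ennreal C * (ennreal B * A3 + (A2 + ennreal R * A3) * ennreal (\<rho>\<^sup>2 / 2))"
      unfolding J A3_def using \<rho> by (intro mult_left_mono add_mono nn_set_integral_set_mono) (auto simp: J_def)
    finally have 1: "ennreal (u x t) * ennreal (\<rho>\<^sup>2 / 2) \<le> ennreal C * (ennreal B * A3 + (A2 + ennreal R * A3) * ennreal (\<rho>\<^sup>2 / 2))" .
    have RB: "B * (2 / \<rho>\<^sup>2) = D * R"
    proof -
      have "(\<rho>\<^sup>2) powr (- N / 2) = \<rho> powr (- N)" using power2_powr[of \<rho> "- N / 2"] \<rho> by simp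
      then have "B = 2 powr (N / 2) * \<rho> powr (- N)"
        unfolding B_def using \<rho> by (simp add: powr_divide powr_minus field_simps)
      moreover have "R = \<rho> powr (- N) / \<rho>\<^sup>2" unfolding R_def using \<rho> by (simp add: powr_diff flip: powr_numeral)
      moreover have "D = 2 * 2 powr (N / 2)" by (simp add: D_def powr_add)
      ultimately show ?thesis by simp
    qed
    have inv: "ennreal (\<rho>\<^sup>2 / 2) * ennreal (2 / \<rho>\<^sup>2) = 1" using \<rho> by (simp flip: ennreal_mult)
    have "ennreal (u x t) = ennreal (u x t) * ennreal (\<rho>\<^sup>2 / 2) * ennreal (2 / \<rho>\<^sup>2)"
      by (simp add: mult.assoc inv)
    also have "\<dots> \<le> ennreal C * (ennreal B * A3 + (A2 + ennreal R * A3) * ennreal (\<rho>\<^sup>2 / 2)) * ennreal (2 / \<rho>\<^sup>2)"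
      by (intro mult_right_mono 1) auto
    also have "\<dots> = ennreal C * ((ennreal B * ennreal (2 / \<rho>\<^sup>2)) * A3 + (A2 + ennreal R * A3) * (ennreal (\<rho>\<^sup>2 / 2) * ennreal (2 / \<rho>\<^sup>2)))"
      by (simp only: distrib_right distrib_left mult_ac)
    also have "ennreal B * ennreal (2 / \<rho>\<^sup>2) = ennreal D * ennreal R"
      using RB D by (simp add: B_def R_def flip: ennreal_mult)
    also have "ennreal C * ((ennreal D * ennreal R) * A3 + (A2 + ennreal R * A3) * (ennreal (\<rho>\<^sup>2 / 2) * ennreal (2 / \<rho>\<^sup>2)))
      = ennreal C * (ennreal (1 + D) * (ennreal R * A3) + A2)"
      unfolding inv using D by (simp add: distrib_right distrib_left add_ac mult_ac)
    also have "\<dots> \<le> ennreal C * (ennreal (1 + D) * (ennreal R * A3) + ennreal (1 + D) * A2)"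
      using mult_right_mono[of 1 "ennreal (1 + D)" A2] D by (intro mult_left_mono add_mono) auto
    also have "\<dots> = ennreal (C * (1 + D)) * (ennreal R * A3 + A2)"
    proof -
      have "ennreal (C * (1 + D)) = ennreal C * ennreal (1 + D)" using C D by (intro ennreal_mult) auto
      then show ?thesis by (simp only: mult.assoc distrib_left)
    qed
    finally show "ennreal (u x t) \<le> ennreal (C * (1 + D)) *
       (ennreal (\<rho> powr (- real DIM('a) - 2)) *
          cyl_integral {t - \<rho>\<^sup>2<..<t} (ball x \<rho>) (\<lambda>y s. uT y s) +
        cyl_integral {t - \<rho>\<^sup>2<..<t} (ball x \<rho>) (\<lambda>y s. heat_kernel (x - y) (t - s) * sourceT y s))"
      by (simp add: A2_def A3_def a2_def a3_def R_def N_def)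
  qed
qed

section \<open>Local mass bounds down to time 0\<close>

text \<open>The weight exp(kappa s) (1 - q/r^2)_+^3 has nonnegative backward heat operator. Hence
  the weighted mass \<open>H\<close> is nondecreasing in time, and its growth dominates the weighted
  integral of f. Both are therefore bounded by the value of \<open>H\<close> at the later time
  \<open>T'\<close>, where u is bounded on compact sets; the behaviour of u as s tends to 0 never
  enters.\<close>

lemma mass_bound:
  assumes K1: "compact K1" and R: "0 < R" and sub: "\<And>x. x \<in> K1 \<Longrightarrow> cball x (2 * R) \<subseteq> \<Omega>"
    and T': "0 < T'" "T' < T"
  obtains m :: real where "0 < m"
    "\<And>x s. x \<in> K1 \<Longrightarrow> 0 < s \<Longrightarrow> s < T' \<Longrightarrow> (\<integral>\<^sup>+y\<in>ball x R. ennreal (uT y s) \<partial>lborel) \<le> ennreal m"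
    "\<And>x. x \<in> K1 \<Longrightarrow> cyl_integral {0<..<T'} (ball x R) (\<lambda>y s. sourceT y s) \<le> ennreal m"
proof -
  define N where "N = real DIM('a)"
  define r where "r = 2 * R"
  have r: "0 < r" using R by (simp add: r_def)
  define \<kappa> where "\<kappa> = (6 * N + 24)\<^sup>2 / (96 * r\<^sup>2)"
  have \<kappa>: "0 \<le> \<kappa>" by (simp add: \<kappa>_def)
  define M where "M q = max 0 (1 - q / r\<^sup>2)" for q
  define Z where "Z q s = exp (\<kappa> * s) * M q ^ 3" for q s
  define Z1 where "Z1 q s = exp (\<kappa> * s) * (3 * M q ^ 2 * (- (1 / r\<^sup>2)))" for q s
  define Z2 where "Z2 q s = exp (\<kappa> * s) * (3 * (2 * M q * (- (1 / r\<^sup>2))) * (- (1 / r\<^sup>2)))" for q s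
  define Zs where "Zs q s = exp (\<kappa> * s) * \<kappa> * M q ^ 3" for q s
  have line: "((\<lambda>q. 1 - q / r\<^sup>2) has_real_derivative - (1 / r\<^sup>2)) (at q)" for q
    by (rule DERIV_cong[OF DERIV_diff[OF DERIV_const DERIV_cdivide[OF DERIV_ident]]]) simp
  have M3: "((\<lambda>q. M q ^ 3) has_real_derivative 3 * M q ^ 2 * (- (1 / r\<^sup>2))) (at q)" for q
    using DERIV_chain2[OF has_real_derivative_max_0_power[of 2] line[of q]]
    by (simp add: M_def eval_nat_numeral)
  have M2: "((\<lambda>q. M q ^ 2) has_real_derivative 2 * M q * (- (1 / r\<^sup>2))) (at q)" for q
    using DERIV_chain2[OF has_real_derivative_max_0_power[of 1] line[of q]]
    by (simp add: M_def eval_nat_numeral)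
  have d1: "((\<lambda>q. Z q s) has_real_derivative Z1 q s) (at q)" for q s
    unfolding Z_def Z1_def by (intro DERIV_cmult M3)
  have d2: "((\<lambda>q. Z1 q s) has_real_derivative Z2 q s) (at q)" for q s
    unfolding Z1_def Z2_def by (intro DERIV_cmult DERIV_cmult_right M2)
  have ds: "((\<lambda>s. Z q s) has_real_derivative Zs q s) (at s)" for q s
    unfolding Z_def Zs_def by (auto intro!: derivative_eq_intros)
  have cM: "continuous_on A (\<lambda>z. M (fst z))" for A :: "(real \<times> real) set"
    unfolding M_def using r by (intro continuous_intros) auto
  have cZ: "continuous_on (UNIV \<times> {0<..<T}) (\<lambda>z. Z (fst z) (snd z))"
    "continuous_on (UNIV \<times> {0<..<T}) (\<lambda>z. Zs (fst z) (snd z))"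
    "continuous_on (UNIV \<times> {0<..<T}) (\<lambda>z. Z1 (fst z) (snd z))"
    "continuous_on (UNIV \<times> {0<..<T}) (\<lambda>z. Z2 (fst z) (snd z))"
    unfolding Z_def Z1_def Z2_def Zs_def
    by (intro continuous_intros cM)+
  have M0: "0 \<le> M q" for q by (simp add: M_def)
  have Z0: "0 \<le> Z q s" for q s by (simp add: Z_def M0)
  have supp: "Z q s = 0 \<and> Z1 q s = 0" if "r\<^sup>2 \<le> q" for q s
  proof -
    have "M q = 0" using that r by (simp add: M_def)
    then show ?thesis by (simp add: Z_def Z1_def)
  qed
  \<comment> \<open>The choice of \<open>\<kappa>\<close> makes the bracket a perfect square.\<close>
  have pos: "0 \<le> Zs q s + (2 * N * Z1 q s + 4 * q * Z2 q s)" for q s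
  proof (cases "M q = 0")
    case True then show ?thesis by (simp add: Zs_def Z1_def Z2_def)
  next
    case False
    define m where "m = M q"
    have q: "q = r\<^sup>2 * (1 - m)" using False r by (auto simp: m_def M_def max_def field_simps split: if_splits)
    have "Zs q s + (2 * N * Z1 q s + 4 * q * Z2 q s) =
        exp (\<kappa> * s) * (\<kappa> * m ^ 3 + 2 * N * (3 * m ^ 2 * (- (1 / r\<^sup>2))) + 4 * q * (3 * (2 * m * (- (1 / r\<^sup>2))) * (- (1 / r\<^sup>2))))"
      by (simp add: Zs_def Z1_def Z2_def m_def algebra_simps)
    also have "\<dots> = exp (\<kappa> * s) * (m / r\<^sup>2 * (((6 * N + 24) * m - 48)\<^sup>2 / 96))"
    proof -
      have "(6 * N + 24)\<^sup>2 / (96 * p) * m ^ 3 + 2 * N * (3 * m ^ 2 * (- (1 / p))) + 4 * (p * (1 - m)) * (3 * (2 * m * (- (1 / p))) * (- (1 / p)))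
        = m / p * (((6 * N + 24) * m - 48)\<^sup>2 / 96)" if "p \<noteq> 0" for p
        using that by (simp add: field_simps power2_eq_square power3_eq_cube)
      from this[of "r\<^sup>2"] show ?thesis using r unfolding \<kappa>_def q by simp
    qed
    also have "0 \<le> \<dots>" using M0[of q] by (auto simp: m_def intro!: mult_nonneg_nonneg)
    finally show ?thesis .
  qed
  define K2 where "K2 = {x + y |x y. x \<in> K1 \<and> y \<in> cball 0 r}"
  \<comment> \<open>\<open>K2\<close> is the union of the balls of radius r centred in
    \<open>K1\<close>; its compactness gives one bound for u(., T') that serves all centres.\<close>
  have K2: "compact K2" unfolding K2_def by (intro compact_sums K1 compact_cball)
  have T'T: "T' \<in> {0<..<T}" using T' by auto
  have "bounded ((\<lambda>y. u y T') ` K2)"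
    by (intro compact_imp_bounded compact_continuous_image cont_slice[OF cont_u T'T] K2)
  then obtain B where B: "0 < B" "\<And>y. y \<in> K2 \<Longrightarrow> u y T' \<le> B"
    unfolding bounded_pos by (metis abs_le_D1 imageI real_norm_def)
  define V where "V = unit_ball_vol N * r ^ DIM('a)"
  have V: "0 < V" using r by (simp add: V_def N_def)
  \<comment> \<open>On the ball of radius R = r/2 the weight is at least (3/4)^3 = 27/64, which is
    divided out here; the bracket bounds \<open>H\<close> at time \<open>T'\<close>.\<close>
  define m where "m = 64 / 27 * (exp (\<kappa> * T') * B * V)"
  have m: "0 < m" using B V by (simp add: m_def)
  have main: "(\<integral>\<^sup>+y\<in>ball x R. ennreal (uT y s) \<partial>lborel) \<le> ennreal m
      \<and> cyl_integral {s<..<T'} (ball x R) (\<lambda>y v. sourceT y v) \<le> ennreal m"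
    if x: "x \<in> K1" and s: "0 < s" "s < T'" for x s
  proof -
    obtain a b where box: "cball x (r + 1) \<subseteq> cbox a b"
      using bounded_cball bounded_subset_cbox_symmetric by metis
    define Q where "Q y = (norm (y - x))\<^sup>2" for y
    define I where "I y s = Z (Q y) s * source y s +
      (Zs (Q y) s + (2 * N * Z1 (Q y) s + 4 * Q y * Z2 (Q y) s)) * u y s" for y s
    define H where "H s = integral (cbox a b) (\<lambda>y. Z (Q y) s * u y s)" for s
    note weak = weak_identity_radial[of T Z Zs Z1 Z2 r x a b, OF _ ds d1 d2 cZ supp _ box,
        folded Q_def N_def, folded I_def H_def]
    have H': "(H has_real_derivative integral (cbox a b) (\<lambda>y. I y s)) (at s)" if "s \<in> {0<..<T}" for s
      using weak(1)[of s] that r by simp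
    have cI: "continuous_on (UNIV \<times> {0<..<T}) (\<lambda>z. I (fst z) (snd z))"
      using weak(2) r by simp
    have cH': "continuous_on {0<..<T} (\<lambda>s. integral (cbox a b) (\<lambda>y. I y s))"
      using weak(3) r by simp
    have Z_out: "Z (Q y) s = 0" if "y \<notin> ball x r" for y s
    proof -
      have "r \<le> norm (y - x)" using that by (simp add: dist_norm norm_minus_commute)
      then have q: "r\<^sup>2 \<le> Q y" unfolding Q_def using r by (intro power_mono) auto
      then show "Z (Q y) s = 0" using supp by simp
    qed
    have Zf: "0 \<le> Z (Q y) s * source y s" if "s \<in> {0<..<T}" for y s
    proof (cases "y \<in> ball x r")
      case True
      then have "0 \<le> source y s" using sub[OF x] by (intro source_nonneg[OF _ that] subsetD[OF sub[OF x]]) (auto simp: r_def)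
      then show ?thesis using Z0 by simp
    qed (simp add: Z_out)
    have I_ge: "Z (Q y) s * source y s \<le> I y s" if "s \<in> {0<..<T}" for y s
      unfolding I_def using pos u_nonneg[OF that] by simp
    have I0: "0 \<le> I y s" if "s \<in> {0<..<T}" for y s
      using I_ge[OF that] Zf[OF that] order_trans by blast
    have cIs: "continuous_on (cbox a b) (\<lambda>y. I y s)" if "s \<in> {0<..<T}" for s
      using that by (intro continuous_on_compose_pair[OF cI] continuous_intros)
    have H'0: "0 \<le> integral (cbox a b) (\<lambda>y. I y s)" if "s \<in> {0<..<T}" for s
      using I0[OF that] cIs[OF that] by (intro integral_nonneg integrable_continuous) auto
    have Hnn: "(\<integral>\<^sup>+y\<in>cbox a b. ennreal (Z (Q y) s * u y s) \<partial>lborel) = ennreal (H s)" if "s \<in> {0<..<T}" for s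
      unfolding H_def Q_def using that Z0 u_nonneg[OF that]
      by (intro set_nn_integral_cbox_continuous continuous_on_mult continuous_on_compose_pair[OF cZ(1)]
          cont_slice[OF cont_u] continuous_intros) auto
    have H0: "0 \<le> H s" if "s \<in> {0<..<T}" for s
      unfolding H_def Q_def using that Z0 u_nonneg[OF that]
      by (intro integral_nonneg integrable_continuous continuous_on_mult continuous_on_compose_pair[OF cZ(1)]
          cont_slice[OF cont_u] continuous_intros) auto
    have Zlow: "27 / 64 \<le> Z (Q y) s" if "y \<in> ball x R" "0 \<le> s" for y s
    proof -
      have "norm (y - x) \<le> r / 2" using that by (simp add: dist_norm norm_minus_commute r_def)
      then have "Q y \<le> (r / 2)\<^sup>2" unfolding Q_def by (intro power_mono) auto
      then have "Q y / r\<^sup>2 \<le> 1/4" using r by (simp add: field_simps power2_eq_square)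
      then have "3 / 4 \<le> M (Q y)" unfolding M_def by linarith
      then have "(3 / 4) ^ 3 \<le> M (Q y) ^ 3" by (intro power_mono) auto
      also have "\<dots> \<le> exp (\<kappa> * s) * M (Q y) ^ 3" 
        using mult_right_mono[of 1 "exp (\<kappa> * s)" "M (Q y) ^ 3"] that \<kappa> M0[of "Q y"] by simp
      finally show ?thesis by (simp add: Z_def eval_nat_numeral)
    qed
    have ball_box: "ball x R \<subseteq> cbox a b"
    proof -
      have "ball x R \<subseteq> cball x (r + 1)" using R by (auto simp: r_def)
      then show ?thesis using box by blast
    qed
    have HT': "ennreal (H T') \<le> ennreal (exp (\<kappa> * T') * B * V)"
    proof -
      have "ennreal (H T') \<le> (\<integral>\<^sup>+y. ennreal (exp (\<kappa> * T') * B) * indicator (ball x r) y \<partial>lborel)"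
        unfolding Hnn[OF T'T, symmetric]
      proof (intro nn_integral_mono)
        fix y
        show "ennreal (Z (Q y) T' * u y T') * indicator (cbox a b) y \<le> ennreal (exp (\<kappa> * T') * B) * indicator (ball x r) y"
        proof (cases "y \<in> ball x r")
          case True
          have "M (Q y) \<le> 1" by (simp add: M_def Q_def)
          then have "Z (Q y) T' \<le> exp (\<kappa> * T')" using M0 by (simp add: Z_def power_le_one mult_left_le)
          moreover have "u y T' \<le> B"
          proof (rule B(2))
            have "y = x + (y - x)" "y - x \<in> cball 0 r" using True by (auto simp: dist_norm norm_minus_commute)
            then show "y \<in> K2" unfolding K2_def using x by blast
          qed
          ultimately have "Z (Q y) T' * u y T' \<le> exp (\<kappa> * T') * B"
            using u_nonneg[OF T'T] by (intro mult_mono) auto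
          then show ?thesis using True by (auto simp: indicator_def intro!: ennreal_leI)
        next
          case False then show ?thesis by (simp add: Z_out)
        qed
      qed
      also have "\<dots> = ennreal (exp (\<kappa> * T') * B) * ennreal V"
        using r by (subst nn_integral_cmult_indicator) (auto simp: emeasure_ball V_def N_def)
      finally show ?thesis using B V by (simp add: ennreal_mult)
    qed
    have c64: "X \<le> ennreal m" if "ennreal (27 / 64) * X \<le> ennreal (H T')" for X
    proof -
      have "X = ennreal (64 / 27) * (ennreal (27 / 64) * X)"
        by (simp add: mult.assoc[symmetric] ennreal_mult[symmetric])
      also have "\<dots> \<le> ennreal (64 / 27) * ennreal (exp (\<kappa> * T') * B * V)"
        using that HT' by (intro mult_left_mono) auto
      also have "\<dots> = ennreal m" unfolding m_def using B V by (intro ennreal_mult[symmetric]) auto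
      finally show ?thesis .
    qed
    have sT: "s \<in> {0<..<T}" using s T' by auto
    have Hs: "H s \<le> H T'"
    proof (rule DERIV_nonneg_imp_nondecreasing[where f = H])
      show "s \<le> T'" using s by simp
      fix v assume "s \<le> v" "v \<le> T'"
      then have "v \<in> {0<..<T}" using s T' by auto
      then show "\<exists>y. (H has_real_derivative y) (at v) \<and> 0 \<le> y" using H' H'0 by blast
    qed
    have p1: "(\<integral>\<^sup>+y\<in>ball x R. ennreal (uT y s) \<partial>lborel) \<le> ennreal m"
    proof (rule c64)
      have "ennreal (27 / 64) * (\<integral>\<^sup>+y\<in>ball x R. ennreal (uT y s) \<partial>lborel)
          = (\<integral>\<^sup>+y. ennreal (27 / 64) * (ennreal (uT y s) * indicator (ball x R) y) \<partial>lborel)"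
        by (rule nn_integral_cmult[symmetric]) measurable
      also have "\<dots> \<le> (\<integral>\<^sup>+y\<in>cbox a b. ennreal (Z (Q y) s * u y s) \<partial>lborel)"
      proof (intro nn_integral_mono)
        fix y
        show "ennreal (27 / 64) * (ennreal (uT y s) * indicator (ball x R) y) \<le> ennreal (Z (Q y) s * u y s) * indicator (cbox a b) y"
        proof (cases "y \<in> ball x R")
          case True
          have "27 / 64 * u y s \<le> Z (Q y) s * u y s"
            using u_nonneg[OF sT] Zlow[OF True, of s] s by (intro mult_right_mono) auto
          then have "ennreal (27 / 64) * ennreal (uT y s) \<le> ennreal (Z (Q y) s * u y s)"
            using u_nonneg[OF sT] sT by (simp add: uT_def ennreal_leI flip: ennreal_mult)
          then show ?thesis using True ball_box by (auto simp: indicator_def)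
        qed simp
      qed
      also have "\<dots> \<le> ennreal (H T')" using Hs by (simp add: Hnn[OF sT] ennreal_leI)
      finally show "ennreal (27 / 64) * (\<integral>\<^sup>+y\<in>ball x R. ennreal (uT y s) \<partial>lborel) \<le> ennreal (H T')" .
    qed
    have p2: "cyl_integral {s<..<T'} (ball x R) (\<lambda>y v. sourceT y v) \<le> ennreal m"
    proof (rule c64)
      define g where "g v = integral (cbox a b) (\<lambda>y. I y v)" for v
      have "(g has_integral H T' - H s) {s..T'}"
      proof (rule fundamental_theorem_of_calculus)
        show "s \<le> T'" using s by simp
        fix v assume "v \<in> {s..T'}"
        then have "v \<in> {0<..<T}" using s T' by auto
        from H'[OF this] show "(H has_vector_derivative g v) (at v within {s..T'})"
          unfolding g_def
          using has_field_derivative_at_within has_real_derivative_iff_has_vector_derivative by blast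
      qed
      then have gi: "integral {s..T'} g = H T' - H s" by (rule integral_unique)
      have cg: "continuous_on {s..T'} g"
        unfolding g_def using s T' by (intro continuous_on_subset[OF cH']) auto
      have g_nn: "ennreal (g v) = (\<integral>\<^sup>+y\<in>cbox a b. ennreal (I y v) \<partial>lborel)" if "v \<in> {0<..<T}" for v
        unfolding g_def using I0[OF that] cIs[OF that] by (intro set_nn_integral_cbox_continuous[symmetric]) auto
      have fl: "ennreal (27 / 64) * (\<integral>\<^sup>+y\<in>ball x R. ennreal (sourceT y v) \<partial>lborel) \<le> ennreal (g v)" if v: "v \<in> {0<..<T}" for v
      proof -
        have "ennreal (27 / 64) * (\<integral>\<^sup>+y\<in>ball x R. ennreal (sourceT y v) \<partial>lborel)
          = (\<integral>\<^sup>+y. ennreal (27 / 64) * (ennreal (sourceT y v) * indicator (ball x R) y) \<partial>lborel)"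
          by (rule nn_integral_cmult[symmetric]) measurable
        also have "\<dots> \<le> (\<integral>\<^sup>+y\<in>cbox a b. ennreal (I y v) \<partial>lborel)"
        proof (intro nn_integral_mono)
          fix y
          show "ennreal (27 / 64) * (ennreal (sourceT y v) * indicator (ball x R) y) \<le> ennreal (I y v) * indicator (cbox a b) y"
          proof (cases "y \<in> ball x R")
            case True
            have f0: "0 \<le> source y v" using True R by (intro source_nonneg[OF _ v] subsetD[OF sub[OF x]]) auto
            have "27 / 64 * source y v \<le> Z (Q y) v * source y v" using f0 Zlow[OF True, of v] v by (intro mult_right_mono) auto
            also have "\<dots> \<le> I y v" by (rule I_ge[OF v])
            finally have "ennreal (27 / 64) * ennreal (sourceT y v) \<le> ennreal (I y v)"
              using f0 v by (simp add: sourceT_def ennreal_leI flip: ennreal_mult)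
            then show ?thesis using True ball_box by (auto simp: indicator_def)
          qed simp
        qed
        finally show ?thesis using g_nn[OF v] by simp
      qed
      have "ennreal (27 / 64) * cyl_integral {s<..<T'} (ball x R) (\<lambda>y v. sourceT y v)
        = (\<integral>\<^sup>+v. ennreal (27 / 64) * ((\<integral>\<^sup>+y\<in>ball x R. ennreal (sourceT y v) \<partial>lborel) * indicator {s<..<T'} v) \<partial>lborel)"
        by (rule nn_integral_cmult[symmetric]) measurable
      also have "\<dots> \<le> (\<integral>\<^sup>+v\<in>cbox s T'. ennreal (g v) \<partial>lborel)"
        using fl s T' by (intro nn_integral_mono) (auto simp: indicator_def)
      also have "\<dots> = ennreal (integral (cbox s T') g)"
        using cg s T' H'0 by (intro set_nn_integral_cbox_continuous) (auto simp: g_def)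
      also have "\<dots> \<le> ennreal (H T')" using H0[OF sT] gi by (intro ennreal_leI) simp
      finally show "ennreal (27 / 64) * cyl_integral {s<..<T'} (ball x R) (\<lambda>y v. sourceT y v) \<le> ennreal (H T')" .
    qed
    show ?thesis using p1 p2 ..
  qed
  show ?thesis
  proof (rule that[OF m])
    show "(\<integral>\<^sup>+y\<in>ball x R. ennreal (uT y s) \<partial>lborel) \<le> ennreal m" if "x \<in> K1" "0 < s" "s < T'" for x s
      using main[OF that] ..
    show "cyl_integral {0<..<T'} (ball x R) (\<lambda>y s. sourceT y s) \<le> ennreal m" if "x \<in> K1" for x
      using main[OF that] by (intro set_nn_integral_Ioo_limit) auto
  qed
qed

end

section \<open>Potentials of powers of the solution\<close>

text \<open>If k > theta, then (k/theta)^(q-1) >= 1. It is applied with k a value of the heat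
  kernel, and with k a value of u in order to pass from an L^1 mean to an L^q mean.\<close>

lemma le_threshold_powr:
  fixes k \<theta> q :: real
  assumes "0 \<le> k" "0 < \<theta>" "1 \<le> q"
  shows "k \<le> \<theta> + \<theta> powr (1 - q) * k powr q"
proof (cases "k \<le> \<theta>")
  case False
  then have k: "\<theta> \<le> k" "0 < k" using assms by auto
  have "k = k powr (1 - q) * k powr q" using k by (simp add: powr_add[symmetric])
  also have "\<dots> \<le> \<theta> powr (1 - q) * k powr q"
    using k assms by (intro mult_right_mono powr_mono2') auto
  finally show ?thesis using assms by linarith
qed (use assms in \<open>simp add: add_increasing2\<close>)

text \<open>Optimising the threshold \<open>\<theta>\<close> replaces Jensen's inequality for the power \<open>q\<close> of a potential.\<close>

lemma powr_le_of_threshold: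
  fixes v C m c q :: real and Y :: ennreal
  assumes v: "0 \<le> v" and pos: "0 < C" "0 < m" "0 < c" and q: "1 \<le> q"
    and le: "\<And>\<theta>. 0 < \<theta> \<Longrightarrow> ennreal v \<le> ennreal C * (ennreal (2 * \<theta> * m) + ennreal (\<theta> powr (1 - q)) * Y + ennreal c)"
  shows "ennreal (v powr q) \<le> ennreal ((4 * C * c) powr q + 2 * C * (8 * C * m) powr (q - 1)) * (Y + 1)"
proof (cases Y)
  case top
  have "0 < (4 * C * c) powr q" using pos by simp
  then have "0 < (4 * C * c) powr q + 2 * C * (8 * C * m) powr (q - 1)" using pos by (intro add_pos_nonneg) auto
  then have "ennreal ((4 * C * c) powr q + 2 * C * (8 * C * m) powr (q - 1)) * (Y + 1) = top"
    using top by (simp add: ennreal_mult_top)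
  then show ?thesis by simp
next
  case (real y)
  have "v powr q \<le> ((4 * C * c) powr q + 2 * C * (8 * C * m) powr (q - 1)) * (y + 1)"
  \<comment> \<open>If the constant dominates there is nothing to optimise. Otherwise C c < v/4, and
    \<open>\<theta>\<close> is taken so that C (2 theta m) = v/4 as well; the term with
    \<open>Y\<close> must then carry v/2.\<close>
  proof (cases "v \<le> 4 * C * c")
    case True
    then have "v powr q \<le> (4 * C * c) powr q" using v q by (intro powr_mono2) auto
    also have "\<dots> \<le> (4 * C * c) powr q * (y + 1)" using real by (simp add: mult_le_cancel_left1)
    also have "\<dots> \<le> ((4 * C * c) powr q + 2 * C * (8 * C * m) powr (q - 1)) * (y + 1)"
      using real pos by (intro mult_right_mono) auto
    finally show ?thesis .
  next
    case False
    then have v0: "0 < v" using pos by (smt (verit) mult_pos_pos)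
    define \<theta> where "\<theta> = v / (8 * C * m)"
    have \<theta>: "0 < \<theta>" using v0 pos by (simp add: \<theta>_def)
    have "ennreal v \<le> ennreal (C * (2 * \<theta> * m + \<theta> powr (1 - q) * y + c))"
      using le[OF \<theta>] pos real \<theta> by (simp add: ennreal_mult ennreal_plus)
    then have "v \<le> C * (2 * \<theta> * m + \<theta> powr (1 - q) * y + c)"
      using real pos \<theta> by (subst (asm) ennreal_le_iff) (auto intro!: mult_nonneg_nonneg add_nonneg_nonneg)
    moreover have "C * (2 * \<theta> * m) = v / 4" using pos by (simp add: \<theta>_def field_simps)
    ultimately have "v \<le> v / 4 + C * \<theta> powr (1 - q) * y + C * c"
      by (simp add: algebra_simps)
    with False have "v / 2 \<le> C * \<theta> powr (1 - q) * y" by simp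
    moreover have "\<theta> powr (1 - q) = v powr (1 - q) * (8 * C * m) powr (q - 1)"
    proof -
      have "(8 * C * m) powr (1 - q) = 1 / (8 * C * m) powr (q - 1)"
        using powr_minus_divide[of "8 * C * m" "q - 1"] by simp
      then show ?thesis unfolding \<theta>_def using v0 pos by (simp add: powr_divide)
    qed
    ultimately have "v / 2 \<le> C * (8 * C * m) powr (q - 1) * y * v powr (1 - q)" by (simp add: mult_ac)
    then have "v \<le> 2 * C * (8 * C * m) powr (q - 1) * y * v powr (1 - q)" by simp
    then have "v * v powr (q - 1) \<le> 2 * C * (8 * C * m) powr (q - 1) * y * v powr (1 - q) * v powr (q - 1)"
      by (intro mult_right_mono) auto
    moreover have "v * v powr (q - 1) = v powr q" using v0 by (simp add: powr_mult_base)
    moreover have "v powr (1 - q) * v powr (q - 1) = 1" using v0 by (simp add: powr_add[symmetric])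
    ultimately have "v powr q \<le> 2 * C * (8 * C * m) powr (q - 1) * y" by (simp add: mult.assoc)
    also have "\<dots> \<le> ((4 * C * c) powr q + 2 * C * (8 * C * m) powr (q - 1)) * (y + 1)"
      using pos real by (intro mult_mono) auto
    finally show ?thesis .
  qed
  then have "ennreal (v powr q) \<le> ennreal (((4 * C * c) powr q + 2 * C * (8 * C * m) powr (q - 1)) * (y + 1))"
    by (rule ennreal_leI)
  also have "\<dots> = ennreal ((4 * C * c) powr q + 2 * C * (8 * C * m) powr (q - 1)) * ennreal (y + 1)"
    using pos real by (intro ennreal_mult) auto
  also have "ennreal (y + 1) = Y + 1" using real by (simp add: ennreal_plus)
  finally show ?thesis .
qed

lemma heat_kernel_powr_le:
  fixes x :: "'a::euclidean_space"
  assumes "0 < t" "0 \<le> \<gamma>"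
  shows "heat_kernel x t powr (\<gamma> / real DIM('a)) \<le> t powr (- (\<gamma> / 2))"
proof -
  have "heat_kernel x t powr (\<gamma> / real DIM('a)) \<le> (t powr (- real DIM('a) / 2)) powr (\<gamma> / real DIM('a))"
    using assms by (intro powr_mono2 heat_kernel_le_powr) auto
  then show ?thesis by (simp add: powr_powr)
qed

lemma nn_integral_threshold:
  fixes k w :: "'b \<Rightarrow> real"
  assumes [measurable]: "k \<in> borel_measurable M" "w \<in> borel_measurable M" "B \<in> sets M"
    and k: "\<And>x. 0 \<le> k x" and \<theta>: "0 < \<theta>" and q: "1 \<le> q"
  shows "(\<integral>\<^sup>+x\<in>B. ennreal (k x * w x) \<partial>M) \<le>
    ennreal \<theta> * (\<integral>\<^sup>+x\<in>B. ennreal (w x) \<partial>M) + ennreal (\<theta> powr (1 - q)) * (\<integral>\<^sup>+x\<in>B. ennreal (k x powr q) * ennreal (w x) \<partial>M)"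
proof -
  have "(\<integral>\<^sup>+x\<in>B. ennreal (k x * w x) \<partial>M) \<le>
    (\<integral>\<^sup>+x. ennreal \<theta> * (ennreal (w x) * indicator B x) + ennreal (\<theta> powr (1 - q)) * (ennreal (k x powr q) * ennreal (w x) * indicator B x) \<partial>M)"
  proof (intro nn_integral_mono)
    fix x
    have "ennreal (k x * w x) = ennreal (k x) * ennreal (w x)" using k by (rule ennreal_mult')
    also have "\<dots> \<le> ennreal (\<theta> + \<theta> powr (1 - q) * k x powr q) * ennreal (w x)"
      using k \<theta> q by (intro mult_right_mono ennreal_leI le_threshold_powr) auto
    also have "\<dots> = ennreal \<theta> * ennreal (w x) + ennreal (\<theta> powr (1 - q)) * (ennreal (k x powr q) * ennreal (w x))"
      using \<theta> by (simp add: ennreal_plus ennreal_mult distrib_right mult.assoc)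
    finally show "ennreal (k x * w x) * indicator B x \<le> ennreal \<theta> * (ennreal (w x) * indicator B x) +
        ennreal (\<theta> powr (1 - q)) * (ennreal (k x powr q) * ennreal (w x) * indicator B x)"
      by (auto simp: indicator_def)
  qed
  also have "\<dots> = ennreal \<theta> * (\<integral>\<^sup>+x\<in>B. ennreal (w x) \<partial>M) + ennreal (\<theta> powr (1 - q)) * (\<integral>\<^sup>+x\<in>B. ennreal (k x powr q) * ennreal (w x) \<partial>M)"
    by (simp add: nn_integral_add nn_integral_cmult)
  finally show ?thesis .
qed

context supersolution
begin

text \<open>For lam <= 1 the local mass of u already controls u^lam, without representing u by
  potentials. The condition on gamma amounts to theta < 1 for the interpolation parameter, which
  makes both endpoint integrals converge.\<close>

lemma potential_bound_sublinear:
  assumes K1: "compact K1" and R: "0 < R" and sub: "\<And>x. x \<in> K1 \<Longrightarrow> cball x (2 * R) \<subseteq> \<Omega>"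
    and T': "0 < T'" "T' < T" and lam: "0 < lam" "lam \<le> 1"
    and \<gamma>: "0 < \<gamma>" "\<gamma> + real DIM('a) * lam < real DIM('a) + 2"
  obtains C :: real where "0 < C"
    "\<And>x t. x \<in> K1 \<Longrightarrow> 0 < t \<Longrightarrow> t < T' \<Longrightarrow>
      cyl_integral {0<..<t} (ball x R) (\<lambda>y s. heat_kernel (x - y) (t - s) powr (\<gamma> / real DIM('a)) * uT y s powr lam)
        \<le> ennreal C"
proof -
  define N where "N = real DIM('a)"
  have N: "0 < N" by (simp add: N_def)
  \<comment> \<open>\<open>\<Phi>\<^bsup>\<gamma>/n\<^esup> u\<^bsup>lam\<^esup>\<close> is interpolated between \<open>\<Phi>\<^bsup>2\<theta>/n\<^esup> u\<close> and \<open>\<Phi>\<^bsup>(n+2)\<theta>/n\<^esup>\<close>, both integrable.\<close>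
  define \<theta> where "\<theta> = \<gamma> / (N + 2 - N * lam)"
  have den: "0 < N + 2 - N * lam" using \<gamma> by (simp add: N_def)
  have \<theta>: "0 < \<theta>" "\<theta> < 1" using den \<gamma> by (auto simp: \<theta>_def N_def field_simps)
  define q where "q = (N + 2) * \<theta>"
  have "q < (N + 2) * 1" unfolding q_def using \<theta> N by (intro mult_strict_left_mono) auto
  moreover have "N * (q / N - 1) = q - N" using N by (simp add: right_diff_distrib)
  moreover have "0 < q" using \<theta> N by (simp add: q_def)
  ultimately have q: "0 < q" "N * (q / N - 1) < 2" "0 < q / N"
    using N by auto
  have split\<gamma>: "\<gamma> = (2 * \<theta>) * lam + q * (1 - lam)"
  proof -
    have "\<gamma> = \<theta> * (N + 2 - N * lam)" using den by (simp add: \<theta>_def)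
    also have "\<dots> = (2 * \<theta>) * lam + q * (1 - lam)" by (simp add: q_def algebra_simps)
    finally show ?thesis .
  qed
  obtain m where m: "0 < m"
    "\<And>x s. x \<in> K1 \<Longrightarrow> 0 < s \<Longrightarrow> s < T' \<Longrightarrow> (\<integral>\<^sup>+y\<in>ball x R. ennreal (uT y s) \<partial>lborel) \<le> ennreal m"
    by (rule mass_bound[OF K1 R sub T']) (assumption, rule that)
  obtain Cq where Cq: "0 < Cq" "\<And>(x::'a) t h. 0 \<le> h \<Longrightarrow>
       (\<integral>\<^sup>+s\<in>{t - h<..<t}. (\<integral>\<^sup>+y. ennreal (heat_kernel (x - y) (t - s) powr (q / N)) \<partial>lborel) \<partial>lborel)
         \<le> ennreal (Cq * h powr (1 - N * (q / N - 1) / 2))"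
    by (rule nn_integral_heat_kernel_cylinder[where ?'a = 'a, folded N_def, OF q(3,2)]) (rule that)
  define C1 where "C1 = m * (T' powr (1 - \<theta>) / (1 - \<theta>))"
  define C2 where "C2 = Cq * T' powr (1 - N * (q / N - 1) / 2)"
  have C12: "0 < C1" "0 < C2" using m Cq T' \<theta> by (auto simp: C1_def C2_def)
  show ?thesis
  proof (rule that[of "C1 + C2"])
    show "0 < C1 + C2" using C12 by simp
    fix x t assume x: "x \<in> K1" and t: "0 < t" "t < T'"
    have "cyl_integral {0<..<t} (ball x R) (\<lambda>y s. heat_kernel (x - y) (t - s) powr (\<gamma> / N) * uT y s powr lam)
      \<le> (\<integral>\<^sup>+s. ennreal ((t - s) powr (- \<theta>)) * indicator {t - t<..<t} s * ennreal m
            + (\<integral>\<^sup>+y. ennreal (heat_kernel (x - y) (t - s) powr (q / N)) \<partial>lborel) * indicator {t - t<..<t} s \<partial>lborel)"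
    proof (intro nn_integral_mono)
      fix s
      show "(\<integral>\<^sup>+y\<in>ball x R. ennreal (heat_kernel (x - y) (t - s) powr (\<gamma> / N) * uT y s powr lam) \<partial>lborel) * indicator {0<..<t} s
        \<le> ennreal ((t - s) powr (- \<theta>)) * indicator {t - t<..<t} s * ennreal m
            + (\<integral>\<^sup>+y. ennreal (heat_kernel (x - y) (t - s) powr (q / N)) \<partial>lborel) * indicator {t - t<..<t} s"
      proof (cases "s \<in> {0<..<t}")
        case s: True
        have "(\<integral>\<^sup>+y\<in>ball x R. ennreal (heat_kernel (x - y) (t - s) powr (\<gamma> / N) * uT y s powr lam) \<partial>lborel)
          \<le> (\<integral>\<^sup>+y. ennreal ((t - s) powr (- \<theta>)) * (ennreal (uT y s) * indicator (ball x R) y)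
              + ennreal (heat_kernel (x - y) (t - s) powr (q / N)) \<partial>lborel)"
        proof (intro nn_integral_mono)
          fix y
          define k where "k = heat_kernel (x - y) (t - s)"
          have k: "0 < k" using s by (simp add: k_def heat_kernel_def)
          define a where "a = k powr (2 * \<theta> / N) * uT y s"
          define b where "b = k powr (q / N)"
          have ab: "0 \<le> a" "0 < b" using k by (auto simp: a_def b_def)
          have "k powr (\<gamma> / N) * uT y s powr lam = a powr lam * b powr (1 - lam)"
            using k unfolding split\<gamma> a_def b_def
            by (simp add: powr_mult powr_powr powr_add add_divide_distrib)
          \<comment> \<open>a + b dominates both bases, and the exponents add up to 1.\<close>
          also have "\<dots> \<le> (a + b) powr lam * (a + b) powr (1 - lam)"
            using ab lam by (intro mult_mono powr_mono2) auto
          also have "\<dots> = a + b" using ab by (simp add: powr_add[symmetric])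
          finally have "k powr (\<gamma> / N) * uT y s powr lam \<le> a + b" .
          moreover have "a \<le> (t - s) powr (- \<theta>) * uT y s"
            unfolding a_def k_def N_def using s \<theta> heat_kernel_powr_le[of "t - s" "2 * \<theta>" "x - y"]
            by (intro mult_right_mono) auto
          ultimately have "ennreal (k powr (\<gamma> / N) * uT y s powr lam) \<le> ennreal ((t - s) powr (- \<theta>) * uT y s + b)"
            by (intro ennreal_leI) simp
          also have "\<dots> = ennreal ((t - s) powr (- \<theta>)) * ennreal (uT y s) + ennreal b"
            using ab by (simp add: ennreal_mult)
          finally show "ennreal (heat_kernel (x - y) (t - s) powr (\<gamma> / N) * uT y s powr lam) * indicator (ball x R) y
            \<le> ennreal ((t - s) powr (- \<theta>)) * (ennreal (uT y s) * indicator (ball x R) y)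
              + ennreal (heat_kernel (x - y) (t - s) powr (q / N))"
            by (auto simp: indicator_def k_def b_def)
        qed
        also have "\<dots> = ennreal ((t - s) powr (- \<theta>)) * (\<integral>\<^sup>+y\<in>ball x R. ennreal (uT y s) \<partial>lborel)
            + (\<integral>\<^sup>+y. ennreal (heat_kernel (x - y) (t - s) powr (q / N)) \<partial>lborel)"
          by (simp add: nn_integral_add nn_integral_cmult)
        also have "\<dots> \<le> ennreal ((t - s) powr (- \<theta>)) * ennreal m
            + (\<integral>\<^sup>+y. ennreal (heat_kernel (x - y) (t - s) powr (q / N)) \<partial>lborel)"
          using x s t by (intro add_mono mult_left_mono m) auto
        finally show ?thesis using s by simp
      qed simp
    qed
    also have "\<dots> = (\<integral>\<^sup>+s\<in>{t - t<..<t}. ennreal ((t - s) powr (- \<theta>)) \<partial>lborel) * ennreal m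
        + (\<integral>\<^sup>+s\<in>{t - t<..<t}. (\<integral>\<^sup>+y. ennreal (heat_kernel (x - y) (t - s) powr (q / N)) \<partial>lborel) \<partial>lborel)"
      by (simp add: nn_integral_add nn_integral_multc)
    also have "\<dots> \<le> ennreal (t powr (1 - \<theta>) / (1 - \<theta>)) * ennreal m + ennreal (Cq * t powr (1 - N * (q / N - 1) / 2))"
      using \<theta> t by (intro add_mono mult_right_mono nn_integral_powr_right Cq) auto
    also have "\<dots> = ennreal (t powr (1 - \<theta>) / (1 - \<theta>) * m + Cq * t powr (1 - N * (q / N - 1) / 2))"
      using \<theta> m(1) Cq(1) by (simp flip: ennreal_mult ennreal_plus)
    also have "\<dots> \<le> ennreal (C1 + C2)"
    proof (intro ennreal_leI add_mono)
      show "t powr (1 - \<theta>) / (1 - \<theta>) * m \<le> C1"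
        unfolding C1_def mult.commute[of m] using t \<theta> m
        by (intro mult_right_mono divide_right_mono powr_mono2) auto
      show "Cq * t powr (1 - N * (q / N - 1) / 2) \<le> C2"
        unfolding C2_def using t Cq q by (intro mult_left_mono powr_mono2) auto
    qed
    finally show "cyl_integral {0<..<t} (ball x R) (\<lambda>y s. heat_kernel (x - y) (t - s) powr (\<gamma> / real DIM('a)) * uT y s powr lam)
        \<le> ennreal (C1 + C2)" by (simp add: N_def)
  qed
qed

text \<open>Raises \<open>representation\<close> to the power lam by means of the threshold
  inequality: the kernel acquires the exponent lam, while u(tau) and f still enter linearly. As |y -
  x| < R, the ball of radius R around y stays in the ball of radius 2R around x, where the masses
  are bounded by \<open>m\<close>. The constant of \<open>representation\<close> is a hypothesis so
  that one value serves all points.\<close>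

lemma powr_bound_by_potentials:
  assumes R: "0 < R" and sub: "cball x (2 * R) \<subseteq> \<Omega>" and T': "0 < T'" "T' < T" and lam: "1 \<le> lam" and m: "0 < m"
    and mu: "\<And>s. 0 < s \<Longrightarrow> s < T' \<Longrightarrow> (\<integral>\<^sup>+y\<in>ball x (2 * R). ennreal (uT y s) \<partial>lborel) \<le> ennreal m"
    and mf: "cyl_integral {0<..<T'} (ball x (2 * R)) (\<lambda>y s. sourceT y s) \<le> ennreal m"
    and C: "0 < C"
      "\<And>x t \<tau> r. 0 < \<tau> \<Longrightarrow> \<tau> < t \<Longrightarrow> t < T \<Longrightarrow> 0 < r \<Longrightarrow> cball x r \<subseteq> \<Omega> \<Longrightarrow>
      ennreal (u x t) \<le> ennreal C *
       ((\<integral>\<^sup>+y\<in>ball x r. ennreal (heat_kernel (x - y) (t - \<tau>) * uT y \<tau>) \<partial>lborel) +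
        cyl_integral {\<tau><..<t} (ball x r) (\<lambda>y s. heat_kernel (x - y) (t - s) * sourceT y s) +
        ennreal (r powr (- real DIM('a) - 2)) *
          cyl_integral {\<tau><..<t} (ball x r) (\<lambda>y s. uT y s))"
    and \<tau>: "0 < \<tau>" "\<tau> < s" "s < T'" and y: "y \<in> ball x R"
  defines "c \<equiv> R powr (- real DIM('a) - 2) * (m * T')"
  shows "ennreal (uT y s powr lam) \<le> ennreal ((4 * C * c) powr lam + 2 * C * (8 * C * m) powr (lam - 1)) *
    ((\<integral>\<^sup>+w\<in>ball x (2 * R). ennreal (heat_kernel (y - w) (s - \<tau>) powr lam) * ennreal (uT w \<tau>) \<partial>lborel)
     + (\<integral>\<^sup>+v\<in>{\<tau><..<s}. (\<integral>\<^sup>+w\<in>ball x (2 * R). ennreal (heat_kernel (y - w) (s - v) powr lam) * ennreal (sourceT w v) \<partial>lborel) \<partial>lborel)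
     + 1)"
proof (rule powr_le_of_threshold[OF uT_nonneg C(1) m _ lam])
  show "0 < c" using R m T' by (simp add: c_def)
  define B where "B = ball x (2 * R)"
  define Y1 where "Y1 = (\<integral>\<^sup>+w\<in>B. ennreal (heat_kernel (y - w) (s - \<tau>) powr lam) * ennreal (uT w \<tau>) \<partial>lborel)"
  define G where "G v = (\<integral>\<^sup>+w\<in>B. ennreal (heat_kernel (y - w) (s - v) powr lam) * ennreal (sourceT w v) \<partial>lborel)" for v
  define F where "F v = (\<integral>\<^sup>+w\<in>B. ennreal (sourceT w v) \<partial>lborel)" for v
  define Y2 where "Y2 = (\<integral>\<^sup>+v\<in>{\<tau><..<s}. G v \<partial>lborel)"
  have [measurable]: "B \<in> sets borel" by (simp add: B_def)
  have GF[measurable]: "G \<in> borel_measurable lborel" "F \<in> borel_measurable lborel"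
    unfolding G_def F_def by measurable
  have sT: "s \<in> {0<..<T}" using \<tau> T' by auto
  have bb: "ball y R \<subseteq> B" unfolding B_def using y by (simp add: ball_subset_ball_iff dist_commute)
  have cb: "cball y R \<subseteq> \<Omega>"
  proof -
    have "cball y R \<subseteq> cball x (2 * R)" using y by (simp add: cball_subset_cball_iff dist_commute)
    then show ?thesis using sub by blast
  qed
  fix \<theta> :: real assume \<theta>: "0 < \<theta>"
  define e where "e = ennreal (\<theta> powr (1 - lam))"
  have T1: "(\<integral>\<^sup>+w\<in>ball y R. ennreal (heat_kernel (y - w) (s - \<tau>) * uT w \<tau>) \<partial>lborel) \<le> ennreal \<theta> * ennreal m + e * Y1"
  proof -
    have "(\<integral>\<^sup>+w\<in>ball y R. ennreal (heat_kernel (y - w) (s - \<tau>) * uT w \<tau>) \<partial>lborel)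
        \<le> (\<integral>\<^sup>+w\<in>B. ennreal (heat_kernel (y - w) (s - \<tau>) * uT w \<tau>) \<partial>lborel)"
      using bb by (rule nn_set_integral_set_mono)
    also have "\<dots> \<le> ennreal \<theta> * (\<integral>\<^sup>+w\<in>B. ennreal (uT w \<tau>) \<partial>lborel) + e * Y1"
      unfolding e_def Y1_def by (rule nn_integral_threshold) (use \<theta> lam in auto)
    also have "\<dots> \<le> ennreal \<theta> * ennreal m + e * Y1"
      unfolding B_def using \<tau> by (intro add_mono mult_left_mono mu) auto
    finally show ?thesis .
  qed
  have T2: "cyl_integral {\<tau><..<s} (ball y R) (\<lambda>w v. heat_kernel (y - w) (s - v) * sourceT w v)
      \<le> ennreal \<theta> * ennreal m + e * Y2"
  proof -
    have "cyl_integral {\<tau><..<s} (ball y R) (\<lambda>w v. heat_kernel (y - w) (s - v) * sourceT w v)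
      \<le> (\<integral>\<^sup>+v. ennreal \<theta> * (F v * indicator {\<tau><..<s} v) + e * (G v * indicator {\<tau><..<s} v) \<partial>lborel)"
    proof (intro nn_integral_mono)
      fix v
      have "(\<integral>\<^sup>+w\<in>ball y R. ennreal (heat_kernel (y - w) (s - v) * sourceT w v) \<partial>lborel)
        \<le> (\<integral>\<^sup>+w\<in>B. ennreal (heat_kernel (y - w) (s - v) * sourceT w v) \<partial>lborel)"
        using bb by (rule nn_set_integral_set_mono)
      also have "\<dots> \<le> ennreal \<theta> * F v + e * G v"
        unfolding e_def G_def F_def by (rule nn_integral_threshold) (use \<theta> lam in auto)
      finally show "(\<integral>\<^sup>+w\<in>ball y R. ennreal (heat_kernel (y - w) (s - v) * sourceT w v) \<partial>lborel) * indicator {\<tau><..<s} v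
          \<le> ennreal \<theta> * (F v * indicator {\<tau><..<s} v) + e * (G v * indicator {\<tau><..<s} v)"
        by (auto simp: indicator_def)
    qed
    also have "\<dots> = ennreal \<theta> * (\<integral>\<^sup>+v\<in>{\<tau><..<s}. F v \<partial>lborel) + e * Y2"
      unfolding Y2_def by (simp add: nn_integral_add nn_integral_cmult)
    also have "\<dots> \<le> ennreal \<theta> * (\<integral>\<^sup>+v\<in>{0<..<T'}. F v \<partial>lborel) + e * Y2"
      using \<tau> by (intro add_mono mult_left_mono nn_set_integral_set_mono) auto
    also have "\<dots> \<le> ennreal \<theta> * ennreal m + e * Y2"
      using mf unfolding F_def B_def by (intro add_mono mult_left_mono) auto
    finally show ?thesis .
  qed
  have T3: "ennreal (R powr (- real DIM('a) - 2)) *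
      cyl_integral {\<tau><..<s} (ball y R) (\<lambda>w v. uT w v) \<le> ennreal c"
  proof -
    have "cyl_integral {\<tau><..<s} (ball y R) (\<lambda>w v. uT w v)
      \<le> (\<integral>\<^sup>+v. ennreal m * indicator {0<..<T'} v \<partial>lborel)"
    proof (intro nn_integral_mono)
      fix v
      have "(\<integral>\<^sup>+w\<in>ball y R. ennreal (uT w v) \<partial>lborel) \<le> ennreal m" if "0 < v" "v < T'"
        using order_trans[OF nn_set_integral_set_mono[OF bb] mu[OF that, folded B_def]] .
      then show "(\<integral>\<^sup>+w\<in>ball y R. ennreal (uT w v) \<partial>lborel) * indicator {\<tau><..<s} v \<le> ennreal m * indicator {0<..<T'} v"
        using \<tau> by (auto simp: indicator_def)
    qed
    also have "\<dots> = ennreal (m * T')" using T' m by (subst nn_integral_cmult_indicator) (auto simp: ennreal_mult)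
    finally have "ennreal (R powr (- real DIM('a) - 2)) * cyl_integral {\<tau><..<s} (ball y R) (\<lambda>w v. uT w v)
       \<le> ennreal (R powr (- real DIM('a) - 2)) * ennreal (m * T')" by (intro mult_left_mono) auto
    also have "\<dots> = ennreal c" unfolding c_def using m T' by (intro ennreal_mult[symmetric]) auto
    finally show ?thesis .
  qed
  have "ennreal (uT y s) = ennreal (u y s)" using sT by (simp add: uT_def)
  also have "\<dots> \<le> ennreal C * ((ennreal \<theta> * ennreal m + e * Y1) + (ennreal \<theta> * ennreal m + e * Y2) + ennreal c)"
    using T' \<tau> by (intro order_trans[OF C(2)[OF \<tau>(1,2) _ R cb]] mult_left_mono add_mono T1 T2 T3) auto
  also have "(ennreal \<theta> * ennreal m + e * Y1) + (ennreal \<theta> * ennreal m + e * Y2) + ennreal c =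
      (ennreal \<theta> * ennreal m + ennreal \<theta> * ennreal m) + e * (Y1 + Y2) + ennreal c"
    by (simp only: distrib_left add_ac)
  also have "ennreal \<theta> * ennreal m + ennreal \<theta> * ennreal m = ennreal (2 * \<theta> * m)"
    using \<theta> m by (simp flip: ennreal_mult ennreal_plus)
  finally show "ennreal (uT y s) \<le> ennreal C * (ennreal (2 * \<theta> * m) + ennreal (\<theta> powr (1 - lam)) *
     ((\<integral>\<^sup>+w\<in>ball x (2 * R). ennreal (heat_kernel (y - w) (s - \<tau>) powr lam) * ennreal (uT w \<tau>) \<partial>lborel)
     + (\<integral>\<^sup>+v\<in>{\<tau><..<s}. (\<integral>\<^sup>+w\<in>ball x (2 * R). ennreal (heat_kernel (y - w) (s - v) powr lam) * ennreal (sourceT w v) \<partial>lborel) \<partial>lborel))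
     + ennreal c)"
    by (simp only: e_def Y1_def Y2_def G_def B_def)
qed

text \<open>After inserting \<open>powr_bound_by_potentials\<close> and interchanging integrals, the
  integral of Phi^lam over y leaves (s - v)^(-b) with b = n(lam-1)/2, and Phi^(gamma/n) is at most
  (t - s)^(-a) with a = gamma/2. The remaining time convolution converges because a + b < 1, which
  is the condition on gamma; what is left are the masses of u(tau) and of f. The radius 4R is what
  \<open>mass_bound\<close> requires for balls of radius 2R.\<close>

lemma potential_bound_superlinear:
  assumes K1: "compact K1" and R: "0 < R" and sub: "\<And>x. x \<in> K1 \<Longrightarrow> cball x (4 * R) \<subseteq> \<Omega>"
    and T': "0 < T'" "T' < T" and lam: "1 \<le> lam"
    and \<gamma>: "0 < \<gamma>" "\<gamma> + real DIM('a) * lam < real DIM('a) + 2"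
  obtains C :: real where "0 < C"
    "\<And>x t. x \<in> K1 \<Longrightarrow> 0 < t \<Longrightarrow> t < T' \<Longrightarrow>
      cyl_integral {0<..<t} (ball x R) (\<lambda>y s. heat_kernel (x - y) (t - s) powr (\<gamma> / real DIM('a)) * uT y s powr lam)
        \<le> ennreal C"
proof -
  define N where "N = real DIM('a)"
  have N: "0 < N" by (simp add: N_def)
  define a where "a = \<gamma> / 2"
  define b where "b = N * (lam - 1) / 2"
  have ab: "0 \<le> a" "0 \<le> b" "a + b < 1" 
  proof -
    have "a + b = (\<gamma> + N * lam - N) / 2" by (simp add: a_def b_def algebra_simps add_divide_distrib diff_divide_distrib)
    then show "a + b < 1" using \<gamma>(2) by (simp add: N_def)
  qed (use \<gamma> lam N in \<open>auto simp: a_def b_def\<close>)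
  have sub': "cball x (2 * (2 * R)) \<subseteq> \<Omega>" if "x \<in> K1" for x using sub[OF that] by simp
  have R2: "0 < 2 * R" using R by simp
  obtain m where m: "0 < m"
    "\<And>x s. x \<in> K1 \<Longrightarrow> 0 < s \<Longrightarrow> s < T' \<Longrightarrow> (\<integral>\<^sup>+y\<in>ball x (2 * R). ennreal (uT y s) \<partial>lborel) \<le> ennreal m"
    "\<And>x. x \<in> K1 \<Longrightarrow> cyl_integral {0<..<T'} (ball x (2 * R)) (\<lambda>y s. sourceT y s) \<le> ennreal m"
    by (rule mass_bound[OF K1 R2 sub' T']) (assumption, rule that)
  obtain C where C: "0 < C"
    "\<And>x t \<tau> r. 0 < \<tau> \<Longrightarrow> \<tau> < t \<Longrightarrow> t < T \<Longrightarrow> 0 < r \<Longrightarrow> cball x r \<subseteq> \<Omega> \<Longrightarrow>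
      ennreal (u x t) \<le> ennreal C *
       ((\<integral>\<^sup>+y\<in>ball x r. ennreal (heat_kernel (x - y) (t - \<tau>) * uT y \<tau>) \<partial>lborel) +
        cyl_integral {\<tau><..<t} (ball x r) (\<lambda>y s. heat_kernel (x - y) (t - s) * sourceT y s) +
        ennreal (r powr (- real DIM('a) - 2)) *
          cyl_integral {\<tau><..<t} (ball x r) (\<lambda>y s. uT y s))"
    by (rule representation) (rule that)
  have lam0: "0 < lam" using lam by simp
  obtain P where P: "0 < P"
    "\<And>(x::'a) \<tau>. 0 < \<tau> \<Longrightarrow> (\<integral>\<^sup>+y. ennreal (heat_kernel (y - x) \<tau> powr lam) \<partial>lborel) \<le> ennreal (P * \<tau> powr (N * (1 - lam) / 2))"
    by (rule nn_integral_heat_kernel_powr[OF lam0, where ?'a = 'a, folded N_def]) (rule that)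
  define c where "c = R powr (- real DIM('a) - 2) * (m * T')"
  define D where "D = (4 * C * c) powr lam + 2 * C * (8 * C * m) powr (lam - 1)"
  have D: "0 \<le> D" using C by (simp add: D_def)
  define W where "W = 2 * T' powr (1 - (a + b)) / (1 - (a + b))"
  have W: "0 \<le> W" using ab by (simp add: W_def)
  define V where "V = unit_ball_vol N * R ^ DIM('a)"
  have V: "0 \<le> V" using R N by (simp add: V_def)
  define U where "U = T' powr (1 - a) / (1 - a)"
  have U: "0 \<le> U" using ab by (simp add: U_def)
  \<comment> \<open>The summands stem from the potential of u(tau), the potential of f, and the
    constant 1 in \<open>powr_bound_by_potentials\<close>.\<close>
  define E where "E = D * (P * m * W + P * W * m + V * U)"
  have E0: "0 \<le> E" using D P m W V U by (simp add: E_def)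
  show ?thesis
  proof (rule that[of "1 + E"])
    show "0 < 1 + E" using E0 by simp
    fix x t assume x: "x \<in> K1" and t: "0 < t" "t < T'"
    have subx: "cball x (2 * R) \<subseteq> \<Omega>"
    proof -
      have "cball x (2 * R) \<subseteq> cball x (4 * R)" using R by (intro subset_cball) auto
      then show ?thesis using sub[OF x] by blast
    qed
    define B where "B = ball x (2 * R)"
    have [measurable]: "B \<in> sets borel" by (simp add: B_def)
    define F where "F v = (\<integral>\<^sup>+w\<in>B. ennreal (sourceT w v) \<partial>lborel)" for v
    have [measurable]: "F \<in> borel_measurable lborel" unfolding F_def by measurable
    have "cyl_integral {0<..<t} (ball x R) (\<lambda>y s. heat_kernel (x - y) (t - s) powr (\<gamma> / N) * uT y s powr lam) \<le> ennreal E"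
    \<comment> \<open>\<open>representation\<close> needs a positive starting time; \<open>E\<close>
      does not depend on it, so the limit to 0 is harmless.\<close>
    proof (rule set_nn_integral_Ioo_limit)
      show "(\<lambda>s. \<integral>\<^sup>+y\<in>ball x R. ennreal (heat_kernel (x - y) (t - s) powr (\<gamma> / N) * uT y s powr lam) \<partial>lborel) \<in> borel_measurable lborel"
        by measurable
      fix \<tau> assume \<tau>: "0 < \<tau>" "\<tau> < t"
      define Y1 where "Y1 y s = (\<integral>\<^sup>+w\<in>B. ennreal (heat_kernel (y - w) (s - \<tau>) powr lam) * ennreal (uT w \<tau>) \<partial>lborel)" for y s
      define Y2 where "Y2 y s = (\<integral>\<^sup>+v\<in>{\<tau><..<s}. (\<integral>\<^sup>+w\<in>B. ennreal (heat_kernel (y - w) (s - v) powr lam) * ennreal (sourceT w v) \<partial>lborel) \<partial>lborel)" for y s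
      have [measurable]: "(\<lambda>y. Y1 y s) \<in> borel_measurable lborel" "(\<lambda>y. Y2 y s) \<in> borel_measurable lborel" for s
        unfolding Y1_def Y2_def by measurable
      have bP: "N * (1 - lam) / 2 = - b" by (simp add: b_def algebra_simps diff_divide_distrib)
      have Y1i: "(\<integral>\<^sup>+y. Y1 y s \<partial>lborel) \<le> ennreal (P * m) * ennreal ((s - \<tau>) powr (- b))" if s: "\<tau> < s" for s
      proof -
        have "(\<integral>\<^sup>+y. Y1 y s \<partial>lborel) = (\<integral>\<^sup>+w. (\<integral>\<^sup>+y. ennreal (heat_kernel (y - w) (s - \<tau>) powr lam) * (ennreal (uT w \<tau>) * indicator B w) \<partial>lborel) \<partial>lborel)"
          unfolding Y1_def mult.assoc by (rule lborel_pair.Fubini') measurable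
        also have "\<dots> = (\<integral>\<^sup>+w. (\<integral>\<^sup>+y. ennreal (heat_kernel (y - w) (s - \<tau>) powr lam) \<partial>lborel) * (ennreal (uT w \<tau>) * indicator B w) \<partial>lborel)"
          by (intro nn_integral_cong nn_integral_multc) measurable
        also have "\<dots> \<le> (\<integral>\<^sup>+w. ennreal (P * (s - \<tau>) powr (- b)) * (ennreal (uT w \<tau>) * indicator B w) \<partial>lborel)"
          using P(2)[of "s - \<tau>"] s unfolding bP by (intro nn_integral_mono mult_right_mono) auto
        also have "\<dots> = ennreal (P * (s - \<tau>) powr (- b)) * (\<integral>\<^sup>+w\<in>B. ennreal (uT w \<tau>) \<partial>lborel)"
          by (rule nn_integral_cmult) measurable
        also have "\<dots> \<le> ennreal (P * (s - \<tau>) powr (- b)) * ennreal m"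
          unfolding B_def using \<tau> t x by (intro mult_left_mono m) auto
        also have "\<dots> = ennreal (P * m) * ennreal ((s - \<tau>) powr (- b))"
          using P m by (simp add: mult_ac flip: ennreal_mult)
        finally show ?thesis .
      qed
      have Y2i: "(\<integral>\<^sup>+y. Y2 y s \<partial>lborel) \<le> (\<integral>\<^sup>+v. ennreal P * (ennreal ((s - v) powr (- b)) * (F v * indicator {\<tau><..<s} v)) \<partial>lborel)" for s
      proof -
        have "(\<integral>\<^sup>+y. Y2 y s \<partial>lborel) = (\<integral>\<^sup>+v. (\<integral>\<^sup>+y. (\<integral>\<^sup>+w\<in>B. ennreal (heat_kernel (y - w) (s - v) powr lam) * ennreal (sourceT w v) \<partial>lborel) * indicator {\<tau><..<s} v \<partial>lborel) \<partial>lborel)"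
          unfolding Y2_def by (rule lborel_pair.Fubini') measurable
        also have "\<dots> \<le> (\<integral>\<^sup>+v. ennreal P * (ennreal ((s - v) powr (- b)) * (F v * indicator {\<tau><..<s} v)) \<partial>lborel)"
        proof (intro nn_integral_mono)
          fix v
          have "(\<integral>\<^sup>+y. (\<integral>\<^sup>+w\<in>B. ennreal (heat_kernel (y - w) (s - v) powr lam) * ennreal (sourceT w v) \<partial>lborel) \<partial>lborel)
             \<le> ennreal P * (ennreal ((s - v) powr (- b)) * F v)" if v: "v < s"
          proof -
            have "(\<integral>\<^sup>+y. (\<integral>\<^sup>+w\<in>B. ennreal (heat_kernel (y - w) (s - v) powr lam) * ennreal (sourceT w v) \<partial>lborel) \<partial>lborel)
              = (\<integral>\<^sup>+w. (\<integral>\<^sup>+y. ennreal (heat_kernel (y - w) (s - v) powr lam) * (ennreal (sourceT w v) * indicator B w) \<partial>lborel) \<partial>lborel)"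
              unfolding mult.assoc by (rule lborel_pair.Fubini') measurable
            also have "\<dots> = (\<integral>\<^sup>+w. (\<integral>\<^sup>+y. ennreal (heat_kernel (y - w) (s - v) powr lam) \<partial>lborel) * (ennreal (sourceT w v) * indicator B w) \<partial>lborel)"
              by (intro nn_integral_cong nn_integral_multc) measurable
            also have "\<dots> \<le> (\<integral>\<^sup>+w. ennreal (P * (s - v) powr (- b)) * (ennreal (sourceT w v) * indicator B w) \<partial>lborel)"
              using P(2)[of "s - v"] v unfolding bP by (intro nn_integral_mono mult_right_mono) auto
            also have "\<dots> = ennreal (P * (s - v) powr (- b)) * F v"
              unfolding F_def by (rule nn_integral_cmult) measurable
            also have "\<dots> = ennreal P * (ennreal ((s - v) powr (- b)) * F v)"
              using P by (simp add: ennreal_mult mult.assoc)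
            finally show ?thesis .
          qed
          then show "(\<integral>\<^sup>+y. (\<integral>\<^sup>+w\<in>B. ennreal (heat_kernel (y - w) (s - v) powr lam) * ennreal (sourceT w v) \<partial>lborel) * indicator {\<tau><..<s} v \<partial>lborel)
              \<le> ennreal P * (ennreal ((s - v) powr (- b)) * (F v * indicator {\<tau><..<s} v))"
            by (auto simp: indicator_def)
        qed
        finally show ?thesis .
      qed
      define w where "w s = ennreal ((t - s) powr (- a)) * indicator {\<tau><..<t} s" for s
      have [measurable]: "w \<in> borel_measurable lborel" unfolding w_def by measurable
      have "cyl_integral {\<tau><..<t} (ball x R) (\<lambda>y s. heat_kernel (x - y) (t - s) powr (\<gamma> / N) * uT y s powr lam)
        \<le> (\<integral>\<^sup>+s. ennreal D * (ennreal (P * m) * (w s * ennreal ((s - \<tau>) powr (- b)))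
             + ennreal P * (\<integral>\<^sup>+v. w s * (ennreal ((s - v) powr (- b)) * (F v * indicator {\<tau><..<s} v)) \<partial>lborel)
             + ennreal V * w s) \<partial>lborel)"
      proof (intro nn_integral_mono)
        fix s
        show "(\<integral>\<^sup>+y\<in>ball x R. ennreal (heat_kernel (x - y) (t - s) powr (\<gamma> / N) * uT y s powr lam) \<partial>lborel) * indicator {\<tau><..<t} s
          \<le> ennreal D * (ennreal (P * m) * (w s * ennreal ((s - \<tau>) powr (- b)))
             + ennreal P * (\<integral>\<^sup>+v. w s * (ennreal ((s - v) powr (- b)) * (F v * indicator {\<tau><..<s} v)) \<partial>lborel)
             + ennreal V * w s)"
        proof (cases "s \<in> {\<tau><..<t}")
          case s: True
          have "(\<integral>\<^sup>+y\<in>ball x R. ennreal (heat_kernel (x - y) (t - s) powr (\<gamma> / N) * uT y s powr lam) \<partial>lborel)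
            \<le> (\<integral>\<^sup>+y. w s * (ennreal D * (Y1 y s + Y2 y s + indicator (ball x R) y)) \<partial>lborel)"
          proof (intro nn_integral_mono)
            fix y
            show "ennreal (heat_kernel (x - y) (t - s) powr (\<gamma> / N) * uT y s powr lam) * indicator (ball x R) y
              \<le> w s * (ennreal D * (Y1 y s + Y2 y s + indicator (ball x R) y))"
            proof (cases "y \<in> ball x R")
              case y: True
              have "ennreal (heat_kernel (x - y) (t - s) powr (\<gamma> / N) * uT y s powr lam)
                  = ennreal (heat_kernel (x - y) (t - s) powr (\<gamma> / N)) * ennreal (uT y s powr lam)"
                by (intro ennreal_mult) auto
              also have "\<dots> \<le> w s * (ennreal D * (Y1 y s + Y2 y s + 1))"
              proof (intro mult_mono)
                have "heat_kernel (x - y) (t - s) powr (\<gamma> / N) \<le> (t - s) powr (- a)"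
                  unfolding N_def a_def using s \<gamma> by (intro heat_kernel_powr_le) auto
                then show "ennreal (heat_kernel (x - y) (t - s) powr (\<gamma> / N)) \<le> w s"
                  using s by (simp add: w_def ennreal_leI)
                show "ennreal (uT y s powr lam) \<le> ennreal D * (Y1 y s + Y2 y s + 1)"
                  unfolding D_def Y1_def Y2_def B_def c_def
                  using s t by (intro powr_bound_by_potentials[OF R subx T' lam m(1) m(2)[OF x] m(3)[OF x] C \<tau>(1) _ _ y]) auto
              qed auto
              finally show ?thesis using y by simp
            qed simp
          qed
          also have "\<dots> = w s * (ennreal D * ((\<integral>\<^sup>+y. Y1 y s \<partial>lborel) + (\<integral>\<^sup>+y. Y2 y s \<partial>lborel) + emeasure lborel (ball x R)))"
            by (simp add: nn_integral_add nn_integral_cmult)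
          also have "\<dots> \<le> w s * (ennreal D * (ennreal (P * m) * ennreal ((s - \<tau>) powr (- b)) +
               (\<integral>\<^sup>+v. ennreal P * (ennreal ((s - v) powr (- b)) * (F v * indicator {\<tau><..<s} v)) \<partial>lborel) + ennreal V))"
            using s R by (intro mult_left_mono add_mono Y1i Y2i) (auto simp: emeasure_ball V_def N_def)
          also have "(\<integral>\<^sup>+v. ennreal P * (ennreal ((s - v) powr (- b)) * (F v * indicator {\<tau><..<s} v)) \<partial>lborel)
              = ennreal P * (\<integral>\<^sup>+v. ennreal ((s - v) powr (- b)) * (F v * indicator {\<tau><..<s} v) \<partial>lborel)"
            by (rule nn_integral_cmult) measurable
          also have "w s * (ennreal D * (ennreal (P * m) * ennreal ((s - \<tau>) powr (- b)) +
               ennreal P * (\<integral>\<^sup>+v. ennreal ((s - v) powr (- b)) * (F v * indicator {\<tau><..<s} v) \<partial>lborel) + ennreal V))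
            = ennreal D * (ennreal (P * m) * (w s * ennreal ((s - \<tau>) powr (- b)))
             + ennreal P * (w s * (\<integral>\<^sup>+v. ennreal ((s - v) powr (- b)) * (F v * indicator {\<tau><..<s} v) \<partial>lborel))
             + ennreal V * w s)"
            by (simp only: distrib_left mult_ac)
          also have "w s * (\<integral>\<^sup>+v. ennreal ((s - v) powr (- b)) * (F v * indicator {\<tau><..<s} v) \<partial>lborel)
             = (\<integral>\<^sup>+v. w s * (ennreal ((s - v) powr (- b)) * (F v * indicator {\<tau><..<s} v)) \<partial>lborel)"
            by (rule nn_integral_cmult[symmetric]) measurable
          finally show ?thesis using s by simp
        qed simp
      qed
      also have "\<dots> = ennreal D * (ennreal (P * m) * (\<integral>\<^sup>+s. w s * ennreal ((s - \<tau>) powr (- b)) \<partial>lborel)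
             + ennreal P * (\<integral>\<^sup>+s. (\<integral>\<^sup>+v. w s * (ennreal ((s - v) powr (- b)) * (F v * indicator {\<tau><..<s} v)) \<partial>lborel) \<partial>lborel)
             + ennreal V * (\<integral>\<^sup>+s. w s \<partial>lborel))"
      proof -
        define J where "J s = (\<integral>\<^sup>+v. w s * (ennreal ((s - v) powr (- b)) * (F v * indicator {\<tau><..<s} v)) \<partial>lborel)" for s
        have [measurable]: "J \<in> borel_measurable lborel"
          unfolding J_def indicator_def greaterThanLessThan_iff by measurable
        have "(\<integral>\<^sup>+s. ennreal D * (ennreal (P * m) * (w s * ennreal ((s - \<tau>) powr (- b))) + ennreal P * J s + ennreal V * w s) \<partial>lborel)
          = ennreal D * (ennreal (P * m) * (\<integral>\<^sup>+s. w s * ennreal ((s - \<tau>) powr (- b)) \<partial>lborel)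
             + ennreal P * (\<integral>\<^sup>+s. J s \<partial>lborel) + ennreal V * (\<integral>\<^sup>+s. w s \<partial>lborel))"
          by (simp add: nn_integral_add nn_integral_cmult)
        then show ?thesis unfolding J_def .
      qed
      also have "\<dots> \<le> ennreal D * (ennreal (P * m) * ennreal W + ennreal P * (ennreal W * ennreal m) + ennreal V * ennreal U)"
      proof (intro mult_left_mono add_mono)
        \<comment> \<open>Uniform in \<open>v\<close>, so once the order of integration is reversed
          only the total mass of f remains.\<close>
        have conv: "(\<integral>\<^sup>+s. w s * (ennreal ((s - v) powr (- b)) * indicator {\<tau><..<s} v) \<partial>lborel) \<le> ennreal W * indicator {\<tau><..<t} v" for v
        proof (cases "v \<in> {\<tau><..<t}")
          case True
          have "(\<integral>\<^sup>+s. w s * (ennreal ((s - v) powr (- b)) * indicator {\<tau><..<s} v) \<partial>lborel)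
              \<le> (\<integral>\<^sup>+s\<in>{v<..<t}. ennreal ((t - s) powr (- a) * (s - v) powr (- b)) \<partial>lborel)"
            by (intro nn_integral_mono) (auto simp: w_def indicator_def ennreal_mult)
          also have "\<dots> \<le> ennreal W"
            unfolding W_def using ab True t \<tau> by (intro nn_integral_powr_convolution) auto
          finally show ?thesis using True by simp
        next
          case False
          then have "w s * (ennreal ((s - v) powr (- b)) * indicator {\<tau><..<s} v) = 0" for s
            by (auto simp: w_def indicator_def)
          then have "(\<integral>\<^sup>+s. w s * (ennreal ((s - v) powr (- b)) * indicator {\<tau><..<s} v) \<partial>lborel) = 0"
            by (simp only: nn_integral_const mult_zero_left)
          then show ?thesis by (simp only: zero_le)
        qed
        show "(\<integral>\<^sup>+s. w s * ennreal ((s - \<tau>) powr (- b)) \<partial>lborel) \<le> ennreal W"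
        proof -
          have "(\<integral>\<^sup>+s. w s * ennreal ((s - \<tau>) powr (- b)) \<partial>lborel)
            = (\<integral>\<^sup>+s\<in>{\<tau><..<t}. ennreal ((t - s) powr (- a) * (s - \<tau>) powr (- b)) \<partial>lborel)"
            by (intro nn_integral_cong) (auto simp: w_def indicator_def ennreal_mult)
          also have "\<dots> \<le> ennreal W"
            unfolding W_def using ab t \<tau> by (intro nn_integral_powr_convolution) auto
          finally show ?thesis .
        qed
        show "(\<integral>\<^sup>+s. w s \<partial>lborel) \<le> ennreal U"
        proof -
          have "(\<integral>\<^sup>+s. w s \<partial>lborel) \<le> (\<integral>\<^sup>+s\<in>{t - t<..<t}. ennreal ((t - s) powr (- a)) \<partial>lborel)"
            using \<tau> by (intro nn_integral_mono) (auto simp: w_def indicator_def)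
          also have "\<dots> \<le> ennreal (t powr (1 - a) / (1 - a))"
            using ab t by (intro nn_integral_powr_right) auto
          also have "\<dots> \<le> ennreal U"
            unfolding U_def using ab t by (intro ennreal_leI divide_right_mono powr_mono2) auto
          finally show ?thesis .
        qed
        show "(\<integral>\<^sup>+s. (\<integral>\<^sup>+v. w s * (ennreal ((s - v) powr (- b)) * (F v * indicator {\<tau><..<s} v)) \<partial>lborel) \<partial>lborel) \<le> ennreal W * ennreal m"
        proof -
          have "(\<integral>\<^sup>+s. (\<integral>\<^sup>+v. w s * (ennreal ((s - v) powr (- b)) * (F v * indicator {\<tau><..<s} v)) \<partial>lborel) \<partial>lborel)
            = (\<integral>\<^sup>+v. (\<integral>\<^sup>+s. w s * (ennreal ((s - v) powr (- b)) * (F v * indicator {\<tau><..<s} v)) \<partial>lborel) \<partial>lborel)"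
            unfolding indicator_def greaterThanLessThan_iff by (rule lborel_pair.Fubini') measurable
          also have "\<dots> = (\<integral>\<^sup>+v. (\<integral>\<^sup>+s. (w s * (ennreal ((s - v) powr (- b)) * indicator {\<tau><..<s} v)) * F v \<partial>lborel) \<partial>lborel)"
            by (simp only: mult_ac)
          also have "\<dots> = (\<integral>\<^sup>+v. (\<integral>\<^sup>+s. w s * (ennreal ((s - v) powr (- b)) * indicator {\<tau><..<s} v) \<partial>lborel) * F v \<partial>lborel)"
            unfolding indicator_def greaterThanLessThan_iff by (intro nn_integral_cong nn_integral_multc) measurable
          also have "\<dots> \<le> (\<integral>\<^sup>+v. ennreal W * (F v * indicator {0<..<T'} v) \<partial>lborel)"
          proof (intro nn_integral_mono)
            fix v
            have "(\<integral>\<^sup>+s. w s * (ennreal ((s - v) powr (- b)) * indicator {\<tau><..<s} v) \<partial>lborel) * F v \<le> ennreal W * indicator {\<tau><..<t} v * F v"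
              by (intro mult_right_mono conv) auto
            also have "\<dots> \<le> ennreal W * (F v * indicator {0<..<T'} v)"
              using \<tau> t by (auto simp: indicator_def)
            finally show "(\<integral>\<^sup>+s. w s * (ennreal ((s - v) powr (- b)) * indicator {\<tau><..<s} v) \<partial>lborel) * F v \<le> ennreal W * (F v * indicator {0<..<T'} v)" .
          qed
          also have "\<dots> = ennreal W * (\<integral>\<^sup>+v\<in>{0<..<T'}. F v \<partial>lborel)"
            by (rule nn_integral_cmult) measurable
          also have "\<dots> \<le> ennreal W * ennreal m"
            unfolding F_def B_def by (intro mult_left_mono m(3) x) auto
          finally show ?thesis .
        qed
      qed auto
      also have "\<dots> = ennreal E"
        unfolding E_def using D P(1) m(1) W V U
        by (simp add: mult.assoc flip: ennreal_mult ennreal_plus)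
      finally show "cyl_integral {\<tau><..<t} (ball x R) (\<lambda>y s. heat_kernel (x - y) (t - s) powr (\<gamma> / N) * uT y s powr lam) \<le> ennreal E" .
    qed
    also have "ennreal E \<le> ennreal (1 + E)" by (intro ennreal_leI) simp
    finally show "cyl_integral {0<..<t} (ball x R) (\<lambda>y s. heat_kernel (x - y) (t - s) powr (\<gamma> / real DIM('a)) * uT y s powr lam)
        \<le> ennreal (1 + E)" by (simp add: N_def)
  qed
qed

text \<open>The condition gamma + n lam < n + 2 is the same in both ranges, though for different
  reasons: interpolation for lam <= 1, iterated potentials for lam > 1.\<close>

lemma potential_bound:
  assumes "compact K1" "0 < R" "\<And>x. x \<in> K1 \<Longrightarrow> cball x (4 * R) \<subseteq> \<Omega>" "0 < T'" "T' < T" "0 < lam"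
    and "0 < \<gamma>" "\<gamma> + real DIM('a) * lam < real DIM('a) + 2"
  obtains C :: real where "0 < C"
    "\<And>x t. x \<in> K1 \<Longrightarrow> 0 < t \<Longrightarrow> t < T' \<Longrightarrow>
      cyl_integral {0<..<t} (ball x R) (\<lambda>y s. heat_kernel (x - y) (t - s) powr (\<gamma> / real DIM('a)) * uT y s powr lam)
        \<le> ennreal C"
proof (cases "lam \<le> 1")
  case True
  have sub: "cball x (2 * R) \<subseteq> \<Omega>" if "x \<in> K1" for x
  proof -
    have "cball x (2 * R) \<subseteq> cball x (4 * R)" using assms(2) by (intro subset_cball) auto
    then show ?thesis using assms(3)[OF that] by blast
  qed
  show ?thesis
    by (rule potential_bound_sublinear[OF assms(1,2) sub assms(4,5,6) True assms(7,8)])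
      (assumption, rule that)
next
  case False
  then have "1 \<le> lam" by simp
  from potential_bound_superlinear[OF assms(1-5) this assms(7,8)] show ?thesis
    using that by blast
qed

section \<open>The weighted maximum point\<close>

text \<open>The distance \<open>D\<close> takes account of the lateral boundary and of the bottom
  t0/2 but not of the top, since the cylinders used later extend backward in time. Thus D at (x0,
  t0) is sqrt(t0/2), which yields the comparison with \<open>u x0 t0\<close>. If u vanishes on the
  cylinder the maximum point may have d = 0, hence the premise \<open>0 < d\<close> in the last
  clause.\<close>

lemma weighted_maximum:
  assumes t0: "0 < t0" "t0 < T" and p: "0 < p"
  obtains x1 t1 d where "0 \<le> d" "dist x1 x0 + d \<le> sqrt t0" "t0 / 2 + d\<^sup>2 \<le> t1" "t1 \<le> t0"
    "u x0 t0 * (t0 / 2) powr (p / 2) \<le> u x1 t1 * d powr p"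
    "\<And>y s. 0 < d \<Longrightarrow> dist y x1 \<le> d / 2 \<Longrightarrow> t1 - d\<^sup>2 / 4 \<le> s \<Longrightarrow> s \<le> t1 \<Longrightarrow> u y s \<le> 2 powr p * u x1 t1"
proof -
  define Q where "Q = cball x0 (sqrt t0) \<times> {t0 / 2..t0}"
  define D where "D z = min (sqrt t0 - dist (fst z) x0) (sqrt (snd z - t0 / 2))" for z :: "'a \<times> real"
  define w where "w z = D z powr p * u (fst z) (snd z)" for z
  have D0: "0 \<le> D z" if "z \<in> Q" for z using that by (auto simp: D_def Q_def dist_commute)
  have cw: "continuous_on Q w"
    unfolding w_def
  proof (intro continuous_on_mult continuous_on_powr')
    show "continuous_on Q D" unfolding D_def by (intro continuous_intros)
    show "continuous_on Q (\<lambda>z. u (fst z) (snd z))"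
      by (rule continuous_on_subset[OF cont_u]) (use t0 in \<open>auto simp: Q_def\<close>)
  qed (use D0 p in auto)
  have cQ: "compact Q" unfolding Q_def by (intro compact_Times) auto
  have z0: "(x0, t0) \<in> Q" using t0 by (simp add: Q_def)
  then have "Q \<noteq> {}" by blast
  from continuous_attains_sup[OF cQ this cw]
  obtain z where z: "z \<in> Q" "\<And>z'. z' \<in> Q \<Longrightarrow> w z' \<le> w z" by blast
  define x1 where "x1 = fst z"
  define t1 where "t1 = snd z"
  define d where "d = D z"
  have zz: "dist x1 x0 \<le> sqrt t0" "t0 / 2 \<le> t1" "t1 \<le> t0" using z(1) by (auto simp: Q_def x1_def t1_def dist_commute)
  have d: "0 \<le> d" "d \<le> sqrt t0 - dist x1 x0" "d \<le> sqrt (t1 - t0 / 2)"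
    using D0[OF z(1)] by (auto simp: d_def D_def x1_def t1_def)
  have d2: "d\<^sup>2 \<le> t1 - t0 / 2"
    using power_mono[OF d(3) d(1), of 2] zz by simp
  show ?thesis
  proof (rule that[of d x1 t1])
    show "0 \<le> d" "dist x1 x0 + d \<le> sqrt t0" "t0 / 2 + d\<^sup>2 \<le> t1" "t1 \<le> t0" using d d2 zz by auto
    have "D (x0, t0) = (t0 / 2) powr (1 / 2)"
    proof -
      have "sqrt (t0 / 2) \<le> sqrt t0" using t0 by (intro real_sqrt_le_mono) simp
      moreover have "t0 - t0 / 2 = t0 / 2" by simp
      ultimately show ?thesis using t0 by (simp add: D_def powr_half_sqrt min_absorb2)
    qed
    then show "u x0 t0 * (t0 / 2) powr (p / 2) \<le> u x1 t1 * d powr p"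
      using z(2)[OF z0] t0 by (simp add: w_def d_def x1_def t1_def powr_powr mult.commute)
    fix y s assume d0: "0 < d" and y: "dist y x1 \<le> d / 2" and s: "t1 - d\<^sup>2 / 4 \<le> s" "s \<le> t1"
    have "0 \<le> d\<^sup>2" by simp
    \<comment> \<open>s - t0/2 is at least d^2 - d^2/4, which exceeds (d/2)^2.\<close>
    then have s': "(d / 2)\<^sup>2 \<le> s - t0 / 2" "t0 / 2 \<le> s" using s d2 by (auto simp: power2_eq_square)
    have "dist y x0 \<le> dist y x1 + dist x1 x0" by (rule dist_triangle)
    then have 1: "d / 2 \<le> sqrt t0 - dist y x0" using y d by simp
    have 2: "d / 2 \<le> sqrt (s - t0 / 2)" using real_le_rsqrt[OF s'(1)] .
    have Dys: "d / 2 \<le> D (y, s)" using 1 2 by (simp add: D_def)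
    have inQ: "(y, s) \<in> Q" using 1 d0 s s' zz by (auto simp: Q_def dist_commute)
    have u0: "0 \<le> u y s" using s' s zz t0 by (intro u_nonneg) auto
    have "(d / 2) powr p * u y s \<le> D (y, s) powr p * u y s"
      using Dys d0 p u0 by (intro mult_right_mono powr_mono2) auto
    also have "\<dots> \<le> d powr p * u x1 t1" using z(2)[OF inQ] by (simp add: w_def d_def x1_def t1_def)
    finally have "d powr p * u y s \<le> d powr p * (2 powr p * u x1 t1)"
      using d0 by (simp add: powr_divide field_simps)
    then show "u y s \<le> 2 powr p * u x1 t1" using d0 by (simp add: mult_le_cancel_left)
  qed
qed

end

section \<open>The rate at a weighted maximum point\<close>

text \<open>The double integral may be infinite a priori, so the inequality is stated in
  \<open>ennreal\<close>. The case distinction on \<open>\<sigma>\<close> is there because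
  \<open>0 powr 0\<close> is 0, whereas u^0 means 1.\<close>

locale nonlocal_supersolution = supersolution u T ut ux uxx \<Omega>
  for u :: "'a::euclidean_space \<Rightarrow> real \<Rightarrow> real" and T ut ux uxx \<Omega> +
  fixes \<alpha> lam \<sigma> :: real
  assumes alpha: "0 < \<alpha>" "\<alpha> < real DIM('a) + 2" and lam: "0 < lam" and sigma: "0 \<le> \<sigma>"
    and nonlocal: "\<And>x t. x \<in> \<Omega> \<Longrightarrow> t \<in> {0<..<T} \<Longrightarrow> ennreal (source x t) \<le>
      (\<integral>\<^sup>+s. (\<integral>\<^sup>+y. ennreal (heat_kernel (x - y) (t - s) powr (\<alpha> / real DIM('a)) * uT y s powr lam) \<partial>lborel) \<partial>lborel)
      * ennreal (if \<sigma> = 0 then 1 else u x t powr \<sigma>)"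
begin

text \<open>The excluded cylinder need not be closed off at s = t, because the kernel vanishes for s
  >= t.\<close>

definition far :: "'a \<Rightarrow> real \<Rightarrow> real \<Rightarrow> ennreal" where
  "far x t \<rho> = (\<integral>\<^sup>+s. (\<integral>\<^sup>+y. ennreal (heat_kernel (x - y) (t - s) powr (\<alpha> / real DIM('a)) * uT y s powr lam)
      * (if t - \<rho>\<^sup>2 < s \<and> dist x y < \<rho> then 0 else 1) \<partial>lborel) \<partial>lborel)"

text \<open>Inside the cylinder u^lam is at most M^lam, and Phi^(alpha/n) integrated over the time
  span rho^2 gives a multiple of rho^(n+2-alpha); here alpha < n + 2 makes the singularity
  integrable.\<close>

lemma nonlocal_term_split:
  obtains C :: real where "0 < C"
    "\<And>x t \<rho> M. 0 < \<rho> \<Longrightarrow> 0 \<le> M \<Longrightarrow> (\<forall>y s. dist y x < \<rho> \<longrightarrow> t - \<rho>\<^sup>2 < s \<longrightarrow> s < t \<longrightarrow> uT y s \<le> M) \<Longrightarrow>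
      (\<integral>\<^sup>+s. (\<integral>\<^sup>+y. ennreal (heat_kernel (x - y) (t - s) powr (\<alpha> / real DIM('a)) * uT y s powr lam) \<partial>lborel) \<partial>lborel)
      \<le> ennreal (C * M powr lam * \<rho> powr (real DIM('a) + 2 - \<alpha>)) + far x t \<rho>"
proof -
  define N where "N = real DIM('a)"
  have N: "0 < N" by (simp add: N_def)
  have a: "0 < \<alpha> / N" "N * (\<alpha> / N - 1) < 2" using alpha N by (auto simp: N_def right_diff_distrib)
  obtain C where C: "0 < C" "\<And>(x::'a) t h. 0 \<le> h \<Longrightarrow>
       (\<integral>\<^sup>+s\<in>{t - h<..<t}. (\<integral>\<^sup>+y. ennreal (heat_kernel (x - y) (t - s) powr (\<alpha> / N)) \<partial>lborel) \<partial>lborel)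
         \<le> ennreal (C * h powr (1 - N * (\<alpha> / N - 1) / 2))"
    by (rule nn_integral_heat_kernel_cylinder[where ?'a = 'a, folded N_def, OF a]) (rule that)
  show ?thesis
  proof (rule that[OF C(1)])
    fix x t \<rho> M assume \<rho>: "0 < \<rho>" and M: "0 \<le> M" and ub0: "\<forall>y s. dist y x < \<rho> \<longrightarrow> t - \<rho>\<^sup>2 < s \<longrightarrow> s < t \<longrightarrow> uT y s \<le> M"
    have ub: "uT y s \<le> M" if "dist y x < \<rho>" "t - \<rho>\<^sup>2 < s" "s < t" for y s using ub0 that by blast
    define g where "g y s = ennreal (heat_kernel (x - y) (t - s) powr (\<alpha> / N) * uT y s powr lam)" for y s
    define G where "G s = (\<integral>\<^sup>+y. g y s * (if t - \<rho>\<^sup>2 < s \<and> dist x y < \<rho> then 0 else 1) \<partial>lborel)" for s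
    have gm[measurable]: "(\<lambda>z. g (fst z) (snd z)) \<in> borel_measurable (lborel \<Otimes>\<^sub>M lborel)"
      unfolding g_def by measurable
    have gm'[measurable]: "(\<lambda>y. g y s) \<in> borel_measurable lborel" for s
      unfolding g_def by measurable
    have Gm[measurable]: "G \<in> borel_measurable lborel"
      unfolding G_def g_def by measurable
    have "(\<integral>\<^sup>+s. (\<integral>\<^sup>+y. g y s \<partial>lborel) \<partial>lborel) \<le>
      (\<integral>\<^sup>+s. ennreal (M powr lam) * ((\<integral>\<^sup>+y. ennreal (heat_kernel (x - y) (t - s) powr (\<alpha> / N)) \<partial>lborel) * indicator {t - \<rho>\<^sup>2<..<t} s) + G s \<partial>lborel)"
    proof (intro nn_integral_mono)
      fix s
      have "(\<integral>\<^sup>+y. g y s \<partial>lborel) \<le> (\<integral>\<^sup>+y. (ennreal (M powr lam) * indicator {t - \<rho>\<^sup>2<..<t} s) * ennreal (heat_kernel (x - y) (t - s) powr (\<alpha> / N))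
          + g y s * (if t - \<rho>\<^sup>2 < s \<and> dist x y < \<rho> then 0 else 1) \<partial>lborel)"
      proof (intro nn_integral_mono)
        fix y
        show "g y s \<le> (ennreal (M powr lam) * indicator {t - \<rho>\<^sup>2<..<t} s) * ennreal (heat_kernel (x - y) (t - s) powr (\<alpha> / N))
          + g y s * (if t - \<rho>\<^sup>2 < s \<and> dist x y < \<rho> then 0 else 1)"
        proof (cases "t - \<rho>\<^sup>2 < s \<and> dist x y < \<rho>")
          case True
          show ?thesis
          proof (cases "s < t")
            case s: True
            have "heat_kernel (x - y) (t - s) powr (\<alpha> / N) * uT y s powr lam \<le> heat_kernel (x - y) (t - s) powr (\<alpha> / N) * M powr lam"
              using True s lam by (intro mult_left_mono powr_mono2 ub) (auto simp: dist_commute)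
            then have "g y s \<le> ennreal (M powr lam) * ennreal (heat_kernel (x - y) (t - s) powr (\<alpha> / N))"
              by (simp add: g_def ennreal_leI mult.commute flip: ennreal_mult)
            then show ?thesis using True s by simp
          next
            case False
            then have "g y s = 0" by (simp add: g_def heat_kernel_def)
            then show ?thesis by simp
          qed
        next
          case False
          then have "g y s * (if t - \<rho>\<^sup>2 < s \<and> dist x y < \<rho> then 0 else 1) = g y s" by (simp only: if_False mult_1_right)
          then show ?thesis by (simp only: add_increasing order_refl zero_le)
        qed
      qed
      also have "\<dots> = (ennreal (M powr lam) * indicator {t - \<rho>\<^sup>2<..<t} s) * (\<integral>\<^sup>+y. ennreal (heat_kernel (x - y) (t - s) powr (\<alpha> / N)) \<partial>lborel) + G s"
      proof -
        have 1: "(\<lambda>y. g y s * (if t - \<rho>\<^sup>2 < s \<and> dist x y < \<rho> then 0 else 1)) \<in> borel_measurable lborel"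
          by measurable
        show ?thesis unfolding G_def by (subst nn_integral_add[OF _ 1]) (auto simp: nn_integral_cmult)
      qed
      also have "\<dots> = ennreal (M powr lam) * ((\<integral>\<^sup>+y. ennreal (heat_kernel (x - y) (t - s) powr (\<alpha> / N)) \<partial>lborel) * indicator {t - \<rho>\<^sup>2<..<t} s) + G s"
        by (simp only: mult_ac)
      finally show "(\<integral>\<^sup>+y. g y s \<partial>lborel) \<le> \<dots>" .
    qed
    also have "\<dots> = ennreal (M powr lam) * (\<integral>\<^sup>+s\<in>{t - \<rho>\<^sup>2<..<t}. (\<integral>\<^sup>+y. ennreal (heat_kernel (x - y) (t - s) powr (\<alpha> / N)) \<partial>lborel) \<partial>lborel) + (\<integral>\<^sup>+s. G s \<partial>lborel)"
      by (simp add: nn_integral_add nn_integral_cmult)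
    also have "\<dots> \<le> ennreal (M powr lam) * ennreal (C * (\<rho>\<^sup>2) powr (1 - N * (\<alpha> / N - 1) / 2)) + far x t \<rho>"
      unfolding far_def G_def g_def N_def[symmetric] by (intro add_mono mult_left_mono C) auto
    also have "ennreal (M powr lam) * ennreal (C * (\<rho>\<^sup>2) powr (1 - N * (\<alpha> / N - 1) / 2)) = ennreal (C * M powr lam * \<rho> powr (N + 2 - \<alpha>))"
    proof -
      have e: "2 * (1 - N * (\<alpha> / N - 1) / 2) = N + 2 - \<alpha>" using N by (simp add: field_simps)
      show ?thesis unfolding power2_powr[OF \<rho>] e using C(1) by (simp add: mult_ac flip: ennreal_mult)
    qed
    finally show "(\<integral>\<^sup>+s. (\<integral>\<^sup>+y. ennreal (heat_kernel (x - y) (t - s) powr (\<alpha> / real DIM('a)) * uT y s powr lam) \<partial>lborel) \<partial>lborel)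
      \<le> ennreal (C * M powr lam * \<rho> powr (real DIM('a) + 2 - \<alpha>)) + far x t \<rho>"
      by (simp add: g_def N_def)
  qed
qed

text \<open>Every term of \<open>cylinder_representation\<close> is estimated: the mean of u by a
  threshold theta and the L^q integral e, and f by its supremum, against which the kernel integrates
  to O(rho^2). The bound by M is demanded on the doubled cylinder because the near part of f at a
  point (y,s) of the smaller one involves the rho-cylinder ending at (y,s).\<close>

lemma pointwise_bound:
  assumes q: "1 \<le> q"
  obtains C :: real where "0 < C"
    "\<And>x t \<rho> M d e \<theta>. 0 < \<rho> \<Longrightarrow> 4 * \<rho>\<^sup>2 < t \<Longrightarrow> t < T \<Longrightarrow> cball x \<rho> \<subseteq> \<Omega> \<Longrightarrow> 0 < \<theta> \<Longrightarrow> 0 < M \<Longrightarrow> 0 \<le> d \<Longrightarrow> 0 \<le> e \<Longrightarrow>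
      (\<forall>y s. dist y x \<le> 2 * \<rho> \<longrightarrow> t - 4 * \<rho>\<^sup>2 \<le> s \<longrightarrow> s \<le> t \<longrightarrow> u y s \<le> M) \<Longrightarrow>
      cyl_integral {t - \<rho>\<^sup>2<..<t} (ball x \<rho>) (\<lambda>y s. uT y s powr q) \<le> ennreal e \<Longrightarrow>
      (\<forall>y s. dist y x < \<rho> \<longrightarrow> t - \<rho>\<^sup>2 < s \<longrightarrow> s < t \<longrightarrow> far y s \<rho> \<le> ennreal d) \<Longrightarrow>
      u x t \<le> C * (\<theta> + \<theta> powr (1 - q) * e * \<rho> powr (- real DIM('a) - 2)
        + \<rho>\<^sup>2 * (M powr lam * \<rho> powr (real DIM('a) + 2 - \<alpha>) + d) * M powr \<sigma>)"
proof -
  define N where "N = real DIM('a)"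
  have N: "0 < N" by (simp add: N_def)
  obtain C1 where C1: "0 < C1"
    "\<And>x t \<rho>. 0 < \<rho> \<Longrightarrow> \<rho>\<^sup>2 < t \<Longrightarrow> t < T \<Longrightarrow> cball x \<rho> \<subseteq> \<Omega> \<Longrightarrow>
      ennreal (u x t) \<le> ennreal C1 *
       (ennreal (\<rho> powr (- N - 2)) *
          cyl_integral {t - \<rho>\<^sup>2<..<t} (ball x \<rho>) (\<lambda>y s. uT y s) +
        cyl_integral {t - \<rho>\<^sup>2<..<t} (ball x \<rho>) (\<lambda>y s. heat_kernel (x - y) (t - s) * sourceT y s))"
    by (rule cylinder_representation[folded N_def]) (rule that)
  obtain C2 where C2: "0 < C2"
    "\<And>x t \<rho> M. 0 < \<rho> \<Longrightarrow> 0 \<le> M \<Longrightarrow> (\<forall>y s. dist y x < \<rho> \<longrightarrow> t - \<rho>\<^sup>2 < s \<longrightarrow> s < t \<longrightarrow> uT y s \<le> M) \<Longrightarrow>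
      (\<integral>\<^sup>+s. (\<integral>\<^sup>+y. ennreal (heat_kernel (x - y) (t - s) powr (\<alpha> / N) * uT y s powr lam) \<partial>lborel) \<partial>lborel)
      \<le> ennreal (C2 * M powr lam * \<rho> powr (N + 2 - \<alpha>)) + far x t \<rho>"
    by (rule nonlocal_term_split[folded N_def]) (rule that)
  have one: "0 < (1::real)" "N * (1 - 1) < 2" by auto
  obtain C3 where C3: "0 < C3" "\<And>(x::'a) t h. 0 \<le> h \<Longrightarrow>
       (\<integral>\<^sup>+s\<in>{t - h<..<t}. (\<integral>\<^sup>+y. ennreal (heat_kernel (x - y) (t - s) powr 1) \<partial>lborel) \<partial>lborel)
         \<le> ennreal (C3 * h powr (1 - N * (1 - 1) / 2))"
    by (rule nn_integral_heat_kernel_cylinder[where ?'a = 'a, folded N_def, OF one]) (rule that)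
  define \<omega> where "\<omega> = unit_ball_vol N"
  have \<omega>: "0 < \<omega>" using N by (simp add: \<omega>_def)
  define C where "C = C1 * (1 + \<omega> + C3 * (1 + C2))"
  have C: "0 < C" using C1 C2 C3 \<omega> by (auto simp: C_def intro!: mult_pos_pos add_pos_pos)
  show ?thesis
  proof (rule that[OF C])
    fix x :: 'a and t \<rho> M d e \<theta> :: real
    assume \<rho>: "0 < \<rho>" "4 * \<rho>\<^sup>2 < t" and tT: "t < T" and cb: "cball x \<rho> \<subseteq> \<Omega>" and \<theta>: "0 < \<theta>" and M: "0 < M" and d: "0 \<le> d" and e: "0 \<le> e"
      and ub0: "\<forall>y s. dist y x \<le> 2 * \<rho> \<longrightarrow> t - 4 * \<rho>\<^sup>2 \<le> s \<longrightarrow> s \<le> t \<longrightarrow> u y s \<le> M"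
      and mean: "cyl_integral {t - \<rho>\<^sup>2<..<t} (ball x \<rho>) (\<lambda>y s. uT y s powr q) \<le> ennreal e"
      and farb0: "\<forall>y s. dist y x < \<rho> \<longrightarrow> t - \<rho>\<^sup>2 < s \<longrightarrow> s < t \<longrightarrow> far y s \<rho> \<le> ennreal d"
    have ub: "u y s \<le> M" if "dist y x \<le> 2 * \<rho>" "t - 4 * \<rho>\<^sup>2 \<le> s" "s \<le> t" for y s using ub0 that by blast
    have farb: "far y s \<rho> \<le> ennreal d" if "dist y x < \<rho>" "t - \<rho>\<^sup>2 < s" "s < t" for y s using farb0 that by blast
    have r2: "0 < \<rho>\<^sup>2" using \<rho> by simp
    define a3 where "a3 s = (\<integral>\<^sup>+y\<in>ball x \<rho>. ennreal (uT y s) \<partial>lborel)" for s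
    define b3 where "b3 s = (\<integral>\<^sup>+y\<in>ball x \<rho>. ennreal (uT y s powr q) \<partial>lborel)" for s
    have [measurable]: "b3 \<in> borel_measurable lborel" unfolding b3_def by measurable
    have A3: "(\<integral>\<^sup>+s\<in>{t - \<rho>\<^sup>2<..<t}. a3 s \<partial>lborel) \<le> ennreal (\<theta> * (\<omega> * \<rho> powr (N + 2)) + \<theta> powr (1 - q) * e)"
    proof -
      have "(\<integral>\<^sup>+s\<in>{t - \<rho>\<^sup>2<..<t}. a3 s \<partial>lborel) \<le>
        (\<integral>\<^sup>+s. ennreal (\<theta> * (\<omega> * \<rho> ^ DIM('a))) * indicator {t - \<rho>\<^sup>2<..<t} s + ennreal (\<theta> powr (1 - q)) * (b3 s * indicator {t - \<rho>\<^sup>2<..<t} s) \<partial>lborel)"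
      proof (intro nn_integral_mono)
        fix s
        have "a3 s \<le> (\<integral>\<^sup>+y. ennreal \<theta> * indicator (ball x \<rho>) y + ennreal (\<theta> powr (1 - q)) * (ennreal (uT y s powr q) * indicator (ball x \<rho>) y) \<partial>lborel)"
          unfolding a3_def
        proof (intro nn_integral_mono)
          fix y
          have "ennreal (uT y s) \<le> ennreal (\<theta> + \<theta> powr (1 - q) * uT y s powr q)"
            using \<theta> q by (intro ennreal_leI le_threshold_powr) auto
          also have "\<dots> = ennreal \<theta> + ennreal (\<theta> powr (1 - q)) * ennreal (uT y s powr q)"
            using \<theta> by (simp add: ennreal_plus ennreal_mult)
          finally show "ennreal (uT y s) * indicator (ball x \<rho>) y \<le> ennreal \<theta> * indicator (ball x \<rho>) y + ennreal (\<theta> powr (1 - q)) * (ennreal (uT y s powr q) * indicator (ball x \<rho>) y)"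
            by (auto simp: indicator_def)
        qed
        also have "\<dots> = ennreal \<theta> * emeasure lborel (ball x \<rho>) + ennreal (\<theta> powr (1 - q)) * b3 s"
          unfolding b3_def by (simp add: nn_integral_add nn_integral_cmult)
        also have "ennreal \<theta> * emeasure lborel (ball x \<rho>) = ennreal (\<theta> * (\<omega> * \<rho> ^ DIM('a)))"
          using \<rho> \<theta> \<omega> by (simp add: emeasure_ball \<omega>_def N_def ennreal_mult)
        finally show "a3 s * indicator {t - \<rho>\<^sup>2<..<t} s \<le> ennreal (\<theta> * (\<omega> * \<rho> ^ DIM('a))) * indicator {t - \<rho>\<^sup>2<..<t} s + ennreal (\<theta> powr (1 - q)) * (b3 s * indicator {t - \<rho>\<^sup>2<..<t} s)"
          by (auto simp: indicator_def)
      qed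
      also have "\<dots> = ennreal (\<theta> * (\<omega> * \<rho> ^ DIM('a))) * ennreal (\<rho>\<^sup>2) + ennreal (\<theta> powr (1 - q)) * (\<integral>\<^sup>+s\<in>{t - \<rho>\<^sup>2<..<t}. b3 s \<partial>lborel)"
        using r2 by (simp add: nn_integral_add nn_integral_cmult nn_integral_cmult_indicator)
      also have "\<dots> \<le> ennreal (\<theta> * (\<omega> * \<rho> ^ DIM('a))) * ennreal (\<rho>\<^sup>2) + ennreal (\<theta> powr (1 - q)) * ennreal e"
        using mean unfolding b3_def by (intro add_mono mult_left_mono) auto
      also have "\<dots> = ennreal (\<theta> * (\<omega> * \<rho> ^ DIM('a)) * \<rho>\<^sup>2 + \<theta> powr (1 - q) * e)"
        using \<theta> \<omega> \<rho> e by (simp add: ennreal_mult ennreal_plus)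
      also have "\<theta> * (\<omega> * \<rho> ^ DIM('a)) * \<rho>\<^sup>2 = \<theta> * (\<omega> * \<rho> powr (N + 2))"
      proof -
        have "\<rho> powr (N + 2) = \<rho> ^ DIM('a) * \<rho>\<^sup>2"
          using \<rho> by (simp add: powr_add N_def powr_realpow flip: powr_numeral)
        then show ?thesis by simp
      qed
      finally show ?thesis .
    qed
    define J where "J = (C2 * M powr lam * \<rho> powr (N + 2 - \<alpha>) + d) * M powr \<sigma>"
    have J: "0 \<le> J" using C2 d by (simp add: J_def)
    have fb: "ennreal (sourceT y s) \<le> ennreal J" if y: "y \<in> ball x \<rho>" and s: "s \<in> {t - \<rho>\<^sup>2<..<t}" for y s
    proof -
      have sT: "s \<in> {0<..<T}" using s \<rho> r2 tT by auto
      have y\<Omega>: "y \<in> \<Omega>" using y cb by (auto simp: subset_eq)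
      have ub': "uT w v \<le> M" if "dist w y < \<rho>" "s - \<rho>\<^sup>2 < v" "v < s" for w v
      proof -
        have "dist w x \<le> dist w y + dist y x" by (rule dist_triangle)
        then have "u w v \<le> M" using that y s r2 by (intro ub) (auto simp: dist_commute)
        then show ?thesis using M by (simp add: uT_def)
      qed
      have us: "u y s \<le> M" using y s r2 \<rho>(1) by (intro ub) (auto simp: dist_commute)
      have "ennreal (sourceT y s) = ennreal (source y s)" using sT by (simp add: sourceT_def)
      also have "\<dots> \<le> (\<integral>\<^sup>+v. (\<integral>\<^sup>+w. ennreal (heat_kernel (y - w) (s - v) powr (\<alpha> / N) * uT w v powr lam) \<partial>lborel) \<partial>lborel)
        * ennreal (if \<sigma> = 0 then 1 else u y s powr \<sigma>)"
        using nonlocal[OF y\<Omega> sT] by (simp add: N_def)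
      also have "\<dots> \<le> (ennreal (C2 * M powr lam * \<rho> powr (N + 2 - \<alpha>)) + far y s \<rho>) * ennreal (M powr \<sigma>)"
      proof (intro mult_mono C2(2))
        show "ennreal (if \<sigma> = 0 then 1 else u y s powr \<sigma>) \<le> ennreal (M powr \<sigma>)"
          using M us sigma u_nonneg[OF sT] by (auto intro!: ennreal_leI powr_mono2)
      qed (use \<rho> M ub' in auto)
      also have "\<dots> \<le> (ennreal (C2 * M powr lam * \<rho> powr (N + 2 - \<alpha>)) + ennreal d) * ennreal (M powr \<sigma>)"
        using y s by (intro mult_right_mono add_mono farb) (auto simp: dist_commute)
      also have "\<dots> = ennreal J"
        unfolding J_def using C2(1) d by (simp add: ennreal_mult ennreal_plus)
      finally show ?thesis .
    qed
    have A2: "cyl_integral {t - \<rho>\<^sup>2<..<t} (ball x \<rho>) (\<lambda>y s. heat_kernel (x - y) (t - s) * sourceT y s)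
        \<le> ennreal (C3 * \<rho>\<^sup>2 * J)"
    proof -
      have "cyl_integral {t - \<rho>\<^sup>2<..<t} (ball x \<rho>) (\<lambda>y s. heat_kernel (x - y) (t - s) * sourceT y s)
        \<le> (\<integral>\<^sup>+s. ennreal J * ((\<integral>\<^sup>+y. ennreal (heat_kernel (x - y) (t - s) powr 1) \<partial>lborel) * indicator {t - \<rho>\<^sup>2<..<t} s) \<partial>lborel)"
      proof (intro nn_integral_mono)
        fix s
        have "(\<integral>\<^sup>+y\<in>ball x \<rho>. ennreal (heat_kernel (x - y) (t - s) * sourceT y s) \<partial>lborel) \<le> ennreal J * (\<integral>\<^sup>+y. ennreal (heat_kernel (x - y) (t - s) powr 1) \<partial>lborel)"
          if s: "s \<in> {t - \<rho>\<^sup>2<..<t}"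
        proof -
          have "(\<integral>\<^sup>+y\<in>ball x \<rho>. ennreal (heat_kernel (x - y) (t - s) * sourceT y s) \<partial>lborel)
            \<le> (\<integral>\<^sup>+y. ennreal J * ennreal (heat_kernel (x - y) (t - s) powr 1) \<partial>lborel)"
          proof (intro nn_integral_mono)
            fix y
            have "ennreal (heat_kernel (x - y) (t - s) * sourceT y s) \<le> ennreal J * ennreal (heat_kernel (x - y) (t - s))" if "y \<in> ball x \<rho>"
              using fb[OF that s] by (simp add: ennreal_mult' mult.commute[of "ennreal J"] mult_left_mono)
            then show "ennreal (heat_kernel (x - y) (t - s) * sourceT y s) * indicator (ball x \<rho>) y \<le> ennreal J * ennreal (heat_kernel (x - y) (t - s) powr 1)"
              by (auto simp: indicator_def)
          qed
          also have "\<dots> = ennreal J * (\<integral>\<^sup>+y. ennreal (heat_kernel (x - y) (t - s) powr 1) \<partial>lborel)"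
            by (rule nn_integral_cmult) measurable
          finally show ?thesis .
        qed
        then show "(\<integral>\<^sup>+y\<in>ball x \<rho>. ennreal (heat_kernel (x - y) (t - s) * sourceT y s) \<partial>lborel) * indicator {t - \<rho>\<^sup>2<..<t} s
          \<le> ennreal J * ((\<integral>\<^sup>+y. ennreal (heat_kernel (x - y) (t - s) powr 1) \<partial>lborel) * indicator {t - \<rho>\<^sup>2<..<t} s)"
          by (auto simp: indicator_def)
      qed
      also have "\<dots> = ennreal J * (\<integral>\<^sup>+s\<in>{t - \<rho>\<^sup>2<..<t}. (\<integral>\<^sup>+y. ennreal (heat_kernel (x - y) (t - s) powr 1) \<partial>lborel) \<partial>lborel)"
        by (rule nn_integral_cmult) measurable
      also have "\<dots> \<le> ennreal J * ennreal (C3 * (\<rho>\<^sup>2) powr (1 - N * (1 - 1) / 2))"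
        by (intro mult_left_mono C3) auto
      also have "\<dots> = ennreal (C3 * \<rho>\<^sup>2 * J)" using J C3(1) r2 by (simp add: mult_ac flip: ennreal_mult)
      finally show ?thesis .
    qed
    have "\<rho>\<^sup>2 < t" using \<rho> r2 by linarith
    then have "ennreal (u x t) \<le> ennreal C1 * (ennreal (\<rho> powr (- N - 2)) * (\<integral>\<^sup>+s\<in>{t - \<rho>\<^sup>2<..<t}. a3 s \<partial>lborel) +
        cyl_integral {t - \<rho>\<^sup>2<..<t} (ball x \<rho>) (\<lambda>y s. heat_kernel (x - y) (t - s) * sourceT y s))"
      unfolding a3_def using C1(2)[OF \<rho>(1) _ tT cb] by simp
    also have "\<dots> \<le> ennreal C1 * (ennreal (\<rho> powr (- N - 2)) * ennreal (\<theta> * (\<omega> * \<rho> powr (N + 2)) + \<theta> powr (1 - q) * e) + ennreal (C3 * \<rho>\<^sup>2 * J))"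
      by (intro mult_left_mono add_mono A3 A2) auto
    also have "\<dots> = ennreal (C1 * (\<rho> powr (- N - 2) * (\<theta> * (\<omega> * \<rho> powr (N + 2)) + \<theta> powr (1 - q) * e) + C3 * \<rho>\<^sup>2 * J))"
      using C1(1) C3(1) \<theta> \<omega> e J by (simp flip: ennreal_mult ennreal_plus)
    finally have "u x t \<le> C1 * (\<rho> powr (- N - 2) * (\<theta> * (\<omega> * \<rho> powr (N + 2)) + \<theta> powr (1 - q) * e) + C3 * \<rho>\<^sup>2 * J)"
      using C1(1) C3(1) \<theta> \<omega> e J by (subst (asm) ennreal_le_iff) auto
    also have "\<rho> powr (- N - 2) * (\<theta> * (\<omega> * \<rho> powr (N + 2)) + \<theta> powr (1 - q) * e) = \<omega> * \<theta> + \<theta> powr (1 - q) * e * \<rho> powr (- N - 2)"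
    proof -
      have "\<rho> powr (- N - 2) * \<rho> powr (N + 2) = 1" using \<rho> by (simp add: powr_add[symmetric])
      then show ?thesis by (simp add: distrib_left mult_ac)
    qed
    also have "C1 * (\<omega> * \<theta> + \<theta> powr (1 - q) * e * \<rho> powr (- N - 2) + C3 * \<rho>\<^sup>2 * J)
       \<le> C * (\<theta> + \<theta> powr (1 - q) * e * \<rho> powr (- N - 2) + \<rho>\<^sup>2 * (M powr lam * \<rho> powr (N + 2 - \<alpha>) + d) * M powr \<sigma>)"
    proof -
      define K where "K = 1 + \<omega> + C3 * (1 + C2)"
      have K: "1 \<le> K" "\<omega> \<le> K" "C3 * (1 + C2) \<le> K" using \<omega> C2(1) C3(1) by (auto simp: K_def)
      have 1: "\<omega> * \<theta> \<le> K * \<theta>" using K \<theta> by (intro mult_right_mono) auto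
      have 2: "1 * (\<theta> powr (1 - q) * e * \<rho> powr (- N - 2)) \<le> K * (\<theta> powr (1 - q) * e * \<rho> powr (- N - 2))"
        using K e by (intro mult_right_mono) auto
      have 3: "C3 * \<rho>\<^sup>2 * J \<le> K * (\<rho>\<^sup>2 * (M powr lam * \<rho> powr (N + 2 - \<alpha>) + d) * M powr \<sigma>)"
      proof -
        have "J \<le> ((1 + C2) * (M powr lam * \<rho> powr (N + 2 - \<alpha>) + d)) * M powr \<sigma>"
          unfolding J_def using C2(1) d by (intro mult_right_mono) (auto simp: algebra_simps)
        then have "C3 * \<rho>\<^sup>2 * J \<le> C3 * \<rho>\<^sup>2 * (((1 + C2) * (M powr lam * \<rho> powr (N + 2 - \<alpha>) + d)) * M powr \<sigma>)"
          using C3(1) by (intro mult_left_mono) auto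
        also have "\<dots> = (C3 * (1 + C2)) * (\<rho>\<^sup>2 * (M powr lam * \<rho> powr (N + 2 - \<alpha>) + d) * M powr \<sigma>)" by (simp only: mult_ac)
        also have "\<dots> \<le> K * (\<rho>\<^sup>2 * (M powr lam * \<rho> powr (N + 2 - \<alpha>) + d) * M powr \<sigma>)"
          using K d by (intro mult_right_mono) auto
        finally show ?thesis .
      qed
      have "\<omega> * \<theta> + \<theta> powr (1 - q) * e * \<rho> powr (- N - 2) + C3 * \<rho>\<^sup>2 * J \<le>
        K * (\<theta> + \<theta> powr (1 - q) * e * \<rho> powr (- N - 2) + \<rho>\<^sup>2 * (M powr lam * \<rho> powr (N + 2 - \<alpha>) + d) * M powr \<sigma>)"
        using 1 2 3 by (simp only: distrib_left mult_1_left)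
      then have "C1 * (\<omega> * \<theta> + \<theta> powr (1 - q) * e * \<rho> powr (- N - 2) + C3 * \<rho>\<^sup>2 * J) \<le>
        C1 * (K * (\<theta> + \<theta> powr (1 - q) * e * \<rho> powr (- N - 2) + \<rho>\<^sup>2 * (M powr lam * \<rho> powr (N + 2 - \<alpha>) + d) * M powr \<sigma>))"
        using C1(1) by (intro mult_left_mono) auto
      then show ?thesis by (simp only: C_def K_def mult.assoc)
    qed
    finally show "u x t \<le> C * (\<theta> + \<theta> powr (1 - q) * e * \<rho> powr (- real DIM('a) - 2)
        + \<rho>\<^sup>2 * (M powr lam * \<rho> powr (real DIM('a) + 2 - \<alpha>) + d) * M powr \<sigma>)" by (simp only: N_def)
  qed
qed

text \<open>\<open>C0\<close> is fixed before \<open>E\<close>: a constant E yields the O rate, an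
  arbitrarily small E the o rate. The exponent n + 2 - pq in the mean hypothesis is the one for
  which the mean term becomes proportional to A under the scaling A = b rho^(-p).\<close>

lemma rate_bound:
  assumes p: "0 < p" and q: "1 \<le> q"
  obtains C0 :: real where "0 < C0"
    "\<And>E D \<beta> t1 K K1 R. 0 < E \<Longrightarrow> 0 \<le> D \<Longrightarrow> 0 < 2 - \<beta> + (1 - \<sigma>) * p \<Longrightarrow>
      0 < 2 + (real DIM('a) + 2 - \<alpha>) + (1 - \<sigma> - lam) * p \<Longrightarrow> 0 < R \<Longrightarrow> 0 < t1 \<Longrightarrow> t1 \<le> T \<Longrightarrow>
      (\<forall>x\<in>K. cball x R \<subseteq> K1) \<Longrightarrow> (\<forall>x\<in>K1. cball x R \<subseteq> \<Omega>) \<Longrightarrow>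
      (\<forall>x\<in>K1. \<forall>t \<rho>. 0 < \<rho> \<longrightarrow> \<rho> < R \<longrightarrow> \<rho> < 1 \<longrightarrow> \<rho>\<^sup>2 < t \<longrightarrow> t < t1 \<longrightarrow>
        cyl_integral {t - \<rho>\<^sup>2<..<t} (ball x \<rho>) (\<lambda>y s. uT y s powr q)
          \<le> ennreal (E * \<rho> powr (real DIM('a) + 2 - p * q))) \<Longrightarrow>
      (\<forall>x\<in>K1. \<forall>t \<rho>. 0 < \<rho> \<longrightarrow> \<rho> < R \<longrightarrow> \<rho> < 1 \<longrightarrow> \<rho>\<^sup>2 < t \<longrightarrow> t < t1 \<longrightarrow>
        far x t \<rho> \<le> ennreal (D * \<rho> powr (- \<beta>))) \<Longrightarrow>
      \<exists>t2>0. \<forall>x\<in>K. \<forall>t. 0 < t \<longrightarrow> t < t2 \<longrightarrow> u x t powr q * t powr (p * q / 2) \<le> C0 * E"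
proof -
  define N where "N = real DIM('a)"
  obtain C where C: "0 < C"
    "\<And>x t \<rho> M d e \<theta>. 0 < \<rho> \<Longrightarrow> 4 * \<rho>\<^sup>2 < t \<Longrightarrow> t < T \<Longrightarrow> cball x \<rho> \<subseteq> \<Omega> \<Longrightarrow> 0 < \<theta> \<Longrightarrow> 0 < M \<Longrightarrow> 0 \<le> d \<Longrightarrow> 0 \<le> e \<Longrightarrow>
      (\<forall>y s. dist y x \<le> 2 * \<rho> \<longrightarrow> t - 4 * \<rho>\<^sup>2 \<le> s \<longrightarrow> s \<le> t \<longrightarrow> u y s \<le> M) \<Longrightarrow>
      cyl_integral {t - \<rho>\<^sup>2<..<t} (ball x \<rho>) (\<lambda>y s. uT y s powr q) \<le> ennreal e \<Longrightarrow>
      (\<forall>y s. dist y x < \<rho> \<longrightarrow> t - \<rho>\<^sup>2 < s \<longrightarrow> s < t \<longrightarrow> far y s \<rho> \<le> ennreal d) \<Longrightarrow>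
      u x t \<le> C * (\<theta> + \<theta> powr (1 - q) * e * \<rho> powr (- N - 2)
        + \<rho>\<^sup>2 * (M powr lam * \<rho> powr (N + 2 - \<alpha>) + d) * M powr \<sigma>)"
    by (rule pointwise_bound[OF q, folded N_def]) (rule that)
  \<comment> \<open>With the threshold theta = kappa A, the first term C theta equals A/4.\<close>
  define \<kappa> where "\<kappa> = 1 / (4 * C)"
  have \<kappa>: "0 < \<kappa>" using C by (simp add: \<kappa>_def)
  \<comment> \<open>With b^q = C' E and rho^p = b/A, the mean term equals A/4 as well.\<close>
  define C' where "C' = 4 * C * \<kappa> powr (1 - q)"
  have C': "0 < C'" using C \<kappa> by (simp add: C'_def)
  \<comment> \<open>If the claimed bound fails, this constant gives u(x,t) (t/2)^(p/2) > 4^p b; at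
    the weighted maximum point this becomes A d^p > 4^p b, that is 4 rho < d.\<close>
  define C0 where "C0 = 2 powr (p * q / 2) * 4 powr (p * q) * C'"
  have C0: "0 < C0" using C' by (simp add: C0_def)
  show ?thesis
  proof (rule that[OF C0])
    fix E D \<beta> t1 R :: real and K K1 :: "'a set"
    assume E: "0 < E" and D: "0 \<le> D" and f1: "0 < 2 - \<beta> + (1 - \<sigma>) * p"
      and f2: "0 < 2 + (real DIM('a) + 2 - \<alpha>) + (1 - \<sigma> - lam) * p"
      and R: "0 < R" and t1: "0 < t1" "t1 \<le> T"
      and KK1: "\<forall>x\<in>K. cball x R \<subseteq> K1" and K1\<Omega>: "\<forall>x\<in>K1. cball x R \<subseteq> \<Omega>"
      and mean: "\<forall>x\<in>K1. \<forall>t \<rho>. 0 < \<rho> \<longrightarrow> \<rho> < R \<longrightarrow> \<rho> < 1 \<longrightarrow> \<rho>\<^sup>2 < t \<longrightarrow> t < t1 \<longrightarrow>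
        cyl_integral {t - \<rho>\<^sup>2<..<t} (ball x \<rho>) (\<lambda>y s. uT y s powr q)
          \<le> ennreal (E * \<rho> powr (real DIM('a) + 2 - p * q))"
      and farb: "\<forall>x\<in>K1. \<forall>t \<rho>. 0 < \<rho> \<longrightarrow> \<rho> < R \<longrightarrow> \<rho> < 1 \<longrightarrow> \<rho>\<^sup>2 < t \<longrightarrow> t < t1 \<longrightarrow>
        far x t \<rho> \<le> ennreal (D * \<rho> powr (- \<beta>))"
    define b where "b = (C' * E) powr (1 / q)"
    have b: "0 < b" "b powr q = C' * E" using C' E q by (auto simp: b_def powr_powr)
    define B where "B = 2 powr p * b"
    have B: "0 < B" using b by (simp add: B_def)
    define e2 where "e2 = 2 + (N + 2 - \<alpha>) + (1 - \<sigma> - lam) * p"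
    define e1 where "e1 = 2 - \<beta> + (1 - \<sigma>) * p"
    have e12: "0 < e1" "0 < e2" using f1 f2 by (auto simp: e1_def e2_def N_def)
    \<comment> \<open>The contribution of the potential of f, measured in units of rho^(-p) = A/b.
      The two exponent hypotheses make it tend to 0, so it falls below b/2, which means A/2.\<close>
    define h where "h \<rho> = C * (B powr lam * B powr \<sigma> * \<rho> powr e2 + D * B powr \<sigma> * \<rho> powr e1)" for \<rho>
    have "((\<lambda>\<rho>::real. \<rho> powr e) \<longlongrightarrow> 0) (at_right 0)" if "0 < e" for e
    proof (rule tendsto_zero_powrI)
      show "((\<lambda>\<rho>::real. \<rho>) \<longlongrightarrow> 0) (at_right 0)" by (rule tendsto_ident_at)
      show "((\<lambda>\<rho>::real. e) \<longlongrightarrow> e) (at_right 0)" by (rule tendsto_const)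
    qed (use that in \<open>auto simp: eventually_at_filter\<close>)
    then have "(h \<longlongrightarrow> C * (B powr lam * B powr \<sigma> * 0 + D * B powr \<sigma> * 0)) (at_right 0)"
      unfolding h_def using e12 by (intro tendsto_intros)
    then have "(h \<longlongrightarrow> 0) (at_right 0)" by simp
    then have "\<forall>\<^sub>F \<rho> in at_right 0. h \<rho> < b / 2" using b by (intro order_tendstoD(2)) auto
    then obtain \<rho>0 where \<rho>0: "0 < \<rho>0" "\<And>\<rho>. 0 < \<rho> \<Longrightarrow> \<rho> < \<rho>0 \<Longrightarrow> h \<rho> < b / 2"
      by (auto simp: eventually_at_right_field)
    define m where "m = min (min R 1) \<rho>0"
    have m: "0 < m" "m \<le> R" "m \<le> 1" "m \<le> \<rho>0" using R \<rho>0 by (auto simp: m_def)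
    \<comment> \<open>t < m^2 forces d <= sqrt(t) < m, and therefore rho < d/4 is below all required
      thresholds.\<close>
    define t2 where "t2 = min t1 (m\<^sup>2)"
    have t2: "0 < t2" using t1 m by (simp add: t2_def)
    have "u x t powr q * t powr (p * q / 2) \<le> C0 * E" if x: "x \<in> K" and t: "0 < t" "t < t2" for x t
    proof (rule ccontr)
      assume "\<not> u x t powr q * t powr (p * q / 2) \<le> C0 * E"
      then have big: "C0 * E < u x t powr q * t powr (p * q / 2)" by simp
      have tt: "t < t1" "t < m\<^sup>2" "t < T" using t t1 by (auto simp: t2_def)
      have sqt: "sqrt t < m" using real_sqrt_less_mono[OF tt(2)] m by simp
      have u0: "0 \<le> u x t" using t tt by (intro u_nonneg) auto
      obtain x1 t1' d where M: "0 \<le> d" "dist x1 x + d \<le> sqrt t" "t / 2 + d\<^sup>2 \<le> t1'" "t1' \<le> t"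
        "u x t * (t / 2) powr (p / 2) \<le> u x1 t1' * d powr p"
        "\<And>y s. 0 < d \<Longrightarrow> dist y x1 \<le> d / 2 \<Longrightarrow> t1' - d\<^sup>2 / 4 \<le> s \<Longrightarrow> s \<le> t1' \<Longrightarrow> u y s \<le> 2 powr p * u x1 t1'"
        by (rule weighted_maximum[OF t(1) tt(3) p, of x]) (rule that)
      define A where "A = u x1 t1'"
      have d2: "0 \<le> d\<^sup>2" by simp
      have t1'0: "0 < t1'" using M(3) t d2 by linarith
      have A0: "0 \<le> A" unfolding A_def using t1'0 M tt by (intro u_nonneg) auto
      define X where "X = u x t * (t / 2) powr (p / 2)"
      have X0: "0 \<le> X" using u0 by (simp add: X_def)
      have "4 powr p * b < X"
      proof (rule ccontr)
        assume "\<not> 4 powr p * b < X"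
        then have "X powr q \<le> (4 powr p * b) powr q" using X0 q by (intro powr_mono2) auto
        also have "\<dots> = 4 powr (p * q) * (C' * E)" using b by (simp add: powr_mult powr_powr)
        finally have 1: "X powr q \<le> 4 powr (p * q) * (C' * E)" .
        have "X powr q = u x t powr q * t powr (p * q / 2) / 2 powr (p * q / 2)"
          unfolding X_def using t by (simp add: powr_mult powr_powr powr_divide)
        then have "u x t powr q * t powr (p * q / 2) = 2 powr (p * q / 2) * X powr q" by simp
        also have "\<dots> \<le> 2 powr (p * q / 2) * (4 powr (p * q) * (C' * E))" using 1 by (intro mult_left_mono) auto
        also have "\<dots> = C0 * E" by (simp add: C0_def)
        finally show False using big by simp
      qed
      then have Ad: "4 powr p * b < A * d powr p" using M(5) by (simp add: X_def A_def)
      moreover have "0 < 4 powr p * b" using b by simp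
      ultimately have "0 < A * d powr p" by linarith
      then have A: "0 < A" and d: "0 < d" using A0 M(1) by (auto simp: zero_less_mult_iff)
      define \<rho> where "\<rho> = (b / A) powr (1 / p)"
      have \<rho>: "0 < \<rho>" "\<rho> powr p = b / A" using b A p by (auto simp: \<rho>_def powr_powr)
      have \<rho>d: "4 * \<rho> < d"
      proof (rule ccontr)
        assume "\<not> 4 * \<rho> < d"
        then have "d powr p \<le> (4 * \<rho>) powr p" using d p by (intro powr_mono2) auto
        also have "\<dots> = 4 powr p * (b / A)" using \<rho> by (simp add: powr_mult)
        finally have "A * d powr p \<le> 4 powr p * b" using A by (simp add: field_simps)
        then show False using Ad by simp
      qed
      have dm: "d < m" using M(2) sqt zero_le_dist[of x1 x] by linarith
      have \<rho>m: "\<rho> < R" "\<rho> < 1" "\<rho> < \<rho>0" using \<rho>d dm m \<rho>(1) by auto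
      have \<rho>2: "16 * \<rho>\<^sup>2 < d\<^sup>2"
        using power_strict_mono[OF \<rho>d, of 2] \<rho>(1) by (simp add: power_mult_distrib)
      have \<rho>2': "0 < \<rho>\<^sup>2" using \<rho>(1) by simp
      have inK1: "y \<in> K1" if "dist y x1 \<le> \<rho>" for y
      proof -
        have "dist y x \<le> dist y x1 + dist x1 x" by (rule dist_triangle)
        then have "y \<in> cball x R" using that M(2) sqt m \<rho>d \<rho>(1) by (simp add: dist_commute)
        then show ?thesis using KK1 x by blast
      qed
      have x1K: "x1 \<in> K1" using inK1[of x1] \<rho> by simp
      define e where "e = E * \<rho> powr (N + 2 - p * q)"
      define dd where "dd = D * \<rho> powr (- \<beta>)"
      have "u x1 t1' \<le> C * (\<kappa> * A + (\<kappa> * A) powr (1 - q) * e * \<rho> powr (- N - 2)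
          + \<rho>\<^sup>2 * ((2 powr p * A) powr lam * \<rho> powr (N + 2 - \<alpha>) + dd) * (2 powr p * A) powr \<sigma>)"
      proof (rule C(2)[OF \<rho>(1)])
        show "4 * \<rho>\<^sup>2 < t1'" using \<rho>2 \<rho>2' M(3) t by linarith
        show "t1' < T" using M tt by simp
        have "cball x1 \<rho> \<subseteq> cball x1 R" using \<rho>m by (intro subset_cball) simp
        then show "cball x1 \<rho> \<subseteq> \<Omega>" using K1\<Omega> x1K by blast
        show "0 < \<kappa> * A" "0 < 2 powr p * A" "0 \<le> dd" "0 \<le> e" using \<kappa> A D E by (auto simp: dd_def e_def)
        show "\<forall>y s. dist y x1 \<le> 2 * \<rho> \<longrightarrow> t1' - 4 * \<rho>\<^sup>2 \<le> s \<longrightarrow> s \<le> t1' \<longrightarrow> u y s \<le> 2 powr p * A"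
          unfolding A_def using \<rho>2 \<rho>2' \<rho>d d by (intro allI impI M(6)) auto
        have "\<rho>\<^sup>2 < t1'" using \<rho>2 \<rho>2' M(3) t by linarith
        then show "cyl_integral {t1' - \<rho>\<^sup>2<..<t1'} (ball x1 \<rho>) (\<lambda>y s. uT y s powr q) \<le> ennreal e"
          unfolding e_def N_def using mean x1K \<rho>m \<rho>(1) M(4) tt(1) by auto
        show "\<forall>y s. dist y x1 < \<rho> \<longrightarrow> t1' - \<rho>\<^sup>2 < s \<longrightarrow> s < t1' \<longrightarrow> far y s \<rho> \<le> ennreal dd"
        proof (intro allI impI)
          fix y s assume ys: "dist y x1 < \<rho>" "t1' - \<rho>\<^sup>2 < s" "s < t1'"
          have "\<rho>\<^sup>2 < s" using \<rho>2 \<rho>2' M(3) t ys by linarith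
          moreover have "y \<in> K1" using ys by (intro inK1) simp
          ultimately show "far y s \<rho> \<le> ennreal dd"
            unfolding dd_def using farb \<rho>m \<rho>(1) M(4) tt(1) ys by auto
        qed
      qed
      then have main: "A \<le> C * (\<kappa> * A) + C * ((\<kappa> * A) powr (1 - q) * e * \<rho> powr (- N - 2))
          + C * (\<rho>\<^sup>2 * ((2 powr p * A) powr lam * \<rho> powr (N + 2 - \<alpha>) + dd) * (2 powr p * A) powr \<sigma>)"
        by (simp add: A_def[symmetric] distrib_left)
      have T1: "C * (\<kappa> * A) = A / 4" using C by (simp add: \<kappa>_def)
      have T2: "C * ((\<kappa> * A) powr (1 - q) * e * \<rho> powr (- N - 2)) = A / 4"
      proof -
        have "\<rho> powr (N + 2 - p * q) * \<rho> powr (- N - 2) = \<rho> powr (- (p * q))"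
          using \<rho>(1) by (simp add: powr_add[symmetric])
        also have "\<dots> = 1 / (\<rho> powr p) powr q" by (simp add: powr_powr powr_minus_divide)
        also have "\<dots> = A powr q / (C' * E)" using A b by (simp add: \<rho>(2) powr_divide)
        finally have r: "\<rho> powr (N + 2 - p * q) * \<rho> powr (- N - 2) = A powr q / (C' * E)" .
        have "A powr (1 - q) * A powr q = A" using A by (simp add: powr_add[symmetric])
        moreover have "(\<kappa> * A) powr (1 - q) = \<kappa> powr (1 - q) * A powr (1 - q)" using \<kappa> A by (simp add: powr_mult)
        moreover have "C * ((\<kappa> * A) powr (1 - q) * e * \<rho> powr (- N - 2))
            = C * (\<kappa> * A) powr (1 - q) * E * (\<rho> powr (N + 2 - p * q) * \<rho> powr (- N - 2))"
          by (simp add: e_def)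
        ultimately have "C * ((\<kappa> * A) powr (1 - q) * e * \<rho> powr (- N - 2)) = C * \<kappa> powr (1 - q) * A / C'"
          unfolding r using E by (simp add: mult_ac)
        also have "\<dots> = A / 4" using C \<kappa> by (simp add: C'_def)
        finally show ?thesis .
      qed
      have T3: "C * (\<rho>\<^sup>2 * ((2 powr p * A) powr lam * \<rho> powr (N + 2 - \<alpha>) + dd) * (2 powr p * A) powr \<sigma>) < A / 2"
      proof -
        have AA: "2 powr p * A = B * \<rho> powr (- p)" using A b \<rho> by (simp add: B_def powr_minus)
        have Bp: "(2 powr p * A) powr a = B powr a * \<rho> powr (- p * a)" for a
          unfolding AA using B by (simp add: powr_mult powr_powr)
        have r2: "\<rho>\<^sup>2 = \<rho> powr 2" using \<rho>(1) by simp
        have "C * (\<rho>\<^sup>2 * ((2 powr p * A) powr lam * \<rho> powr (N + 2 - \<alpha>) + dd) * (2 powr p * A) powr \<sigma>)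
          = C * (B powr lam * B powr \<sigma> * (\<rho> powr 2 * \<rho> powr (- p * lam) * \<rho> powr (N + 2 - \<alpha>) * \<rho> powr (- p * \<sigma>))
             + D * B powr \<sigma> * (\<rho> powr 2 * \<rho> powr (- \<beta>) * \<rho> powr (- p * \<sigma>)))"
          unfolding Bp dd_def r2 by (simp only: distrib_left distrib_right mult_ac)
        also have "\<rho> powr 2 * \<rho> powr (- p * lam) * \<rho> powr (N + 2 - \<alpha>) * \<rho> powr (- p * \<sigma>) = \<rho> powr e2 * \<rho> powr (- p)"
          unfolding powr_add[symmetric] by (simp add: e2_def algebra_simps)
        also have "\<rho> powr 2 * \<rho> powr (- \<beta>) * \<rho> powr (- p * \<sigma>) = \<rho> powr e1 * \<rho> powr (- p)"
          unfolding powr_add[symmetric] by (simp add: e1_def algebra_simps)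
        also have "C * (B powr lam * B powr \<sigma> * (\<rho> powr e2 * \<rho> powr (- p)) + D * B powr \<sigma> * (\<rho> powr e1 * \<rho> powr (- p)))
            = h \<rho> * \<rho> powr (- p)"
          by (simp add: h_def algebra_simps)
        also have "\<dots> < b / 2 * \<rho> powr (- p)" using \<rho>0(2)[OF \<rho>(1) \<rho>m(3)] \<rho>(1) by (intro mult_strict_right_mono) auto
        also have "\<dots> = A / 2" using A b \<rho> by (simp add: powr_minus)
        finally show ?thesis .
      qed
      show False using main T1 T2 T3 by linarith
    qed
    then show "\<exists>t2>0. \<forall>x\<in>K. \<forall>t. 0 < t \<longrightarrow> t < t2 \<longrightarrow> u x t powr q * t powr (p * q / 2) \<le> C0 * E"
      using t2 by blast
  qed
qed

section \<open>Bounds for the far part\<close>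

text \<open>Outside the cylinder Phi^(alpha/n) is O(rho^(-alpha)) and the integral of u^lam remains.
  This exponent is good enough when lam >= (n+2)/n, but in general too weak below that
  value.\<close>

lemma far_bound_global:
  obtains C :: real where "0 < C"
    "\<And>x t \<rho>. 0 < \<rho> \<Longrightarrow> far x t \<rho> \<le> ennreal (C * \<rho> powr (- \<alpha>)) * (\<integral>\<^sup>+s. (\<integral>\<^sup>+y. ennreal (uT y s powr lam) \<partial>lborel) \<partial>lborel)"
proof -
  define N where "N = real DIM('a)"
  have N: "0 < N" by (simp add: N_def)
  obtain Ck where Ck: "0 < Ck"
    "\<And>(x::'a) t \<rho>. 0 < \<rho> \<Longrightarrow> \<rho> \<le> norm x \<or> \<rho>\<^sup>2 \<le> t \<Longrightarrow> heat_kernel x t \<le> Ck * \<rho> powr (- N)"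
    using heat_kernel_off_diagonal[where ?'a = 'a] unfolding N_def by metis
  show ?thesis
  proof (rule that[of "Ck powr (\<alpha> / N)"])
    show "0 < Ck powr (\<alpha> / N)" using Ck by simp
    fix x :: 'a and t \<rho> :: real assume \<rho>: "0 < \<rho>"
    define c where "c = ennreal (Ck powr (\<alpha> / N) * \<rho> powr (- \<alpha>))"
    have "far x t \<rho> \<le> (\<integral>\<^sup>+s. (\<integral>\<^sup>+y. c * ennreal (uT y s powr lam) \<partial>lborel) \<partial>lborel)"
      unfolding far_def
    proof (intro nn_integral_mono)
      fix s y
      show "ennreal (heat_kernel (x - y) (t - s) powr (\<alpha> / real DIM('a)) * uT y s powr lam) * (if t - \<rho>\<^sup>2 < s \<and> dist x y < \<rho> then 0 else 1)
        \<le> c * ennreal (uT y s powr lam)"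
      proof (cases "t - \<rho>\<^sup>2 < s \<and> dist x y < \<rho>")
        case False
        then have "heat_kernel (x - y) (t - s) \<le> Ck * \<rho> powr (- N)" using \<rho> by (intro Ck) (auto simp: dist_norm)
        then have "heat_kernel (x - y) (t - s) powr (\<alpha> / N) \<le> (Ck * \<rho> powr (- N)) powr (\<alpha> / N)"
          using alpha N by (intro powr_mono2) auto
        also have "\<dots> = Ck powr (\<alpha> / N) * \<rho> powr (- \<alpha>)" using Ck N by (simp add: powr_mult powr_powr)
        finally show ?thesis using False
          by (simp add: c_def N_def ennreal_mult[symmetric] ennreal_leI mult_right_mono)
      qed simp
    qed
    also have "\<dots> = c * (\<integral>\<^sup>+s. (\<integral>\<^sup>+y. ennreal (uT y s powr lam) \<partial>lborel) \<partial>lborel)"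
      by (simp add: nn_integral_cmult)
    finally show "far x t \<rho> \<le> ennreal (Ck powr (\<alpha> / N) * \<rho> powr (- \<alpha>)) * (\<integral>\<^sup>+s. (\<integral>\<^sup>+y. ennreal (uT y s powr lam) \<partial>lborel) \<partial>lborel)"
      by (simp only: c_def)
  qed
qed

text \<open>Only the factor Phi^(beta/n) is estimated by its size outside the cylinder, which costs
  rho^(-beta) instead of rho^(-alpha); the factor Phi^(gamma/n) stays under the integral, to be
  handled by \<open>potential_bound\<close>. Beyond the fixed radius R the full power is bounded and
  the global integral of u^lam takes over.\<close>

lemma far_bound_local:
  assumes ab: "\<alpha> = \<beta> + \<gamma>" "0 \<le> \<beta>" "0 < \<gamma>" and R: "0 < R"
  obtains C :: real where "0 < C"
    "\<And>x t \<rho>. 0 < \<rho> \<Longrightarrow> far x t \<rho> \<le>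
      ennreal (C * \<rho> powr (- \<beta>)) * cyl_integral {0<..<t} (ball x R) (\<lambda>y s. heat_kernel (x - y) (t - s) powr (\<gamma> / real DIM('a)) * uT y s powr lam)
      + ennreal C * (\<integral>\<^sup>+s. (\<integral>\<^sup>+y. ennreal (uT y s powr lam) \<partial>lborel) \<partial>lborel)"
proof -
  define N where "N = real DIM('a)"
  have N: "0 < N" by (simp add: N_def)
  obtain Ck where Ck: "0 < Ck"
    "\<And>(x::'a) t \<rho>. 0 < \<rho> \<Longrightarrow> \<rho> \<le> norm x \<or> \<rho>\<^sup>2 \<le> t \<Longrightarrow> heat_kernel x t \<le> Ck * \<rho> powr (- N)"
    using heat_kernel_off_diagonal[where ?'a = 'a] unfolding N_def by metis
  define C where "C = Ck powr (\<beta> / N) + (Ck * R powr (- N)) powr (\<alpha> / N)"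
  have C: "0 < C" "Ck powr (\<beta> / N) \<le> C" "(Ck * R powr (- N)) powr (\<alpha> / N) \<le> C"
    using Ck(1) by (auto simp: C_def intro: add_pos_nonneg)
  show ?thesis
  proof (rule that[OF C(1)])
    fix x :: 'a and t \<rho> :: real assume \<rho>: "0 < \<rho>"
    define c where "c = ennreal (C * \<rho> powr (- \<beta>))"
    define g where "g y s = ennreal (heat_kernel (x - y) (t - s) powr (\<gamma> / N) * uT y s powr lam) * indicator (ball x R) y" for y s
    define G where "G s = (\<integral>\<^sup>+y. g y s \<partial>lborel)" for s
    define V where "V s = (\<integral>\<^sup>+y. ennreal (uT y s powr lam) \<partial>lborel)" for s
    have [measurable]: "G \<in> borel_measurable lborel" "V \<in> borel_measurable lborel" "\<And>s. (\<lambda>y. g y s) \<in> borel_measurable lborel"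
      unfolding G_def V_def g_def by measurable
    have "far x t \<rho> \<le> (\<integral>\<^sup>+s. c * (G s * indicator {0<..<t} s) + ennreal C * V s \<partial>lborel)"
      unfolding far_def
    proof (intro nn_integral_mono)
      fix s
      have "(\<integral>\<^sup>+y. ennreal (heat_kernel (x - y) (t - s) powr (\<alpha> / real DIM('a)) * uT y s powr lam) * (if t - \<rho>\<^sup>2 < s \<and> dist x y < \<rho> then 0 else 1) \<partial>lborel)
        \<le> (\<integral>\<^sup>+y. (c * indicator {0<..<t} s) * g y s + ennreal C * ennreal (uT y s powr lam) \<partial>lborel)"
      proof (intro nn_integral_mono)
        fix y
        define k where "k = heat_kernel (x - y) (t - s)"
        define w where "w = uT y s powr lam"
        have k0: "0 \<le> k" and w0: "0 \<le> w" by (auto simp: k_def w_def)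
        show "ennreal (heat_kernel (x - y) (t - s) powr (\<alpha> / real DIM('a)) * uT y s powr lam) * (if t - \<rho>\<^sup>2 < s \<and> dist x y < \<rho> then 0 else 1)
          \<le> (c * indicator {0<..<t} s) * g y s + ennreal C * ennreal (uT y s powr lam)"
        proof (cases "t - \<rho>\<^sup>2 < s \<and> dist x y < \<rho>")
          case far: False
          show ?thesis
          proof (cases "y \<in> ball x R")
            case y: True
            show ?thesis
            proof (cases "s \<in> {0<..<t}")
              case s: True
              have "k \<le> Ck * \<rho> powr (- N)" unfolding k_def using \<rho> far by (intro Ck) (auto simp: dist_norm)
              then have "k powr (\<beta> / N) \<le> (Ck * \<rho> powr (- N)) powr (\<beta> / N)"
                using ab N k0 by (intro powr_mono2) auto
              also have "\<dots> = Ck powr (\<beta> / N) * \<rho> powr (- \<beta>)" using Ck N by (simp add: powr_mult powr_powr)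
              also have "\<dots> \<le> C * \<rho> powr (- \<beta>)" using C by (intro mult_right_mono) auto
              finally have "k powr (\<beta> / N) * (k powr (\<gamma> / N) * w) \<le> C * \<rho> powr (- \<beta>) * (k powr (\<gamma> / N) * w)"
                using w0 by (intro mult_right_mono) auto
              moreover have "k powr (\<alpha> / N) = k powr (\<beta> / N) * k powr (\<gamma> / N)"
                by (simp add: ab(1) add_divide_distrib powr_add)
              ultimately have "ennreal (k powr (\<alpha> / N) * w) \<le> ennreal (C * \<rho> powr (- \<beta>) * (k powr (\<gamma> / N) * w))"
                by (intro ennreal_leI) (simp add: mult.assoc)
              also have "\<dots> = c * g y s" using C(1) y w0
                unfolding c_def g_def k_def[symmetric] w_def[symmetric] by (subst ennreal_mult) auto
              also have "\<dots> \<le> (c * indicator {0<..<t} s) * g y s + ennreal C * ennreal (uT y s powr lam)"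
                using s by simp
              finally show ?thesis using far by (simp add: k_def w_def N_def)
            next
              case False
              then have "heat_kernel (x - y) (t - s) powr (\<alpha> / real DIM('a)) * uT y s powr lam = 0"
                by (auto simp: heat_kernel_def uT_def)
              then show ?thesis by (simp only: ennreal_0 mult_zero_left zero_le)
            qed
          next
            case False
            then have "k \<le> Ck * R powr (- N)" unfolding k_def using R by (intro Ck) (auto simp: dist_norm)
            then have "k powr (\<alpha> / N) \<le> (Ck * R powr (- N)) powr (\<alpha> / N)"
              using alpha N k0 by (intro powr_mono2) auto
            also have "\<dots> \<le> C" by (rule C)
            finally have "ennreal (k powr (\<alpha> / N) * w) \<le> ennreal (C * w)" using w0 by (intro ennreal_leI mult_right_mono) auto
            also have "\<dots> = ennreal C * ennreal w" using C w0 by (intro ennreal_mult) auto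
            finally show ?thesis using far False by (simp add: k_def w_def N_def g_def)
          qed
        qed simp
      qed
      also have "\<dots> = c * (G s * indicator {0<..<t} s) + ennreal C * V s"
        unfolding G_def V_def by (simp add: nn_integral_add nn_integral_cmult) (simp add: mult_ac)
      finally show "(\<integral>\<^sup>+y. ennreal (heat_kernel (x - y) (t - s) powr (\<alpha> / real DIM('a)) * uT y s powr lam) * (if t - \<rho>\<^sup>2 < s \<and> dist x y < \<rho> then 0 else 1) \<partial>lborel)
        \<le> c * (G s * indicator {0<..<t} s) + ennreal C * V s" .
    qed
    also have "\<dots> = c * (\<integral>\<^sup>+s\<in>{0<..<t}. G s \<partial>lborel) + ennreal C * (\<integral>\<^sup>+s. V s \<partial>lborel)"
      by (simp add: nn_integral_add nn_integral_cmult)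
    finally show "far x t \<rho> \<le>
      ennreal (C * \<rho> powr (- \<beta>)) * cyl_integral {0<..<t} (ball x R) (\<lambda>y s. heat_kernel (x - y) (t - s) powr (\<gamma> / real DIM('a)) * uT y s powr lam)
      + ennreal C * (\<integral>\<^sup>+s. (\<integral>\<^sup>+y. ennreal (uT y s powr lam) \<partial>lborel) \<partial>lborel)"
      by (simp add: c_def G_def V_def g_def N_def)
  qed
qed

end

section \<open>The two ranges of the exponent\<close>

text \<open>Continuity from above of the measure with density \<open>g\<close>. Applied to the
  spatial integrals of u^lam, it is the origin of the little-o.\<close>

lemma set_nn_integral_small_interval:
  fixes g :: "real \<Rightarrow> ennreal"
  assumes [measurable]: "g \<in> borel_measurable lborel" and fin: "(\<integral>\<^sup>+s. g s \<partial>lborel) < \<infinity>" and \<epsilon>: "0 < \<epsilon>"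
  obtains h :: real where "0 < h" "(\<integral>\<^sup>+s\<in>{0<..<h}. g s \<partial>lborel) \<le> ennreal \<epsilon>"
proof -
  define M where "M = density lborel g"
  define A where "A k = {0<..<1 / real (Suc k)}" for k
  have em: "emeasure M (A k) = (\<integral>\<^sup>+s\<in>A k. g s \<partial>lborel)" for k
    unfolding M_def A_def by (rule emeasure_density) auto
  have "(\<lambda>k. emeasure M (A k)) \<longlonglongrightarrow> emeasure M (\<Inter>k. A k)"
  proof (rule Lim_emeasure_decseq)
    show "range A \<subseteq> sets M" by (auto simp: A_def M_def)
    show "decseq A"
    proof (intro decseq_SucI)
      fix k
      have "1 / real (Suc (Suc k)) \<le> 1 / real (Suc k)" by (intro divide_left_mono) auto
      then show "A (Suc k) \<subseteq> A k" by (auto simp: A_def)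
    qed
    fix k
    have "emeasure M (A k) \<le> (\<integral>\<^sup>+s. g s \<partial>lborel)"
      unfolding em by (intro nn_integral_mono) (auto simp: indicator_def)
    then show "emeasure M (A k) \<noteq> \<infinity>" using fin by (auto simp: top_unique)
  qed
  moreover have "(\<Inter>k. A k) = {}"
  proof (rule ccontr)
    assume "(\<Inter>k. A k) \<noteq> {}"
    then obtain s where s: "\<And>k. s \<in> A k" by blast
    have "0 < s" using s[of 0] by (simp add: A_def)
    then obtain k where "1 / real (Suc k) < s" using nat_approx_posE by blast
    then show False using s[of k] by (simp add: A_def)
  qed
  ultimately have "(\<lambda>k. emeasure M (A k)) \<longlonglongrightarrow> 0" by simp
  then have "\<forall>\<^sub>F k in sequentially. emeasure M (A k) < ennreal \<epsilon>"
    using \<epsilon> by (intro order_tendstoD(2)) auto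
  then obtain k where "emeasure M (A k) < ennreal \<epsilon>" by (auto simp: eventually_sequentially)
  then have "(\<integral>\<^sup>+s\<in>A k. g s \<partial>lborel) \<le> ennreal \<epsilon>" unfolding em by (rule less_imp_le)
  then show ?thesis unfolding A_def by (rule that[rotated]) simp
qed

context supersolution
begin

lemma nonlocal_integral_iterated:
  "(\<integral>\<^sup>+z. ennreal (indicator (UNIV \<times> {0<..<T}) z * heat_kernel (x - fst z) (t - snd z) powr a * u (fst z) (snd z) powr l) \<partial>lborel)
    = (\<integral>\<^sup>+s. (\<integral>\<^sup>+y. ennreal (heat_kernel (x - y) (t - s) powr a * uT y s powr l) \<partial>lborel) \<partial>lborel)"
proof -
  have "(\<integral>\<^sup>+z. ennreal (indicator (UNIV \<times> {0<..<T}) z * heat_kernel (x - fst z) (t - snd z) powr a * u (fst z) (snd z) powr l) \<partial>lborel)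
    = (\<integral>\<^sup>+z. ennreal (heat_kernel (x - fst z) (t - snd z) powr a * uT (fst z) (snd z) powr l) \<partial>(lborel \<Otimes>\<^sub>M lborel))"
    unfolding lborel_prod by (intro nn_integral_cong) (auto simp: indicator_def uT_def mem_Times_iff)
  also have "\<dots> = (\<integral>\<^sup>+s. (\<integral>\<^sup>+y. ennreal (heat_kernel (x - y) (t - s) powr a * uT y s powr l) \<partial>lborel) \<partial>lborel)"
    by (subst lborel_pair.nn_integral_snd[symmetric]) auto
  finally show ?thesis .
qed

lemma power_integral_finite:
  assumes "set_integrable lborel (UNIV \<times> {0<..<T}) (\<lambda>(x, t). \<bar>u x t\<bar> powr l)"
  shows "(\<integral>\<^sup>+s. (\<integral>\<^sup>+y. ennreal (uT y s powr l) \<partial>lborel) \<partial>lborel) < \<infinity>"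
proof -
  have "(\<integral>\<^sup>+s. (\<integral>\<^sup>+y. ennreal (uT y s powr l) \<partial>lborel) \<partial>lborel)
     = (\<integral>\<^sup>+z. ennreal (uT (fst z) (snd z) powr l) \<partial>(lborel \<Otimes>\<^sub>M lborel))"
    by (subst lborel_pair.nn_integral_snd[symmetric]) auto
  also have "\<dots> = (\<integral>\<^sup>+z. ennreal (norm (indicator (UNIV \<times> {0<..<T}) z *\<^sub>R (case z of (x, t) \<Rightarrow> \<bar>u x t\<bar> powr l))) \<partial>lborel)"
    unfolding lborel_prod using u_nonneg
    by (intro nn_integral_cong) (auto simp: indicator_def uT_def mem_Times_iff split: prod.splits)
  also have "\<dots> < \<infinity>" using assms unfolding set_integrable_def integrable_iff_bounded by blast
  finally show ?thesis .
qed

end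

lemma compact_thickening:
  fixes K \<Omega> :: "'a::euclidean_space set"
  assumes "compact K" "K \<subseteq> \<Omega>" "open \<Omega>"
  obtains R K1 where "0 < R" "compact K1" "\<forall>x\<in>K. cball x R \<subseteq> K1" "\<And>x. x \<in> K1 \<Longrightarrow> cball x (4 * R) \<subseteq> \<Omega>"
proof -
  obtain e where e: "0 < e" "(\<Union>x\<in>K. cball x e) \<subseteq> \<Omega>"
    using compact_subset_open_imp_cball_epsilon_subset[OF assms(1,3,2)] by blast
  \<comment> \<open>One R for the thickening and 4 R for the balls around points of
    \<open>K1\<close> must together fit into e.\<close>
  define R where "R = e / 5"
  define K1 where "K1 = {x + y |x y. x \<in> K \<and> y \<in> cball 0 R}"
  show ?thesis
  proof (rule that[of R K1])
    show "0 < R" using e by (simp add: R_def)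
    show "compact K1" unfolding K1_def by (intro compact_sums assms compact_cball)
    show "\<forall>x\<in>K. cball x R \<subseteq> K1"
    proof (intro ballI subsetI)
      fix x y assume "x \<in> K" "y \<in> cball x R"
      moreover have "y = x + (y - x)" by simp
      ultimately show "y \<in> K1" unfolding K1_def by (fastforce simp: dist_norm norm_minus_commute)
    qed
    fix z assume "z \<in> K1"
    then obtain x y where xy: "z = x + y" "x \<in> K" "norm y \<le> R" by (auto simp: K1_def)
    have "cball z (4 * R) \<subseteq> cball x e"
    proof
      fix w assume "w \<in> cball z (4 * R)"
      moreover have "dist x w \<le> dist x z + dist z w" by (rule dist_triangle)
      moreover have "dist x z \<le> R" using xy by (simp add: dist_norm)
      ultimately show "w \<in> cball x e" by (simp add: R_def)
    qed
    then show "cball z (4 * R) \<subseteq> \<Omega>" using e xy by blast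
  qed
qed

context nonlocal_supersolution
begin

text \<open>\<open>rate_bound\<close> is used with p = n and q = 1: the mass bound m on every time
  slice integrates over the time span rho^2 to m rho^2, which is m rho^(n+2-pq).\<close>

lemma subcritical_rate:
  assumes sub: "lam < (real DIM('a) + 2) / real DIM('a)" and \<sigma>: "\<sigma> < g_alpha DIM('a) \<alpha> lam"
    and Om: "open \<Omega>" and K: "compact K" "K \<subseteq> \<Omega>" and T: "0 < T"
    and L: "(\<integral>\<^sup>+s. (\<integral>\<^sup>+y. ennreal (uT y s powr lam) \<partial>lborel) \<partial>lborel) < \<infinity>"
  shows "\<exists>C. \<exists>t2>0. \<forall>x\<in>K. \<forall>t. 0 < t \<longrightarrow> t < t2 \<longrightarrow> u x t \<le> C * t powr (- real DIM('a) / 2)"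
proof -
  define N where "N = real DIM('a)"
  have N: "0 < N" by (simp add: N_def)
  have lamN: "N * lam < N + 2" using sub N by (simp add: N_def field_simps)
  \<comment> \<open>Both inequalities hold in either branch: below lam = (n+2-alpha)/n the first
    implies the second, and above it the second implies the first.\<close>
  have \<sigma>1: "N * \<sigma> < N + 2" and \<sigma>2: "N * \<sigma> + N * lam < 2 * (N + 2) - \<alpha>"
  proof -
    have "\<sigma> < (N + 2) / N \<and> \<sigma> + lam < (2 * (N + 2) - \<alpha>) / N"
    proof (cases "lam < (N + 2 - \<alpha>) / N")
      case True
      then have 1: "\<sigma> < (N + 2) / N" using \<sigma> by (simp add: g_alpha_def N_def)
      have "\<sigma> + lam < (N + 2) / N + (N + 2 - \<alpha>) / N" using 1 True by simp
      also have "\<dots> = (2 * (N + 2) - \<alpha>) / N" by (simp add: add_divide_distrib[symmetric])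
      finally show ?thesis using 1 by simp
    next
      case False
      then have 1: "\<sigma> < (2 * (N + 2) - \<alpha>) / N - lam" using \<sigma> sub by (simp add: g_alpha_def N_def)
      also have "\<dots> \<le> (2 * (N + 2) - \<alpha>) / N - (N + 2 - \<alpha>) / N" using False by simp
      also have "\<dots> = (N + 2) / N" by (simp add: diff_divide_distrib[symmetric])
      finally show ?thesis using 1 by simp
    qed
    then show "N * \<sigma> < N + 2" "N * \<sigma> + N * lam < 2 * (N + 2) - \<alpha>"
      using N by (simp_all add: field_simps)
  qed
  \<comment> \<open>gamma must exceed alpha - (n + 2 - n sigma), to make 2 - beta + (1 - sigma) n
    positive, and must stay below n + 2 - n lam, for \<open>potential_bound\<close>; also 0 < gamma
    < alpha. The two inequalities for \<open>\<sigma>\<close>, together with lam < (n+2)/n, say that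
    this interval is nonempty; its midpoint is taken.\<close>
  define lo where "lo = max 0 (\<alpha> - (N + 2 - N * \<sigma>))"
  define hi where "hi = min \<alpha> (N + 2 - N * lam)"
  define \<gamma> where "\<gamma> = (lo + hi) / 2"
  define \<beta> where "\<beta> = \<alpha> - \<gamma>"
  have \<gamma>: "0 < \<gamma>" "\<gamma> < \<alpha>" "\<gamma> + N * lam < N + 2" "\<alpha> - \<gamma> < N + 2 - N * \<sigma>"
  proof -
    have "lo < hi" unfolding lo_def hi_def using \<sigma>1 \<sigma>2 lamN alpha by simp
    then have "lo < \<gamma>" "\<gamma> < hi" by (auto simp: \<gamma>_def)
    then show "0 < \<gamma>" "\<gamma> < \<alpha>" "\<gamma> + N * lam < N + 2" "\<alpha> - \<gamma> < N + 2 - N * \<sigma>"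
      by (auto simp: lo_def hi_def)
  qed
  have \<beta>: "\<alpha> = \<beta> + \<gamma>" "0 \<le> \<beta>" using \<gamma> by (auto simp: \<beta>_def)
  obtain R K1 where R: "0 < R" and K1: "compact K1" "\<forall>x\<in>K. cball x R \<subseteq> K1"
    "\<And>x. x \<in> K1 \<Longrightarrow> cball x (4 * R) \<subseteq> \<Omega>"
    using compact_thickening[OF K Om] by blast
  have sm: "cball x r \<subseteq> \<Omega>" if "x \<in> K1" "r \<le> 4 * R" for x r
  proof -
    have "cball x r \<subseteq> cball x (4 * R)" using that by (intro subset_cball)
    then show ?thesis using K1(3)[OF that(1)] by blast
  qed
  have sm2: "cball x (2 * R) \<subseteq> \<Omega>" if "x \<in> K1" for x using sm[OF that] R by simp
  have T': "0 < T / 2" "T / 2 < T" using T by auto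
  obtain m where m: "0 < m"
    "\<And>x s. x \<in> K1 \<Longrightarrow> 0 < s \<Longrightarrow> s < T / 2 \<Longrightarrow> (\<integral>\<^sup>+y\<in>ball x R. ennreal (uT y s) \<partial>lborel) \<le> ennreal m"
    by (rule mass_bound[OF K1(1) R sm2 T']) (assumption, rule that)
  obtain P where P: "0 < P"
    "\<And>x t. x \<in> K1 \<Longrightarrow> 0 < t \<Longrightarrow> t < T / 2 \<Longrightarrow>
      cyl_integral {0<..<t} (ball x R) (\<lambda>y s. heat_kernel (x - y) (t - s) powr (\<gamma> / N) * uT y s powr lam)
        \<le> ennreal P"
    using potential_bound[OF K1(1) R K1(3) T' lam \<gamma>(1) \<gamma>(3)[unfolded N_def]] unfolding N_def by blast
  obtain Cf where Cf: "0 < Cf"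
    "\<And>x t \<rho>. 0 < \<rho> \<Longrightarrow> far x t \<rho> \<le>
      ennreal (Cf * \<rho> powr (- \<beta>)) * cyl_integral {0<..<t} (ball x R) (\<lambda>y s. heat_kernel (x - y) (t - s) powr (\<gamma> / N) * uT y s powr lam)
      + ennreal Cf * (\<integral>\<^sup>+s. (\<integral>\<^sup>+y. ennreal (uT y s powr lam) \<partial>lborel) \<partial>lborel)"
    by (rule far_bound_local[OF \<beta> \<gamma>(1) R, folded N_def]) (rule that)
  define l where "l = enn2real (\<integral>\<^sup>+s. (\<integral>\<^sup>+y. ennreal (uT y s powr lam) \<partial>lborel) \<partial>lborel)"
  have l: "(\<integral>\<^sup>+s. (\<integral>\<^sup>+y. ennreal (uT y s powr lam) \<partial>lborel) \<partial>lborel) = ennreal l" "0 \<le> l"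
    using L by (auto simp: l_def)
  define D where "D = Cf * P + Cf * l"
  have D: "0 \<le> D" using Cf P l by (simp add: D_def)
  obtain C0 where C0: "0 < C0"
    "\<And>E D \<beta> t1 K K1 R. 0 < E \<Longrightarrow> 0 \<le> D \<Longrightarrow> 0 < 2 - \<beta> + (1 - \<sigma>) * N \<Longrightarrow>
      0 < 2 + (N + 2 - \<alpha>) + (1 - \<sigma> - lam) * N \<Longrightarrow> 0 < R \<Longrightarrow> 0 < t1 \<Longrightarrow> t1 \<le> T \<Longrightarrow>
      (\<forall>x\<in>K. cball x R \<subseteq> K1) \<Longrightarrow> (\<forall>x\<in>K1. cball x R \<subseteq> \<Omega>) \<Longrightarrow>
      (\<forall>x\<in>K1. \<forall>t \<rho>. 0 < \<rho> \<longrightarrow> \<rho> < R \<longrightarrow> \<rho> < 1 \<longrightarrow> \<rho>\<^sup>2 < t \<longrightarrow> t < t1 \<longrightarrow>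
        cyl_integral {t - \<rho>\<^sup>2<..<t} (ball x \<rho>) (\<lambda>y s. uT y s powr 1)
          \<le> ennreal (E * \<rho> powr (N + 2 - N * 1))) \<Longrightarrow>
      (\<forall>x\<in>K1. \<forall>t \<rho>. 0 < \<rho> \<longrightarrow> \<rho> < R \<longrightarrow> \<rho> < 1 \<longrightarrow> \<rho>\<^sup>2 < t \<longrightarrow> t < t1 \<longrightarrow>
        far x t \<rho> \<le> ennreal (D * \<rho> powr (- \<beta>))) \<Longrightarrow>
      \<exists>t2>0. \<forall>x\<in>K. \<forall>t. 0 < t \<longrightarrow> t < t2 \<longrightarrow> u x t powr 1 * t powr (N * 1 / 2) \<le> C0 * E"
    by (rule rate_bound[OF N order_refl, folded N_def]) (rule that)
  have "\<exists>t2>0. \<forall>x\<in>K. \<forall>t. 0 < t \<longrightarrow> t < t2 \<longrightarrow> u x t powr 1 * t powr (N * 1 / 2) \<le> C0 * m"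
  proof (rule C0(2)[OF m(1) D _ _ R, where ?t1.0 = "T / 2" and \<beta> = \<beta> and K = K and ?K1.0 = K1])
    show "0 < 2 - \<beta> + (1 - \<sigma>) * N" "0 < 2 + (N + 2 - \<alpha>) + (1 - \<sigma> - lam) * N"
      using \<gamma> \<sigma>2 by (auto simp: \<beta>_def algebra_simps)
    show "\<forall>x\<in>K1. cball x R \<subseteq> \<Omega>" using sm R by auto
    show "\<forall>x\<in>K1. \<forall>t \<rho>. 0 < \<rho> \<longrightarrow> \<rho> < R \<longrightarrow> \<rho> < 1 \<longrightarrow> \<rho>\<^sup>2 < t \<longrightarrow> t < T / 2 \<longrightarrow>
        cyl_integral {t - \<rho>\<^sup>2<..<t} (ball x \<rho>) (\<lambda>y s. uT y s powr 1)
          \<le> ennreal (m * \<rho> powr (N + 2 - N * 1))"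
    proof (intro ballI allI impI)
      fix x t \<rho> assume x: "x \<in> K1" and \<rho>: "0 < \<rho>" "\<rho> < R" "\<rho> < 1" "\<rho>\<^sup>2 < t" "t < T / 2"
      have "cyl_integral {t - \<rho>\<^sup>2<..<t} (ball x \<rho>) (\<lambda>y s. uT y s powr 1)
        \<le> (\<integral>\<^sup>+s. ennreal m * indicator {t - \<rho>\<^sup>2<..<t} s \<partial>lborel)"
      proof (intro nn_integral_mono)
        fix s
        have "(\<integral>\<^sup>+y\<in>ball x \<rho>. ennreal (uT y s powr 1) \<partial>lborel) \<le> ennreal m" if "s \<in> {t - \<rho>\<^sup>2<..<t}"
        proof -
          have "(\<integral>\<^sup>+y\<in>ball x \<rho>. ennreal (uT y s powr 1) \<partial>lborel) \<le> (\<integral>\<^sup>+y\<in>ball x R. ennreal (uT y s) \<partial>lborel)"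
            using \<rho> by (intro nn_integral_mono) (auto simp: indicator_def)
          also have "\<dots> \<le> ennreal m" using x \<rho> that by (intro m) auto
          finally show ?thesis .
        qed
        then show "(\<integral>\<^sup>+y\<in>ball x \<rho>. ennreal (uT y s powr 1) \<partial>lborel) * indicator {t - \<rho>\<^sup>2<..<t} s \<le> ennreal m * indicator {t - \<rho>\<^sup>2<..<t} s"
          by (auto simp: indicator_def)
      qed
      also have "\<dots> = ennreal (m * \<rho>\<^sup>2)"
        using m(1) by (subst nn_integral_cmult_indicator) (auto simp: ennreal_mult)
      finally show "cyl_integral {t - \<rho>\<^sup>2<..<t} (ball x \<rho>) (\<lambda>y s. uT y s powr 1)
          \<le> ennreal (m * \<rho> powr (N + 2 - N * 1))" using \<rho>(1) by simp
    qed
    show "\<forall>x\<in>K1. \<forall>t \<rho>. 0 < \<rho> \<longrightarrow> \<rho> < R \<longrightarrow> \<rho> < 1 \<longrightarrow> \<rho>\<^sup>2 < t \<longrightarrow> t < T / 2 \<longrightarrow>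
        far x t \<rho> \<le> ennreal (D * \<rho> powr (- \<beta>))"
    proof (intro ballI allI impI)
      fix x t \<rho> assume x: "x \<in> K1" and \<rho>: "0 < \<rho>" "\<rho> < R" "\<rho> < 1" "\<rho>\<^sup>2 < t" "t < T / 2"
      have "0 < \<rho>\<^sup>2" using \<rho>(1) by simp
      then have t0: "0 < t" using \<rho> by linarith
      have "far x t \<rho> \<le> ennreal (Cf * \<rho> powr (- \<beta>)) * ennreal P + ennreal Cf * ennreal l"
        using Cf(2)[OF \<rho>(1), of x t] P(2)[OF x t0 \<rho>(5)] unfolding l(1)
        by (elim order_trans) (intro add_mono mult_left_mono, auto)
      also have "\<dots> = ennreal (Cf * \<rho> powr (- \<beta>) * P + Cf * l)"
        using Cf(1) P(1) l(2) by (simp flip: ennreal_mult ennreal_plus)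
      also have "\<dots> \<le> ennreal (D * \<rho> powr (- \<beta>))"
      proof (rule ennreal_leI)
        \<comment> \<open>Since rho < 1 and beta >= 0, the contribution from outside the ball of
          radius R is absorbed into rho^(-beta).\<close>
        have "1 powr (- \<beta>) \<le> \<rho> powr (- \<beta>)" using \<rho> \<beta> by (intro powr_mono2') auto
        then have "Cf * l * 1 \<le> Cf * l * \<rho> powr (- \<beta>)" using Cf(1) l(2) by (intro mult_left_mono) auto
        then show "Cf * \<rho> powr (- \<beta>) * P + Cf * l \<le> D * \<rho> powr (- \<beta>)" by (simp add: D_def algebra_simps)
      qed
      finally show "far x t \<rho> \<le> ennreal (D * \<rho> powr (- \<beta>))" .
    qed
  qed (use T' K1 in auto)
  then obtain t2 where t2: "0 < t2" "\<And>x t. x \<in> K \<Longrightarrow> 0 < t \<Longrightarrow> t < t2 \<Longrightarrow> u x t powr 1 * t powr (N * 1 / 2) \<le> C0 * m"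
    by blast
  have "u x t \<le> C0 * m * t powr (- N / 2)" if x: "x \<in> K" and t: "0 < t" "t < min t2 T" for x t
  proof -
    have "u x t * t powr (N / 2) \<le> C0 * m" using t2(2)[OF x t(1)] t u_nonneg[of t x] by simp
    then have "u x t * t powr (N / 2) * t powr (- N / 2) \<le> C0 * m * t powr (- N / 2)" by (intro mult_right_mono) auto
    moreover have "t powr (N / 2) * t powr (- N / 2) = 1" using t by (simp add: powr_add[symmetric])
    ultimately show ?thesis by (simp add: mult.assoc)
  qed
  moreover have "0 < min t2 T" using t2 T by simp
  ultimately show ?thesis unfolding N_def[symmetric] by blast
qed

text \<open>\<open>rate_bound\<close> is used with p = (n+2)/lam, q = lam and beta = alpha. Then n +
  2 - pq = 0, so the mean hypothesis only asks that u^lam have integral at most E over short initial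
  times, and because p lam = n + 2 the two exponent conditions coincide.\<close>

lemma supercritical_rate:
  assumes sup: "lam \<ge> (real DIM('a) + 2) / real DIM('a)" and \<sigma>: "\<sigma> < g_alpha DIM('a) \<alpha> lam"
    and Om: "open \<Omega>" and K: "compact K" "K \<subseteq> \<Omega>" and T: "0 < T"
    and L: "(\<integral>\<^sup>+s. (\<integral>\<^sup>+y. ennreal (uT y s powr lam) \<partial>lborel) \<partial>lborel) < \<infinity>"
    and \<epsilon>: "0 < \<epsilon>"
  shows "\<exists>t2>0. \<forall>x\<in>K. \<forall>t. 0 < t \<longrightarrow> t < t2 \<longrightarrow> u x t \<le> \<epsilon> * t powr (- (real DIM('a) + 2) / (2 * lam))"
proof -
  define N where "N = real DIM('a)"
  have N: "0 < N" by (simp add: N_def)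
  have "1 < (N + 2) / N" using N by simp
  then have lam1: "1 \<le> lam" using sup unfolding N_def by linarith
  \<comment> \<open>The last branch of \<open>g_alpha\<close> applies because alpha > 0, and
    \<open>0 \<le> \<sigma>\<close> rules out that the maximum there is 0.\<close>
  have \<sigma>': "\<sigma> < 1 - (\<alpha> - 2) / (N + 2) * lam"
  proof -
    have "(N + 2 - \<alpha>) / N < (N + 2) / N" using alpha N by (simp add: divide_strict_right_mono)
    then have "\<sigma> < max 0 (1 - (\<alpha> - 2) / (N + 2) * lam)"
      using \<sigma> sup by (simp add: g_alpha_def N_def split: if_splits)
    then show ?thesis using sigma by (simp add: max_def split: if_splits)
  qed
  define p where "p = (N + 2) / lam"
  have p: "0 < p" "p * lam = N + 2" using N lam by (auto simp: p_def)
  have ex: "0 < 2 - \<alpha> + (1 - \<sigma>) * p"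
  proof -
    have "(\<alpha> - 2) / (N + 2) * lam < 1 - \<sigma>" using \<sigma>' by simp
    then have "(\<alpha> - 2) / (N + 2) * lam * p < (1 - \<sigma>) * p" using p by (intro mult_strict_right_mono) auto
    moreover have "(\<alpha> - 2) / (N + 2) * lam * p = \<alpha> - 2"
    proof -
      have "(\<alpha> - 2) / (N + 2) * lam * p = (\<alpha> - 2) / (N + 2) * (p * lam)" by (simp only: mult_ac)
      then show ?thesis using p N by simp
    qed
    ultimately show ?thesis by simp
  qed
  obtain R K1 where R: "0 < R" and K1: "compact K1" "\<forall>x\<in>K. cball x R \<subseteq> K1"
    "\<And>x. x \<in> K1 \<Longrightarrow> cball x (4 * R) \<subseteq> \<Omega>"
    using compact_thickening[OF K Om] by blast
  obtain Cf where Cf: "0 < Cf"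
    "\<And>x t \<rho>. 0 < \<rho> \<Longrightarrow> far x t \<rho> \<le> ennreal (Cf * \<rho> powr (- \<alpha>)) * (\<integral>\<^sup>+s. (\<integral>\<^sup>+y. ennreal (uT y s powr lam) \<partial>lborel) \<partial>lborel)"
    by (rule far_bound_global) (rule that)
  define l where "l = enn2real (\<integral>\<^sup>+s. (\<integral>\<^sup>+y. ennreal (uT y s powr lam) \<partial>lborel) \<partial>lborel)"
  have l: "(\<integral>\<^sup>+s. (\<integral>\<^sup>+y. ennreal (uT y s powr lam) \<partial>lborel) \<partial>lborel) = ennreal l" "0 \<le> l"
    using L by (auto simp: l_def)
  obtain C0 where C0: "0 < C0"
    "\<And>E D \<beta> t1 K K1 R. 0 < E \<Longrightarrow> 0 \<le> D \<Longrightarrow> 0 < 2 - \<beta> + (1 - \<sigma>) * p \<Longrightarrow>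
      0 < 2 + (N + 2 - \<alpha>) + (1 - \<sigma> - lam) * p \<Longrightarrow> 0 < R \<Longrightarrow> 0 < t1 \<Longrightarrow> t1 \<le> T \<Longrightarrow>
      (\<forall>x\<in>K. cball x R \<subseteq> K1) \<Longrightarrow> (\<forall>x\<in>K1. cball x R \<subseteq> \<Omega>) \<Longrightarrow>
      (\<forall>x\<in>K1. \<forall>t \<rho>. 0 < \<rho> \<longrightarrow> \<rho> < R \<longrightarrow> \<rho> < 1 \<longrightarrow> \<rho>\<^sup>2 < t \<longrightarrow> t < t1 \<longrightarrow>
        cyl_integral {t - \<rho>\<^sup>2<..<t} (ball x \<rho>) (\<lambda>y s. uT y s powr lam)
          \<le> ennreal (E * \<rho> powr (N + 2 - p * lam))) \<Longrightarrow>
      (\<forall>x\<in>K1. \<forall>t \<rho>. 0 < \<rho> \<longrightarrow> \<rho> < R \<longrightarrow> \<rho> < 1 \<longrightarrow> \<rho>\<^sup>2 < t \<longrightarrow> t < t1 \<longrightarrow>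
        far x t \<rho> \<le> ennreal (D * \<rho> powr (- \<beta>))) \<Longrightarrow>
      \<exists>t2>0. \<forall>x\<in>K. \<forall>t. 0 < t \<longrightarrow> t < t2 \<longrightarrow> u x t powr lam * t powr (p * lam / 2) \<le> C0 * E"
    by (rule rate_bound[OF p(1) lam1, folded N_def]) (rule that)
  \<comment> \<open>Makes C0 E = epsilon^lam, so that taking the root of order lam at the end
    returns epsilon.\<close>
  define E where "E = \<epsilon> powr lam / C0"
  have E: "0 < E" using \<epsilon> C0 by (simp add: E_def)
  define G where "G s = (\<integral>\<^sup>+y. ennreal (uT y s powr lam) \<partial>lborel)" for s
  have Gm[measurable]: "G \<in> borel_measurable lborel" unfolding G_def by measurable
  obtain h where h: "0 < h" "(\<integral>\<^sup>+s\<in>{0<..<h}. G s \<partial>lborel) \<le> ennreal E"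
    using set_nn_integral_small_interval[OF Gm _ E] L unfolding G_def by blast
  have "\<exists>t2>0. \<forall>x\<in>K. \<forall>t. 0 < t \<longrightarrow> t < t2 \<longrightarrow> u x t powr lam * t powr (p * lam / 2) \<le> C0 * E"
  proof (rule C0(2)[OF E _ _ _ R, where ?t1.0 = "min h T" and \<beta> = \<alpha> and K = K and ?K1.0 = K1 and D = "Cf * l"])
    show "0 \<le> Cf * l" using Cf l by simp
    show "0 < 2 - \<alpha> + (1 - \<sigma>) * p" by (rule ex)
    show "0 < 2 + (N + 2 - \<alpha>) + (1 - \<sigma> - lam) * p" using ex p by (simp add: algebra_simps)
    show "\<forall>x\<in>K1. cball x R \<subseteq> \<Omega>"
    proof
      fix x assume "x \<in> K1"
      then have "cball x (4 * R) \<subseteq> \<Omega>" by (rule K1)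
      moreover have "cball x R \<subseteq> cball x (4 * R)" using R by (intro subset_cball) auto
      ultimately show "cball x R \<subseteq> \<Omega>" by blast
    qed
    show "\<forall>x\<in>K1. \<forall>t \<rho>. 0 < \<rho> \<longrightarrow> \<rho> < R \<longrightarrow> \<rho> < 1 \<longrightarrow> \<rho>\<^sup>2 < t \<longrightarrow> t < min h T \<longrightarrow>
        cyl_integral {t - \<rho>\<^sup>2<..<t} (ball x \<rho>) (\<lambda>y s. uT y s powr lam)
          \<le> ennreal (E * \<rho> powr (N + 2 - p * lam))"
    proof (intro ballI allI impI)
      fix x t \<rho> assume \<rho>: "0 < \<rho>" "\<rho>\<^sup>2 < t" "t < min h T"
      have "cyl_integral {t - \<rho>\<^sup>2<..<t} (ball x \<rho>) (\<lambda>y s. uT y s powr lam) \<le> (\<integral>\<^sup>+s\<in>{0<..<h}. G s \<partial>lborel)"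
      proof (intro nn_integral_mono)
        fix s
        have "(\<integral>\<^sup>+y\<in>ball x \<rho>. ennreal (uT y s powr lam) \<partial>lborel) \<le> G s"
          unfolding G_def by (intro nn_integral_mono) (auto simp: indicator_def)
        then show "(\<integral>\<^sup>+y\<in>ball x \<rho>. ennreal (uT y s powr lam) \<partial>lborel) * indicator {t - \<rho>\<^sup>2<..<t} s \<le> G s * indicator {0<..<h} s"
          using \<rho> by (auto simp: indicator_def)
      qed
      also have "\<dots> \<le> ennreal E" by (rule h)
      also have "ennreal E = ennreal (E * \<rho> powr (N + 2 - p * lam))" using p \<rho> by simp
      finally show "cyl_integral {t - \<rho>\<^sup>2<..<t} (ball x \<rho>) (\<lambda>y s. uT y s powr lam)
          \<le> ennreal (E * \<rho> powr (N + 2 - p * lam))" .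
    qed
    show "\<forall>x\<in>K1. \<forall>t \<rho>. 0 < \<rho> \<longrightarrow> \<rho> < R \<longrightarrow> \<rho> < 1 \<longrightarrow> \<rho>\<^sup>2 < t \<longrightarrow> t < min h T \<longrightarrow>
        far x t \<rho> \<le> ennreal (Cf * l * \<rho> powr (- \<alpha>))"
    proof (intro ballI allI impI)
      fix x t \<rho> assume \<rho>: "(0::real) < \<rho>"
      have "far x t \<rho> \<le> ennreal (Cf * \<rho> powr (- \<alpha>)) * ennreal l" using Cf(2)[OF \<rho>] unfolding l(1) .
      also have "\<dots> = ennreal (Cf * l * \<rho> powr (- \<alpha>))" using Cf(1) l(2) by (simp add: mult_ac flip: ennreal_mult)
      finally show "far x t \<rho> \<le> ennreal (Cf * l * \<rho> powr (- \<alpha>))" .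
    qed
  qed (use h T K1 in auto)
  then obtain t2 where t2: "0 < t2" "\<And>x t. x \<in> K \<Longrightarrow> 0 < t \<Longrightarrow> t < t2 \<Longrightarrow> u x t powr lam * t powr (p * lam / 2) \<le> C0 * E"
    by blast
  have "u x t \<le> \<epsilon> * t powr (- (N + 2) / (2 * lam))" if x: "x \<in> K" and t: "0 < t" "t < min t2 T" for x t
  proof -
    have u0: "0 \<le> u x t" using t by (intro u_nonneg) auto
    have "(u x t * t powr (p / 2)) powr lam = u x t powr lam * t powr (p * lam / 2)"
      using u0 t by (simp add: powr_mult powr_powr)
    also have "\<dots> \<le> C0 * E" using t2(2)[OF x t(1)] t by simp
    also have "\<dots> = \<epsilon> powr lam" using C0 by (simp add: E_def)
    finally have "u x t * t powr (p / 2) \<le> \<epsilon>"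
      using powr_less_mono2[of lam \<epsilon> "u x t * t powr (p / 2)"] lam \<epsilon> by linarith
    then have "u x t * t powr (p / 2) * t powr (- (p / 2)) \<le> \<epsilon> * t powr (- (p / 2))" by (intro mult_right_mono) auto
    moreover have "t powr (p / 2) * t powr (- (p / 2)) = 1" using t by (simp add: powr_add[symmetric])
    ultimately have "u x t \<le> \<epsilon> * t powr (- (p / 2))" by (simp add: mult.assoc)
    moreover have "- (p / 2) = - (N + 2) / (2 * lam)" unfolding p_def minus_divide_left by simp
    ultimately show ?thesis by (simp only:)
  qed
  moreover have "0 < min t2 T" using t2 T by simp
  ultimately show ?thesis unfolding N_def[symmetric] by blast
qed

end

section \<open>From pointwise rates to Landau symbols\<close>

lemma norm_SUP_le:
  fixes g :: "'b \<Rightarrow> real"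
  assumes "K \<noteq> {}" "\<And>x. x \<in> K \<Longrightarrow> 0 \<le> g x" "\<And>x. x \<in> K \<Longrightarrow> g x \<le> B"
  shows "norm (SUP x\<in>K. g x) \<le> B"
proof -
  obtain x where x: "x \<in> K" using assms by blast
  have "bdd_above (g ` K)" using assms(3) by (intro bdd_aboveI2)
  then have "g x \<le> (SUP x\<in>K. g x)" using x by (intro cSUP_upper)
  then have "0 \<le> (SUP x\<in>K. g x)" using assms(2)[OF x] by linarith
  moreover have "(SUP x\<in>K. g x) \<le> B" using assms by (intro cSUP_least)
  ultimately show ?thesis by simp
qed

text \<open>Serves the case of empty \<open>K\<close>, in which the supremum is some fixed real
  number independent of t; both rates blow up at 0, so any constant is negligible.\<close>

lemma const_in_smallo_powr_at_right_0:
  fixes c a :: real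
  assumes "0 < a"
  shows "(\<lambda>t. c) \<in> o[at_right 0](\<lambda>t. t powr (- a))"
proof (rule smalloI_tendsto)
  have "((\<lambda>t::real. c * t powr a) \<longlongrightarrow> c * 0) (at_right 0)"
    using assms by (intro tendsto_mult_left tendsto_zero_powrI[of "\<lambda>t. t" _ "\<lambda>t. a" a] tendsto_const tendsto_ident_at)
      (auto simp: eventually_at_filter)
  then show "((\<lambda>t. c / t powr (- a)) \<longlongrightarrow> 0) (at_right 0)" by (simp add: powr_minus field_simps)
qed (auto simp: eventually_at_filter)

theorem theorem1p1:
  fixes u :: "'a::euclidean_space \<Rightarrow> real \<Rightarrow> real"
    and \<Omega> K :: "'a set"
    and \<alpha> lam T \<sigma> :: real
  assumes alpha: "0 < \<alpha>" "\<alpha> < real DIM('a) + 2"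
    and lam: "lam > 0" and T: "T > 0"
    and sigma: "0 \<le> \<sigma>" "\<sigma> < g_alpha DIM('a) \<alpha> lam"
    and \<Omega>: "open \<Omega>"
    and nonneg: "\<forall>x. \<forall>t\<in>{0<..<T}. u x t \<ge> 0"
    and C21: "C21_on u T ut ux uxx"
    and L: "set_integrable lborel (UNIV \<times> {0<..<T}) (\<lambda>(x, t). \<bar>u x t\<bar> powr lam)"
    and ineq: "\<forall>x\<in>\<Omega>. \<forall>t\<in>{0<..<T}.
         0 \<le> ut x t - laplacian_of uxx x t \<and>
         ennreal (ut x t - laplacian_of uxx x t) \<le>
           (\<integral>\<^sup>+ z. ennreal (indicator (UNIV \<times> {0<..<T}) z *
               heat_kernel (x - fst z) (t - snd z) powr (\<alpha> / real DIM('a)) *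
               u (fst z) (snd z) powr lam) \<partial>lborel)
           * ennreal (if \<sigma> = 0 then 1 else u x t powr \<sigma>)"
    and K: "compact K" "K \<subseteq> \<Omega>"
  shows "(lam < (real DIM('a) + 2) / real DIM('a) \<longrightarrow>
           (\<lambda>t. SUP x\<in>K. u x t) \<in> O[at_right 0](\<lambda>t. t powr (- real DIM('a) / 2))) \<and>
         (lam \<ge> (real DIM('a) + 2) / real DIM('a) \<longrightarrow>
           (\<lambda>t. SUP x\<in>K. u x t) \<in> o[at_right 0](\<lambda>t. t powr (- (real DIM('a) + 2) / (2 * lam))))"
proof -
  note \<sigma>_less = sigma(2)
  interpret C21_strip u T ut ux uxx by standard (rule C21)
  interpret supersolution u T ut ux uxx \<Omega>
    by standard (use nonneg ineq in \<open>auto simp: source_def\<close>)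
  interpret nonlocal_supersolution u T ut ux uxx \<Omega> \<alpha> lam \<sigma>
  proof
    show "ennreal (source x t) \<le> (\<integral>\<^sup>+s. (\<integral>\<^sup>+y. ennreal (heat_kernel (x - y) (t - s) powr (\<alpha> / real DIM('a)) * uT y s powr lam) \<partial>lborel) \<partial>lborel)
      * ennreal (if \<sigma> = 0 then 1 else u x t powr \<sigma>)" if "x \<in> \<Omega>" "t \<in> {0<..<T}" for x t
      using ineq that unfolding source_def nonlocal_integral_iterated by blast
  qed (use alpha lam sigma in auto)
  note Lfin = power_integral_finite[OF L]
  show ?thesis
  proof (cases "K = {}")
    case True
    define c where "c = (SUP x\<in>K. 0 :: real)"
    have c: "(\<lambda>t. SUP x\<in>K. u x t) = (\<lambda>t. c)" unfolding c_def True by simp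
    have "(\<lambda>t. c) \<in> o[at_right 0](\<lambda>t. t powr (- (real DIM('a) / 2)))"
      "(\<lambda>t. c) \<in> o[at_right 0](\<lambda>t. t powr (- ((real DIM('a) + 2) / (2 * lam))))"
      using lam by (intro const_in_smallo_powr_at_right_0; simp)+
    then show ?thesis unfolding c minus_divide_left using landau_o.small_imp_big by blast
  next
    case False
    show ?thesis
    proof (intro conjI impI)
      assume "lam < (real DIM('a) + 2) / real DIM('a)"
      from subcritical_rate[OF this \<sigma>_less \<Omega> K T Lfin] obtain C t2 where
        t2: "0 < t2" "\<And>x t. x \<in> K \<Longrightarrow> 0 < t \<Longrightarrow> t < t2 \<Longrightarrow> u x t \<le> C * t powr (- real DIM('a) / 2)" by blast
      show "(\<lambda>t. SUP x\<in>K. u x t) \<in> O[at_right 0](\<lambda>t. t powr (- real DIM('a) / 2))"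
      proof (rule bigoI)
        have "\<forall>\<^sub>F t in at_right 0. t \<in> {0<..<min t2 T}"
          using t2 T by (intro eventually_at_right_real) auto
        then show "\<forall>\<^sub>F t in at_right 0. norm (SUP x\<in>K. u x t) \<le> C * norm (t powr (- real DIM('a) / 2))"
        proof eventually_elim
          case (elim t)
          then show ?case using nonneg t2(2) by (intro norm_SUP_le[OF False]) auto
        qed
      qed
    next
      assume sup: "lam \<ge> (real DIM('a) + 2) / real DIM('a)"
      show "(\<lambda>t. SUP x\<in>K. u x t) \<in> o[at_right 0](\<lambda>t. t powr (- (real DIM('a) + 2) / (2 * lam)))"
      proof (rule landau_o.smallI)
        fix c :: real assume "0 < c"
        from supercritical_rate[OF sup \<sigma>_less \<Omega> K T Lfin this] obtain t2 where
          t2: "0 < t2" "\<And>x t. x \<in> K \<Longrightarrow> 0 < t \<Longrightarrow> t < t2 \<Longrightarrow> u x t \<le> c * t powr (- (real DIM('a) + 2) / (2 * lam))" by blast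
        have "\<forall>\<^sub>F t in at_right 0. t \<in> {0<..<min t2 T}"
          using t2 T by (intro eventually_at_right_real) auto
        then show "\<forall>\<^sub>F t in at_right 0. norm (SUP x\<in>K. u x t) \<le> c * norm (t powr (- (real DIM('a) + 2) / (2 * lam)))"
        proof eventually_elim
          case (elim t)
          then show ?case using nonneg t2(2) by (intro norm_SUP_le[OF False]) auto
        qed
      qed
    qed
  qed
qed

end
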